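(* Let $D$ be a first order differential operator satisfying the structural assumptions in the context and let $p\in(1,\infty)$. (1) If $\overline{\mathsf{R}_p(D)}=L^p$, then $\overline{\mathsf{R}_p(D)}$ is stable under multiplication by smooth cut-off functions. (2) If $\overline{\mathsf{R}_p(D)}\ne L^p$, then $\overline{\mathsf{R}_p(D)}$ is stable under multiplication by smooth cut-off functions if and only if $V\perp W$ for the $\mathbb{C}^N$ inner product. This implies that if the situation of (1) (namely $\overline{\mathsf{R}_p(D)}=L^p$) or that of (2) (namely $\overline{\mathsf{R}_p(D)}\ne L^p$ and $\overline{\mathsf{R}_p(D)}$ is stable under multiplication by smooth cut-off functions) holds for one $p\in(1,\infty)$, then it holds for all $p\in(1,\infty)$.
   Context: Let $n,N\in\mathbb{N}^*$ and $L^p:=L^p(\mathbb{R}^n,\mathbb{C}^N)$. Assumptions on $D$: (i) $D=-i\sum_{j=1}^n\hat D_j\partial_j$ with matrices $\hat D_j\in\mathcal{L}(\mathbb{C}^N)$, considered in $L^p$ with its natural domain $\{u\in L^p:Du\in L^p\}$; (ii) there is $\kappa>0$ such that the symbol $\hat D(\xi)=\sum_{j}\hat D_j\xi_j$ satisfies $\kappa|\xi||e|\le|\hat D(\xi)e|$ for all $\xi\in\mathbb{R}^n$ and all $e$ in the range of $\hat D(\xi)$; (iii) there is $\omega_D\in[0,\pi/2)$ such that the spectrum $\sigma(\hat D(\xi))$ is contained in $\{\lambda\in\mathbb{C}\setminus\{0\}:|\arg\lambda|\le\omega_D\text{ or }|\arg(-\lambda)|\le\omega_D\}\cup\{0\}$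 for all $\xi$. $D^*$ is the adjoint of $D$, acting in $L^{p'}$, $p'=p/(p-1)$. $\overline{\mathsf{R}_p(D)}$ is the closure in $L^p$ of the range of $D$ on $L^p$, and $\mathsf{N}_{p'}(D^* )$ is the null space of $D^*$ in $L^{p'}$. A closed subspace $U$ of $L^p$ is stable under multiplication by smooth cut-off functions if $\zeta u\in U$ for every $u\in U$ and every smooth compactly supported complex-valued function $\zeta$ on $\mathbb{R}^n$. $V_p$ is the linear subspace of $\mathbb{C}^N$ generated by the averages $\frac{1}{|Q|}\int_Qv$ over all balls $Q\subset\mathbb{R}^n$ and all $v\in\overline{\mathsf{R}_p(D)}$; $W_{p'}$ is the linear subspace of $\mathbb{C}^N$ generated by the averages $\frac{1}{|Q|}\int_Qw$ over all balls $Q\subset\mathbb{R}^n$ and all $w\in\mathsf{N}_{p'}(D^* )$. These spaces do not depend on $p\in(1,\infty)$ and one sets $V:=V_p$, $W:=W_{p'}$ for any one $p\in(1,\infty)$. *)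

theory Defs
  imports "HOL-Analysis.Analysis"
begin

section \<open>Smooth compactly supported functions\<close>

definition partial_deriv :: "'n::finite \<Rightarrow> (real^'n \<Rightarrow> complex) \<Rightarrow> real^'n \<Rightarrow> complex" where
  "partial_deriv j f x = frechet_derivative f (at x) (axis j 1)"

fun Ck :: "nat \<Rightarrow> (real^'n::finite \<Rightarrow> complex) \<Rightarrow> bool" where
  "Ck 0 f \<longleftrightarrow> continuous_on UNIV f"
| "Ck (Suc k) f \<longleftrightarrow> (\<forall>x. f differentiable (at x)) \<and> (\<forall>j. Ck k (partial_deriv j f))"

definition test_function :: "(real^'n::finite \<Rightarrow> complex) \<Rightarrow> bool" where
  "test_function \<phi> \<longleftrightarrow> (\<forall>k. Ck k \<phi>) \<and> compact (closure {x. \<phi> x \<noteq> 0})"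

section \<open>Lebesgue spaces\<close>

text \<open>
  Elements of \<open>L\<^sup>p\<close> are represented by Borel functions rather than by classes modulo
  null sets (every Lebesgue measurable function agrees almost everywhere with a Borel one).
  Every subset of \<open>L\<^sup>p\<close> named in the theorem is closed under almost everywhere equality,
  so equalities of such sets mean what they mean for classes.
\<close>

definition Lp :: "real \<Rightarrow> (real^'n::finite \<Rightarrow> complex^'N::finite) set" where
  "Lp p = {f. f \<in> borel_measurable lborel \<and> integrable lborel (\<lambda>x. norm (f x) powr p)}"

definition Lp_norm :: "real \<Rightarrow> (real^'n::finite \<Rightarrow> complex^'N::finite) \<Rightarrow> real" where
  "Lp_norm p f = (LINT x|lborel. norm (f x) powr p) powr (1 / p)"

definition Lp_closure ::
    "real \<Rightarrow> (real^'n::finite \<Rightarrow> complex^'N::finite) set \<Rightarrow> (real^'n \<Rightarrow> complex^'N) set" where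
  "Lp_closure p U = {v \<in> Lp p. \<forall>\<epsilon>>0. \<exists>u\<in>U. Lp_norm p (\<lambda>x. v x - u x) < \<epsilon>}"

definition conj_exp :: "real \<Rightarrow> real" where
  "conj_exp p = p / (p - 1)"

text \<open>The library's \<open>inner\<close> on \<open>complex^'N\<close> is only the real part of this inner product.\<close>

definition cinner :: "complex^'N::finite \<Rightarrow> complex^'N \<Rightarrow> complex" where
  "cinner x y = (\<Sum>k\<in>UNIV. x $ k * cnj (y $ k))"

definition perp :: "(complex^'N::finite) set \<Rightarrow> (complex^'N) set \<Rightarrow> bool" where
  "perp V W \<longleftrightarrow> (\<forall>v\<in>V. \<forall>w\<in>W. cinner v w = 0)"

section \<open>The differential operator\<close>

text \<open>\<open>Dh j\<close> is the coefficient matrix of \<open>-i \<partial>\<^sub>j\<close>.\<close>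

definition symbol :: "('n::finite \<Rightarrow> complex^'N::finite^'N) \<Rightarrow> real^'n \<Rightarrow> complex^'N^'N" where
  "symbol Dh \<xi> = (\<Sum>j\<in>UNIV. (\<xi> $ j) *\<^sub>R Dh j)"

definition mat_spectrum :: "complex^'N::finite^'N \<Rightarrow> complex set" where
  "mat_spectrum A = {z. \<not> invertible (mat z - A)}"

definition closed_bisector :: "real \<Rightarrow> complex set" where
  "closed_bisector \<omega> = {z. z \<noteq> 0 \<and> (\<bar>Arg z\<bar> \<le> \<omega> \<or> \<bar>Arg (- z)\<bar> \<le> \<omega>)} \<union> {0}"

text \<open>
  \<open>Du = f\<close> in the sense of distributions. The two minus signs, one from \<open>-i\<close> and one from
  \<open>\<langle>\<partial>\<^sub>j u, \<phi>\<rangle> = - \<langle>u, \<partial>\<^sub>j \<phi>\<rangle>\<close>, cancel.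
\<close>

definition weak_D ::
    "('n::finite \<Rightarrow> complex^'N::finite^'N) \<Rightarrow> (real^'n \<Rightarrow> complex^'N) \<Rightarrow> (real^'n \<Rightarrow> complex^'N) \<Rightarrow> bool"
  where
  "weak_D Dh u f \<longleftrightarrow> (\<forall>\<phi>. test_function \<phi> \<longrightarrow>
     (LINT x|lborel. \<phi> x *s f x) =
       \<i> *s (\<Sum>j\<in>UNIV. Dh j *v (LINT x|lborel. partial_deriv j \<phi> x *s u x)))"

text \<open>
  Operators are represented by their graphs (up to almost everywhere equality).
\<close>

definition D_graph ::
    "('n::finite \<Rightarrow> complex^'N::finite^'N) \<Rightarrow> real \<Rightarrow> ((real^'n \<Rightarrow> complex^'N) \<times> (real^'n \<Rightarrow> complex^'N)) set"
  where
  "D_graph Dh p = {(u, f). u \<in> Lp p \<and> f \<in> Lp p \<and> weak_D Dh u f}"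

definition closed_range ::
    "('n::finite \<Rightarrow> complex^'N::finite^'N) \<Rightarrow> real \<Rightarrow> (real^'n \<Rightarrow> complex^'N) set" where
  "closed_range Dh p = Lp_closure p (Range (D_graph Dh p))"

text \<open>
  Graph of the adjoint of an operator in \<open>L\<^sup>p\<close>, acting in \<open>L\<^sup>p\<^sup>'\<close>,
  for the sesquilinear duality between \<open>L\<^sup>p\<close> and \<open>L\<^sup>p\<^sup>'\<close>.
\<close>

definition adjoint_graph ::
    "real \<Rightarrow> ((real^'n::finite \<Rightarrow> complex^'N::finite) \<times> (real^'n \<Rightarrow> complex^'N)) set
      \<Rightarrow> ((real^'n \<Rightarrow> complex^'N) \<times> (real^'n \<Rightarrow> complex^'N)) set" where
  "adjoint_graph p G = {(w, g). w \<in> Lp (conj_exp p) \<and> g \<in> Lp (conj_exp p) \<and>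
     (\<forall>(u, f)\<in>G. (LINT x|lborel. cinner (f x) (w x)) = (LINT x|lborel. cinner (u x) (g x)))}"

definition null_adjoint ::
    "('n::finite \<Rightarrow> complex^'N::finite^'N) \<Rightarrow> real \<Rightarrow> (real^'n \<Rightarrow> complex^'N) set" where
  "null_adjoint Dh p = {w. (w, \<lambda>x. 0) \<in> adjoint_graph p (D_graph Dh p)}"

definition cutoff_stable :: "(real^'n::finite \<Rightarrow> complex^'N::finite) set \<Rightarrow> bool" where
  "cutoff_stable U \<longleftrightarrow> (\<forall>u\<in>U. \<forall>\<zeta>. test_function \<zeta> \<longrightarrow> (\<lambda>x. \<zeta> x *s u x) \<in> U)"

section \<open>Spaces of averages\<close>

text \<open>
  \<open>vec.span\<close> is the complex span; the plain \<open>span\<close> on \<open>complex^'N\<close> would be the real one.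
\<close>

definition average_span :: "(real^'n::finite \<Rightarrow> complex^'N::finite) set \<Rightarrow> (complex^'N) set" where
  "average_span F = vec.span
     {(1 / measure lborel (ball c r)) *\<^sub>R (LINT x:ball c r|lborel. v x) | c r v. r > 0 \<and> v \<in> F}"

definition V_space :: "('n::finite \<Rightarrow> complex^'N::finite^'N) \<Rightarrow> real \<Rightarrow> (complex^'N) set" where
  "V_space Dh p = average_span (closed_range Dh p)"

text \<open>With \<open>p\<close> as parameter, this is the space \<open>W\<close> for the conjugate exponent \<open>p' = p / (p - 1)\<close>.\<close>

definition W_space :: "('n::finite \<Rightarrow> complex^'N::finite^'N) \<Rightarrow> real \<Rightarrow> (complex^'N) set" where
  "W_space Dh p = average_span (null_adjoint Dh p)"

end

theory Submission
  imports Defs "HOL-Probability.Probability"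
begin

text \<open>
  All conditions turn out to be equivalent to one that does not involve the exponent: the range
  of the symbol \<open>D(\<xi>)\<close>, \<open>\<xi> \<noteq> 0\<close>, is a fixed space, necessarily the span \<open>V\<close> of the ranges of
  the coefficients. The argument avoids Fourier multiplier theorems.

  If \<open>Q(\<xi>)\<close> is a matrix of polynomials with \<open>Q(\<xi>) D(\<xi>) = 0\<close> and generically the kernel of
  \<open>Q(\<xi>)\<close> is the range of \<open>D(\<xi>)\<close>, the rows of \<open>Q\<close> times a Gaussian are Fourier transforms of
  (conjugates of) rapidly decreasing elements \<open>w\<close> of the null space of the adjoint, for every exponent.
  Either stability or \<open>V \<bottom> W\<close> forces \<open>w(x) \<bottom> V\<close> for all \<open>x\<close>, so \<open>Q(\<xi>) V = 0\<close> by Fourier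
  inversion. Hence the range of \<open>D(\<xi>)\<close> is \<open>V\<close> for generic \<open>\<xi>\<close>, and by the lower bound on the
  symbol for all \<open>\<xi> \<noteq> 0\<close>.

  Conversely, if the range of \<open>D(\<xi>)\<close> is \<open>V\<close> for all \<open>\<xi> \<noteq> 0\<close>, there are polynomials \<open>C(\<xi>)\<close> and
  \<open>b(\<xi>) > 0\<close>, \<open>b\<close> homogeneous, with \<open>D(\<xi>) C(\<xi>) v = b(\<xi>) v\<close> for \<open>v \<in> V\<close>. As
  \<open>exp (- s b) - exp (- t b)\<close> is \<open>b\<close> times the integral of \<open>exp (- \<tau> b)\<close> over \<open>s \<le> \<tau> \<le> t\<close>, the
  difference of the two convolutions of a \<open>V\<close>-valued function with the inverse transforms of
  \<open>exp (- s b)\<close> and \<open>exp (- t b)\<close> lies in the range of \<open>D\<close>; for \<open>s \<rightarrow> 0\<close>, \<open>t \<rightarrow> \<infinity>\<close> it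
  approximates the function in \<open>L\<^sup>p\<close>, because the error tends to zero uniformly, is bounded in
  \<open>L\<^sup>1\<close>, and \<open>p > 1\<close>. So the closed range is \<open>L\<^sup>p(V)\<close>.
\<close>

section \<open>Polynomial functions and smoothness\<close>

text \<open>The natural projection onto the closed range would be a Fourier multiplier homogeneous
  of degree zero, hence a singular integral. Only density of the range is needed, and for that
  integrable kernels suffice: an error that is small uniformly and bounded in L^1 is small in L^p.
  The lower bound on the symbol is used in three ways. At a frequency of maximal rank it makes range
  and kernel of D(\<xi>) meet only in 0, so that adding a projection onto the kernel gives an
  invertible matrix. By continuity it carries injectivity on V from generic frequencies to all \<xi>
  \<noteq> 0. Finally it makes the matrix whose determinant yields b(\<xi>) invertible for \<xi>
  \<noteq> 0. Polynomial matrices are what makes one construction serve every exponent: multiplied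
  by a Gaussian they stay rapidly decreasing, which a matrix of rational functions such as the
  projection onto the range need not do. That the closed range is all of L^p adds only the condition
  V = \<complex>^N. Since only smallness of p-th power integrals matters, the inequalities of
  Hoelder and Minkowski are replaced by cruder ones.\<close>

lemma partial_deriv_eq:
  "(f has_derivative f') (at x) \<Longrightarrow> partial_deriv j f x = f' (axis j 1)"
  unfolding partial_deriv_def by (simp add: frechet_derivative_at[symmetric])

lemma partial_deriv_add:
  assumes "f differentiable at x" "g differentiable at x"
  shows "partial_deriv j (\<lambda>x. f x + g x) x = partial_deriv j f x + partial_deriv j g x"
  by (subst partial_deriv_eq[OF has_derivative_add[OF
        assms[unfolded frechet_derivative_works]]]) (simp add: partial_deriv_def)

lemma partial_deriv_mult:
  assumes "f differentiable at x" "g differentiable at x"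
  shows "partial_deriv j (\<lambda>x. f x * g x) x = f x * partial_deriv j g x + partial_deriv j f x * g x"
  by (subst partial_deriv_eq[OF has_derivative_mult[OF
        assms[unfolded frechet_derivative_works]]]) (simp add: partial_deriv_def)

lemma partial_deriv_const [simp]: "partial_deriv j (\<lambda>x. c) = (\<lambda>x. 0)"
  by (rule ext, subst partial_deriv_eq[OF has_derivative_const]) simp

lemma coord_has_derivative:
  "((\<lambda>x::real^'n. complex_of_real (x $ i)) has_derivative (\<lambda>h. complex_of_real (h $ i))) (at x)"
  by (rule bounded_linear.has_derivative[OF _ has_derivative_ident])
     (intro bounded_linear_compose[OF bounded_linear_of_real] bounded_linear_vec_nth)

lemma partial_deriv_coord:
  "partial_deriv j (\<lambda>x::real^'n::finite. complex_of_real (x $ i)) = (\<lambda>x. if i = j then 1 else 0)"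
  by (rule ext, subst partial_deriv_eq[OF coord_has_derivative]) (simp add: axis_def)

text \<open>Polynomial functions of a real vector with complex values, given by generation: closure
  under derivatives, growth bounds and restriction to lines then all follow by induction.\<close>

inductive cpoly :: "(real^'n::finite \<Rightarrow> complex) \<Rightarrow> bool" where
  const: "cpoly (\<lambda>x. c)"
| coord: "cpoly (\<lambda>x. complex_of_real (x $ j))"
| add: "cpoly f \<Longrightarrow> cpoly g \<Longrightarrow> cpoly (\<lambda>x. f x + g x)"
| mult: "cpoly f \<Longrightarrow> cpoly g \<Longrightarrow> cpoly (\<lambda>x. f x * g x)"

lemma cpoly_differentiable: "cpoly f \<Longrightarrow> f differentiable at x"
proof (induction rule: cpoly.induct)
  case (coord j)
  show ?case using coord_has_derivative differentiable_def by blast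
qed auto

lemma cpoly_partial_deriv: "cpoly f \<Longrightarrow> cpoly (partial_deriv j f)"
proof (induction rule: cpoly.induct)
  case (const c)
  show ?case by (simp add: cpoly.const)
next
  case (coord i)
  show ?case unfolding partial_deriv_coord by (rule cpoly.const)
next
  case (add f g)
  then have "partial_deriv j (\<lambda>x. f x + g x) = (\<lambda>x. partial_deriv j f x + partial_deriv j g x)"
    by (intro ext partial_deriv_add) (auto intro: cpoly_differentiable)
  with add show ?case by (simp add: cpoly.add)
next
  case (mult f g)
  then have "partial_deriv j (\<lambda>x. f x * g x) = (\<lambda>x. f x * partial_deriv j g x + partial_deriv j f x * g x)"
    by (intro ext partial_deriv_mult) (auto intro: cpoly_differentiable)
  with mult show ?case by (simp add: cpoly.add cpoly.mult)
qed

lemma cpoly_cmult: "cpoly f \<Longrightarrow> cpoly (\<lambda>x. c * f x)"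
  using cpoly.mult[OF cpoly.const] .

lemma cpoly_uminus: "cpoly f \<Longrightarrow> cpoly (\<lambda>x. - f x)"
  using cpoly_cmult[of f "-1"] by simp

lemma cpoly_diff: "cpoly f \<Longrightarrow> cpoly g \<Longrightarrow> cpoly (\<lambda>x. f x - g x)"
  using cpoly.add[OF _ cpoly_uminus, of f g] by simp

lemma cpoly_sum: "(\<And>i. i \<in> I \<Longrightarrow> cpoly (f i)) \<Longrightarrow> cpoly (\<lambda>x. \<Sum>i\<in>I. f i x)"
  by (induction I rule: infinite_finite_induct) (auto intro: cpoly.intros)

lemma cpoly_prod: "(\<And>i. i \<in> I \<Longrightarrow> cpoly (f i)) \<Longrightarrow> cpoly (\<lambda>x. \<Prod>i\<in>I. f i x)"
  by (induction I rule: infinite_finite_induct) (auto intro: cpoly.intros)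

lemma cpoly_power: "cpoly f \<Longrightarrow> cpoly (\<lambda>x. f x ^ k)"
  by (induction k) (auto intro: cpoly.intros)

lemma cpoly_cnj: "cpoly f \<Longrightarrow> cpoly (\<lambda>x. cnj (f x))"
  by (induction rule: cpoly.induct) (auto intro: cpoly.intros)

lemma cpoly_det:
  fixes M :: "real^'n::finite \<Rightarrow> complex^'m::finite^'m"
  assumes "\<And>i j. cpoly (\<lambda>x. M x $ i $ j)"
  shows "cpoly (\<lambda>x. det (M x))"
  unfolding det_def by (intro cpoly_sum cpoly.mult cpoly.const cpoly_prod assms)

lemma cpoly_continuous: "cpoly f \<Longrightarrow> continuous_on S f"
  by (induction rule: cpoly.induct) (auto intro!: continuous_intros)

lemma cpoly_growth:
  fixes f :: "real^'n::finite \<Rightarrow> complex"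
  assumes "cpoly f"
  obtains C d where "C \<ge> 0" "\<And>x. norm (f x) \<le> C * (1 + norm x) ^ d"
proof -
  from assms have "\<exists>C d. C \<ge> 0 \<and> (\<forall>x. norm (f x) \<le> C * (1 + norm x) ^ d)"
  proof (induction rule: cpoly.induct)
    case (const c)
    show ?case by (rule exI[of _ "norm c"], rule exI[of _ 0]) simp
  next
    case (coord j)
    show ?case
      by (rule exI[of _ 1], rule exI[of _ 1])
         (auto intro: order_trans[OF component_le_norm_cart])
  next
    case (add f g)
    then obtain C d C' d' where *: "C \<ge> 0" "C' \<ge> 0" "\<And>x. norm (f x) \<le> C * (1 + norm x) ^ d"
      "\<And>x. norm (g x) \<le> C' * (1 + norm x) ^ d'" by blast
    show ?case
    proof (intro exI conjI allI)
      show "C + C' \<ge> 0" using * by simp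
      fix x :: "real^'n"
      \<comment> \<open>The base \<open>1 + norm x\<close> is at least 1, so both exponents may be
        raised to their sum.\<close>
      have "C * (1 + norm x) ^ d \<le> C * (1 + norm x) ^ (d + d')"
        "C' * (1 + norm x) ^ d' \<le> C' * (1 + norm x) ^ (d + d')"
        using * by (auto intro!: mult_left_mono power_increasing)
      then show "norm (f x + g x) \<le> (C + C') * (1 + norm x) ^ (d + d')"
        using norm_triangle_ineq[of "f x" "g x"] *(3)[of x] *(4)[of x]
        by (simp add: algebra_simps)
    qed
  next
    case (mult f g)
    then obtain C d C' d' where *: "C \<ge> 0" "C' \<ge> 0" "\<And>x. norm (f x) \<le> C * (1 + norm x) ^ d"
      "\<And>x. norm (g x) \<le> C' * (1 + norm x) ^ d'" by blast
    show ?case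
    proof (intro exI conjI allI)
      show "C * C' \<ge> 0" using * by simp
      fix x :: "real^'n"
      have "norm (f x * g x) \<le> (C * (1 + norm x) ^ d) * (C' * (1 + norm x) ^ d')"
        unfolding norm_mult using * by (intro mult_mono) auto
      then show "norm (f x * g x) \<le> (C * C') * (1 + norm x) ^ (d + d')"
        by (simp add: power_add mult_ac)
    qed
  qed
  then show ?thesis using that by blast
qed

text \<open>Restriction to a line makes the finiteness of the zero set of a polynomial in one
  variable available.\<close>

lemma cpoly_line:
  assumes "cpoly f"
  obtains p where "\<And>t. f (x + t *\<^sub>R y) = poly p (complex_of_real t)"
proof -
  from assms have "\<exists>p. \<forall>t. f (x + t *\<^sub>R y) = poly p (complex_of_real t)"
  proof (induction rule: cpoly.induct)
    case (const c)
    show ?case by (rule exI[of _ "[:c:]"]) simp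
  next
    case (coord j)
    show ?case by (rule exI[of _ "[:of_real (x $ j), of_real (y $ j):]"]) simp
  next
    case (add f g)
    then show ?case by (metis poly_add)
  next
    case (mult f g)
    then show ?case by (metis poly_mult)
  qed
  then show ?thesis using that by blast
qed

text \<open>On the line from a point where \<open>f\<close> does not vanish to \<open>x\<close>, \<open>f\<close> is a nonzero polynomial
  in one variable, so it has no zeros close to \<open>x\<close> except possibly \<open>x\<close>.\<close>

lemma cpoly_nonzero_dense:
  assumes "cpoly f" "f x0 \<noteq> 0"
  shows "\<exists>s. s \<longlonglongrightarrow> x \<and> (\<forall>k::nat. f (s k) \<noteq> 0)"
proof -
  obtain p where p: "\<And>t. f (x + t *\<^sub>R (x0 - x)) = poly p (complex_of_real t)"
    using cpoly_line[OF assms(1)] by blast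
  have "p \<noteq> 0" using p[of 1] assms(2) by auto
  then have fin: "finite {z. poly p z = 0}" by (rule poly_roots_finite)
  have fin': "finite {t. poly p (complex_of_real t) = 0}"
    using finite_imageD[of complex_of_real "{t. poly p (complex_of_real t) = 0}"]
      finite_subset[OF _ fin, of "complex_of_real ` {t. poly p (complex_of_real t) = 0}"]
    by (auto simp: inj_on_def)
  have "\<exists>t. 0 < t \<and> t < 1 / real (Suc k) \<and> poly p (complex_of_real t) \<noteq> 0" for k
  proof (rule ccontr)
    assume "\<not> ?thesis"
    then have "{0<..<1 / real (Suc k)} \<subseteq> {t. poly p (complex_of_real t) = 0}" by auto
    then show False
      using finite_subset fin' infinite_Ioo[of 0 "1 / real (Suc k)"] by (metis of_nat_0_less_iff zero_less_Suc zero_less_divide_1_iff)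
  qed
  then obtain t where t: "\<And>k. 0 < t k" "\<And>k. t k < 1 / real (Suc k)"
      "\<And>k. poly p (complex_of_real (t k)) \<noteq> 0" by metis
  have "t \<longlonglongrightarrow> 0"
    by (rule tendsto_sandwich[OF _ _ tendsto_const LIMSEQ_inverse_real_of_nat])
       (use t in \<open>auto intro!: always_eventually less_imp_le simp: inverse_eq_divide\<close>)
  then have "(\<lambda>k. x + t k *\<^sub>R (x0 - x)) \<longlonglongrightarrow> x + 0 *\<^sub>R (x0 - x)"
    by (intro tendsto_intros)
  then show ?thesis using t(3) p by (intro exI[of _ "\<lambda>k. x + t k *\<^sub>R (x0 - x)"]) auto
qed

section \<open>Differentiability of every finite order\<close>

lemma differentiable_imp_continuous_UNIV:
  "(\<And>x. f differentiable at x) \<Longrightarrow> continuous_on UNIV f"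
  by (simp add: continuous_on_eq_continuous_at differentiable_imp_continuous_within)

lemma Ck_SucD: "Ck (Suc k) f \<Longrightarrow> Ck k f"
proof (induction k arbitrary: f)
  case 0
  then show ?case
    by (auto simp: continuous_on_eq_continuous_at intro: differentiable_imp_continuous_within)
qed simp

lemma Ck_continuous: "Ck k f \<Longrightarrow> continuous_on UNIV f"
proof (induction k)
  case (Suc k)
  then show ?case using Ck_SucD by blast
qed simp

lemma Ck_const: "Ck k (\<lambda>x. c)"
  by (induction k arbitrary: c) auto

lemma Ck_add: "Ck k f \<Longrightarrow> Ck k g \<Longrightarrow> Ck k (\<lambda>x. f x + g x)"
proof (induction k arbitrary: f g)
  case 0
  then show ?case by (auto intro: continuous_intros)
next
  case (Suc k)
  have "partial_deriv j (\<lambda>x. f x + g x) = (\<lambda>x. partial_deriv j f x + partial_deriv j g x)" for j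
    using Suc.prems by (intro ext partial_deriv_add) auto
  with Suc show ?case by auto
qed

lemma Ck_mult: "Ck k f \<Longrightarrow> Ck k g \<Longrightarrow> Ck k (\<lambda>x. f x * g x)"
proof (induction k arbitrary: f g)
  case 0
  then show ?case by (auto intro: continuous_intros)
next
  case (Suc k)
  have "partial_deriv j (\<lambda>x. f x * g x) = (\<lambda>x. f x * partial_deriv j g x + partial_deriv j f x * g x)" for j
    using Suc.prems by (intro ext partial_deriv_mult) auto
  moreover have "Ck k (\<lambda>x. f x * partial_deriv j g x + partial_deriv j f x * g x)" for j
    using Suc.prems Suc.IH Ck_SucD[OF Suc.prems(1)] Ck_SucD[OF Suc.prems(2)]
    by (intro Ck_add) auto
  ultimately show ?case using Suc.prems by auto
qed

lemma Ck_prod: "(\<And>i. i \<in> I \<Longrightarrow> Ck k (f i)) \<Longrightarrow> Ck k (\<lambda>x. \<Prod>i\<in>I. f i x)"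
  by (induction I rule: infinite_finite_induct) (auto intro: Ck_const Ck_mult)

lemma cpoly_Ck: "cpoly f \<Longrightarrow> Ck k f"
  by (induction k arbitrary: f)
     (auto intro: cpoly_continuous cpoly_differentiable cpoly_partial_deriv)

text \<open>Since \<open>partial_deriv\<close> acts on complex functions, the derivative of the real
  function \<open>b\<close> is recovered as the real part of the derivative of its
  embedding.\<close>

lemma real_comp_partial_deriv:
  fixes b :: "real^'n::finite \<Rightarrow> real"
  assumes b: "cpoly (\<lambda>x. complex_of_real (b x))"
    and \<sigma>: "\<And>t. (\<sigma> has_real_derivative \<sigma>' t) (at t)"
  shows "(\<lambda>x. complex_of_real (\<sigma> (b x))) differentiable at x"
    and "partial_deriv j (\<lambda>x. complex_of_real (\<sigma> (b x))) x
      = complex_of_real (\<sigma>' (b x)) * partial_deriv j (\<lambda>x. complex_of_real (b x)) x"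
proof -
  obtain B where B: "((\<lambda>x. complex_of_real (b x)) has_derivative B) (at x)"
    using cpoly_differentiable[OF b] by (auto simp: differentiable_def)
  have b': "(b has_derivative (\<lambda>h. Re (B h))) (at x)"
    using bounded_linear.has_derivative[OF bounded_linear_Re B] by simp
  have 1: "partial_deriv j (\<lambda>x. complex_of_real (b x)) x = complex_of_real (Re (B (axis j 1)))"
    by (rule partial_deriv_eq) (rule has_derivative_of_real[OF b'])
  have "((\<lambda>x. \<sigma> (b x)) has_derivative (\<lambda>h. \<sigma>' (b x) * Re (B h))) (at x)"
    using diff_chain_at[OF b' \<sigma>[unfolded has_field_derivative_def]] by (simp add: o_def)
  from has_derivative_of_real[OF this]
  have 2: "((\<lambda>x. complex_of_real (\<sigma> (b x))) has_derivative (\<lambda>h. complex_of_real (\<sigma>' (b x) * Re (B h)))) (at x)" .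
  then show "(\<lambda>x. complex_of_real (\<sigma> (b x))) differentiable at x"
    by (auto simp: differentiable_def)
  show "partial_deriv j (\<lambda>x. complex_of_real (\<sigma> (b x))) x
      = complex_of_real (\<sigma>' (b x)) * partial_deriv j (\<lambda>x. complex_of_real (b x)) x"
    using partial_deriv_eq[OF 2, of j] 1 by simp
qed

text \<open>Smoothness of a composition is an induction over a whole family of profiles closed under
  differentiation. The families used are the flat functions exp(-1/t) times polynomials in 1/t, the
  multiples of decaying exponentials, and averages of exponentials.\<close>

definition deriv_closed :: "(real \<Rightarrow> real) set \<Rightarrow> bool" where
  "deriv_closed S \<longleftrightarrow> (\<forall>\<sigma>\<in>S. \<exists>\<sigma>'\<in>S. \<forall>t. (\<sigma> has_real_derivative \<sigma>' t) (at t))"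

lemma Ck_comp:
  assumes S: "deriv_closed S" and b: "cpoly (\<lambda>x. complex_of_real (b x))"
  shows "\<sigma> \<in> S \<Longrightarrow> Ck k (\<lambda>x. complex_of_real (\<sigma> (b x)))"
proof (induction k arbitrary: \<sigma>)
  case (0 \<sigma>)
  then obtain \<sigma>' where "\<And>t. (\<sigma> has_real_derivative \<sigma>' t) (at t)"
    using S by (auto simp: deriv_closed_def)
  from differentiable_imp_continuous_UNIV[OF real_comp_partial_deriv(1)[OF b this]] show ?case
    by simp
next
  case (Suc k)
  then obtain \<sigma>' where \<sigma>': "\<sigma>' \<in> S" "\<And>t. (\<sigma> has_real_derivative \<sigma>' t) (at t)"
    using S by (auto simp: deriv_closed_def)
  have "partial_deriv j (\<lambda>x. complex_of_real (\<sigma> (b x)))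
      = (\<lambda>x. complex_of_real (\<sigma>' (b x)) * partial_deriv j (\<lambda>x. complex_of_real (b x)) x)" for j
    by (intro ext real_comp_partial_deriv(2)[OF b \<sigma>'(2)])
  then show ?case
    using real_comp_partial_deriv(1)[OF b \<sigma>'(2)] Suc.IH[OF \<sigma>'(1)]
    by (auto intro!: Ck_mult cpoly_Ck[OF cpoly_partial_deriv] b)
qed

section \<open>Test functions\<close>

text \<open>The polynomial factor is a parameter because all derivatives of exp(-1/t) have this
  shape.\<close>

definition flat_exp :: "real poly \<Rightarrow> real \<Rightarrow> real" where
  "flat_exp p t = (if t > 0 then poly p (inverse t) * exp (- inverse t) else 0)"

lemma poly_times_exp_tendsto_0: "((\<lambda>x. poly p x * exp (- x)) \<longlongrightarrow> 0) at_top" for p :: "real poly"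
proof -
  have "((\<lambda>x. \<Sum>i\<le>degree p. coeff p i * (x ^ i / exp x)) \<longlongrightarrow> (\<Sum>i\<le>degree p. coeff p i * 0)) at_top"
    by (intro tendsto_intros tendsto_power_div_exp_0)
  moreover have "(\<Sum>i\<le>degree p. coeff p i * (x ^ i / exp x)) = poly p x * exp (- x)" for x
    by (simp add: poly_altdef sum_distrib_right exp_minus divide_inverse mult.assoc)
  ultimately show ?thesis by simp
qed

lemma flat_exp_tendsto: "((\<lambda>t. flat_exp p t) \<longlongrightarrow> 0) (at 0)"
proof -
  have "((\<lambda>t. poly p (inverse t) * exp (- inverse t)) \<longlongrightarrow> 0) (at_right 0)"
    by (rule filterlim_compose[OF poly_times_exp_tendsto_0 filterlim_inverse_at_top_right])
  then have "((\<lambda>t. flat_exp p t) \<longlongrightarrow> 0) (at_right 0)"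
    by (rule Lim_transform_eventually)
       (auto simp: eventually_at_filter flat_exp_def)
  moreover have "((\<lambda>t. flat_exp p t) \<longlongrightarrow> 0) (at_left 0)"
    by (rule Lim_transform_eventually[OF tendsto_const])
       (auto simp: eventually_at_filter flat_exp_def)
  ultimately show ?thesis by (simp add: filterlim_split_at)
qed

text \<open>With y = 1/t one has dy/dt = -y^2, so the derivative of p(y) exp(-y) is y^2 (p(y) -
  p'(y)) exp(-y); this is the origin of the new polynomial.\<close>

lemma flat_exp_has_derivative:
  "(flat_exp p has_real_derivative flat_exp ([:0,0,1:] * (p - pderiv p)) t) (at t)"
proof (cases t "0::real" rule: linorder_cases)
  case less
  have "((\<lambda>t. 0::real) has_real_derivative 0) (at t)" by simp
  then have "(flat_exp p has_real_derivative 0) (at t)"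
    by (rule DERIV_cong_ev[OF refl _ refl, THEN iffD1, rotated])
       (use eventually_nhds_in_open[of "{..<0}" t] less in
         \<open>auto simp: flat_exp_def elim!: eventually_mono\<close>)
  with less show ?thesis by (simp add: flat_exp_def)
next
  case greater
  have "((\<lambda>t. poly p (inverse t) * exp (- inverse t)) has_real_derivative
      flat_exp ([:0,0,1:] * (p - pderiv p)) t) (at t)"
    using greater
    by (auto intro!: derivative_eq_intros DERIV_chain2[OF poly_DERIV] simp: flat_exp_def field_simps power2_eq_square)
  then show ?thesis
    by (rule DERIV_cong_ev[OF refl _ refl, THEN iffD1, rotated])
       (use eventually_nhds_in_open[of "{0<..}" t] greater in
         \<open>auto simp: flat_exp_def elim!: eventually_mono\<close>)
next
  case equal
  \<comment> \<open>The difference quotient at 0 is itself a flat function: the factor 1/h is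
    absorbed into the polynomial.\<close>
  have "((\<lambda>h. (flat_exp p (0 + h) - flat_exp p 0) / h) \<longlongrightarrow> 0) (at 0)"
    by (rule Lim_transform_eventually[OF flat_exp_tendsto[of "[:0,1:] * p"]])
       (auto simp: eventually_at_filter flat_exp_def divide_inverse)
  then show ?thesis unfolding equal DERIV_def by (simp add: flat_exp_def)
qed

lemma deriv_closed_flat_exp: "deriv_closed (range flat_exp)"
  unfolding deriv_closed_def using flat_exp_has_derivative by blast

text \<open>Positive exactly on the box and below 1 everywhere, so that the powers of
  \<open>1 - bump a b x\<close> decrease to the indicator of the complement of the box.\<close>

definition bump :: "real^'n::finite \<Rightarrow> real^'n \<Rightarrow> real^'n \<Rightarrow> real" where
  "bump a b x = (\<Prod>i\<in>UNIV. flat_exp 1 (x $ i - a $ i) * flat_exp 1 (b $ i - x $ i))"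

lemma flat_exp_1: "0 \<le> flat_exp 1 t" "flat_exp 1 t < 1" "flat_exp 1 t > 0 \<longleftrightarrow> t > 0"
  by (auto simp: flat_exp_def)

lemma bump_bounds:
  fixes a b x :: "real^'n::finite"
  shows "0 \<le> bump a b x" "bump a b x < 1" "bump a b x > 0 \<longleftrightarrow> x \<in> box a b"
proof -
  let ?f = "\<lambda>i. flat_exp 1 (x $ i - a $ i) * flat_exp 1 (b $ i - x $ i)"
  have f: "0 \<le> ?f i" "?f i < 1" for i
    using flat_exp_1 mult_strict_mono[of "flat_exp 1 (x $ i - a $ i)" 1 "flat_exp 1 (b $ i - x $ i)" 1]
    by auto
  then show 0: "0 \<le> bump a b x" unfolding bump_def by (intro prod_nonneg) auto
  show "bump a b x < 1"
  proof -
    \<comment> \<open>The index type is nonempty, so one factor strictly below 1 can be split off;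
      the remaining ones are at most 1.\<close>
    obtain i :: 'n where True by blast
    have "bump a b x = ?f i * (\<Prod>i\<in>UNIV - {i}. ?f i)"
      unfolding bump_def by (simp add: prod.remove)
    also have "\<dots> \<le> ?f i * 1"
      using f by (intro mult_left_mono prod_le_1) (auto intro: less_imp_le)
    finally show ?thesis using f[of i] by simp
  qed
  have "bump a b x > 0 \<longleftrightarrow> bump a b x \<noteq> 0" using 0 by auto
  also have "\<dots> \<longleftrightarrow> (\<forall>i. flat_exp 1 (x $ i - a $ i) \<noteq> 0 \<and> flat_exp 1 (b $ i - x $ i) \<noteq> 0)"
    unfolding bump_def by auto
  also have "\<dots> \<longleftrightarrow> x \<in> box a b"
    by (auto simp: mem_box_cart flat_exp_def not_le)
  finally show "bump a b x > 0 \<longleftrightarrow> x \<in> box a b" .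
qed

lemma Ck_bump: "Ck k (\<lambda>x. complex_of_real (bump a b x))"
proof -
  have "Ck k (\<lambda>x. complex_of_real (flat_exp 1 (x $ i - a $ i)))" for i
    by (rule Ck_comp[OF deriv_closed_flat_exp])
       (auto intro!: cpoly.coord cpoly.const cpoly_diff)
  moreover have "Ck k (\<lambda>x. complex_of_real (flat_exp 1 (b $ i - x $ i)))" for i
    by (rule Ck_comp[OF deriv_closed_flat_exp])
       (auto intro!: cpoly.coord cpoly.const cpoly_diff)
  ultimately show ?thesis
    unfolding bump_def of_real_prod of_real_mult by (intro Ck_prod Ck_mult)
qed

lemma compact_support_boxI:
  assumes "\<And>x. x \<notin> box a b \<Longrightarrow> f x = 0"
  shows "compact (closure {x::real^'n. f x \<noteq> 0})"
proof -
  have "closure {x. f x \<noteq> 0} \<subseteq> cbox a b"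
    by (rule closure_minimal) (use assms box_subset_cbox in auto)
  then show ?thesis using compact_cbox closed_closure
    by (metis compact_Int_closed inf.absorb_iff2)
qed

text \<open>Smooth functions increasing to the indicator function of the box.\<close>

lemma test_function_box:
  "test_function (\<lambda>x. complex_of_real (1 - (1 - bump a b x) ^ k))"
proof -
  have eq: "complex_of_real (1 - (1 - bump a b x) ^ k)
      = 1 + - 1 * (\<Prod>i\<in>{..<k}. 1 + - 1 * complex_of_real (bump a b x))" for x by simp
  have "Ck m (\<lambda>x. complex_of_real (1 - (1 - bump a b x) ^ k))" for m
    unfolding eq by (intro Ck_add Ck_mult Ck_const Ck_prod Ck_bump)
  moreover have "bump a b x = 0" if "x \<notin> box a b" for x
    using bump_bounds[of a b x] that by auto
  ultimately show ?thesis unfolding test_function_def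
    by (intro conjI allI compact_support_boxI[of a b]) auto
qed

lemma box_approx:
  "(\<lambda>k. 1 - (1 - bump a b x) ^ k) \<longlonglongrightarrow> indicator (box a b) x"
proof (cases "x \<in> box a b")
  case True
  then have "norm (1 - bump a b x) < 1"
    using bump_bounds(1,2)[of a b x] bump_bounds(3)[of a b x] by simp
  then have "(\<lambda>k. (1 - bump a b x) ^ k) \<longlonglongrightarrow> 0"
    by (rule LIMSEQ_power_zero)
  from tendsto_diff[OF tendsto_const[of 1] this]
  have "(\<lambda>k. 1 - (1 - bump a b x) ^ k) \<longlonglongrightarrow> 1 - 0" .
  with True show ?thesis by simp
next
  case False
  then have "bump a b x = 0" using bump_bounds[of a b x] by auto
  then show ?thesis using False by simp
qed

lemma test_functionD:
  assumes "test_function \<phi>"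
  shows "Ck k \<phi>" "\<phi> differentiable at x" "continuous_on UNIV \<phi>"
    "continuous_on UNIV (partial_deriv j \<phi>)"
proof -
  show *: "Ck k \<phi>" for k using assms by (simp add: test_function_def)
  from *[of 1] show "\<phi> differentiable at x" "continuous_on UNIV (partial_deriv j \<phi>)" by auto
  from *[of 0] show "continuous_on UNIV \<phi>" by simp
qed

lemma zero_outside_support: "x \<notin> closure {x. f x \<noteq> 0} \<Longrightarrow> f x = 0"
  by (rule ccontr) (metis (mono_tags, lifting) closure_subset mem_Collect_eq subsetD)

lemma partial_deriv_support:
  assumes "x \<notin> closure {x. \<phi> x \<noteq> 0}"
  shows "partial_deriv j \<phi> x = 0"
proof -
  have ev: "\<forall>\<^sub>F y in nhds x. y \<in> - closure {x. \<phi> x \<noteq> 0}"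
    by (rule eventually_nhds_in_open[OF open_Compl[OF closed_closure]]) (use assms in blast)
  have 0: "\<phi> y = 0" if "y \<notin> closure {x. \<phi> x \<noteq> 0}" for y
    using that zero_outside_support[of y \<phi>] by simp
  have "\<forall>\<^sub>F y in at x. 0 = \<phi> y"
    unfolding eventually_at_filter
  proof (rule eventually_mono[OF ev])
    fix y assume "y \<in> - closure {x. \<phi> x \<noteq> 0}"
    then have "\<phi> y = 0" by (intro 0) simp
    then show "y \<noteq> x \<longrightarrow> y \<in> UNIV \<longrightarrow> 0 = \<phi> y" by metis
  qed
  from has_derivative_transform_eventually[OF has_derivative_const this _ UNIV_I]
  have "(\<phi> has_derivative (\<lambda>h. 0)) (at x)" using 0[OF assms] by metis
  from partial_deriv_eq[OF this] show ?thesis .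
qed

lemma test_function_partial_deriv: "test_function \<phi> \<Longrightarrow> test_function (partial_deriv j \<phi>)"
proof -
  assume \<phi>: "test_function \<phi>"
  have "Ck k (partial_deriv j \<phi>)" for k
    using test_functionD(1)[OF \<phi>, of "Suc k"] by simp
  moreover have "closure {x. partial_deriv j \<phi> x \<noteq> 0} \<subseteq> closure {x. \<phi> x \<noteq> 0}"
    by (rule closure_minimal) (use partial_deriv_support[of _ \<phi> j] in blast, simp)
  ultimately show ?thesis using \<phi> unfolding test_function_def
    by (metis closed_closure compact_Int_closed inf.absorb_iff2)
qed

lemma test_function_bounded:
  assumes "test_function \<phi>"
  obtains B R where "B \<ge> 0" "R > 0" "\<And>x. norm (\<phi> x) \<le> B" "\<And>x. norm x > R \<Longrightarrow> \<phi> x = 0"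
proof -
  let ?K = "closure {x. \<phi> x \<noteq> 0}"
  have K: "compact ?K" using assms by (simp add: test_function_def)
  have "bounded (\<phi> ` ?K)"
    by (intro compact_imp_bounded compact_continuous_image K continuous_on_subset[OF test_functionD(3)[OF assms]]) auto
  then obtain B where B: "\<And>x. x \<in> ?K \<Longrightarrow> norm (\<phi> x) \<le> B" by (auto simp: bounded_iff)
  obtain R where R: "R > 0" "\<And>x. x \<in> ?K \<Longrightarrow> norm x \<le> R"
    using compact_imp_bounded[OF K] by (auto simp: bounded_pos)
  have out: "\<phi> x = 0" if "x \<notin> ?K" for x using that zero_outside_support[of x \<phi>] by simp
  show ?thesis
  proof (rule that[of "max 0 B" R])
    show "norm (\<phi> x) \<le> max 0 B" for x
    proof (cases "x \<in> ?K")
      case True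
      then show ?thesis by (rule order_trans[OF B max.cobounded2])
    next
      case False
      then have "\<phi> x = 0" by (rule out)
      then show ?thesis by simp
    qed
    show "\<phi> x = 0" if "norm x > R" for x using R(2)[of x] out[of x] that by (meson not_le)
  qed (use R in auto)
qed

section \<open>Lebesgue measure on \<open>\<real>\<^sup>n\<close>\<close>

lemma lborel_affine_integral:
  fixes f :: "'a::euclidean_space \<Rightarrow> 'b::{banach, second_countable_topology}"
  assumes f: "integrable lborel f" and c: "c \<noteq> 0"
  shows "integrable lborel (\<lambda>x. f (t + c *\<^sub>R x))"
    and "(LINT x|lborel. f x) = \<bar>c\<bar> ^ DIM('a) *\<^sub>R (LINT x|lborel. f (t + c *\<^sub>R x))"
proof -
  let ?T = "\<lambda>x::'a. t + c *\<^sub>R x"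
  have [measurable]: "f \<in> borel_measurable borel" using f by auto
  have eq: "(lborel :: 'a measure) = density (distr lborel borel ?T) (\<lambda>_. ennreal (\<bar>c\<bar> ^ DIM('a)))"
    using lborel_affine[OF c, of t] by (simp add: ennreal_power)
  have "integrable (density (distr lborel borel ?T) (\<lambda>_. ennreal (\<bar>c\<bar> ^ DIM('a)))) f"
    using f by (subst eq[symmetric])
  then have "integrable lborel (\<lambda>x. (\<bar>c\<bar> ^ DIM('a)) *\<^sub>R f (?T x))"
    by (subst (asm) integrable_density) (auto simp: integrable_distr_eq)
  from integrable_scaleR_right[OF this, of "inverse (\<bar>c\<bar> ^ DIM('a))"]
  show "integrable lborel (\<lambda>x. f (t + c *\<^sub>R x))" using c by simp
  have "(LINT x|lborel. f x) = (LINT x|density (distr lborel borel ?T) (\<lambda>_. ennreal (\<bar>c\<bar> ^ DIM('a))). f x)"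
    by (subst eq) simp
  also have "\<dots> = \<bar>c\<bar> ^ DIM('a) *\<^sub>R (LINT x|lborel. f (?T x))"
    by (subst integral_density) (auto simp: integral_distr)
  finally show "(LINT x|lborel. f x) = \<bar>c\<bar> ^ DIM('a) *\<^sub>R (LINT x|lborel. f (t + c *\<^sub>R x))" .
qed

lemma lborel_shift_integral:
  fixes f :: "'a::euclidean_space \<Rightarrow> 'b::{banach, second_countable_topology}"
  assumes f: "integrable lborel f"
  shows "integrable lborel (\<lambda>x. f (x + t))" "(LINT x|lborel. f (x + t)) = (LINT x|lborel. f x)"
    "integrable lborel (\<lambda>x. f (x - t))" "(LINT x|lborel. f (x - t)) = (LINT x|lborel. f x)"
  using lborel_affine_integral[OF f, of 1 t] lborel_affine_integral[OF f, of 1 "- t"]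
  by (simp_all add: add.commute)

section \<open>Integrability on product spaces\<close>

lemma integrable_pair_mult:
  fixes a :: "'a::euclidean_space \<Rightarrow> complex" and c :: "'b::euclidean_space \<Rightarrow> complex"
  assumes [measurable]: "integrable lborel a" "integrable lborel c"
  shows "integrable (lborel \<Otimes>\<^sub>M lborel) (\<lambda>(x, y). a x * c y)"
proof (rule lborel_pair.Fubini_integrable)
  have [measurable]: "a \<in> borel_measurable borel" "c \<in> borel_measurable borel" using assms by auto
  show "(\<lambda>(x, y). a x * c y) \<in> borel_measurable (lborel \<Otimes>\<^sub>M lborel)" by measurable
qed (use assms in \<open>auto simp: norm_mult\<close>)

text \<open>By translation invariance the inner integral of the norm is \<open>norm (a y)\<close>
  times the L^1 norm of \<open>c\<close>, whatever \<open>t\<close> is. The case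
  \<open>t = 1\<close> serves ordinary convolutions, general \<open>t\<close> the rescaled
  ones.\<close>

lemma integrable_pair_shift:
  fixes a c :: "'a::euclidean_space \<Rightarrow> complex"
  assumes "integrable lborel a" "integrable lborel c"
  shows "integrable (lborel \<Otimes>\<^sub>M lborel) (\<lambda>(y, x). c (x - t *\<^sub>R y) * a y)"
    and "integrable (lborel \<Otimes>\<^sub>M lborel) (\<lambda>(x, y). c (x - t *\<^sub>R y) * a y)"
proof -
  have [measurable]: "a \<in> borel_measurable borel" "c \<in> borel_measurable borel" using assms by auto
  show *: "integrable (lborel \<Otimes>\<^sub>M lborel) (\<lambda>(y, x). c (x - t *\<^sub>R y) * a y)"
  proof (rule lborel_pair.Fubini_integrable)
    show "(\<lambda>(y, x). c (x - t *\<^sub>R y) * a y) \<in> borel_measurable (lborel \<Otimes>\<^sub>M lborel)" by measurable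
    have "(LINT x|lborel. norm (c (x - t *\<^sub>R y) * a y)) = norm (a y) * (LINT x|lborel. norm (c x))" for y
      using lborel_shift_integral(4)[of "\<lambda>x. norm (c x)" "t *\<^sub>R y"] assms by (simp add: norm_mult)
    then show "integrable lborel (\<lambda>y. LINT x|lborel. norm (case (y, x) of (y, x) \<Rightarrow> c (x - t *\<^sub>R y) * a y))"
      using assms by simp
    show "AE y in lborel. integrable lborel (\<lambda>x. case (y, x) of (y, x) \<Rightarrow> c (x - t *\<^sub>R y) * a y)"
      using lborel_shift_integral(3)[OF assms(2)] by simp
  qed
  from lborel_pair.integrable_product_swap[OF this]
  show "integrable (lborel \<Otimes>\<^sub>M lborel) (\<lambda>(x, y). c (x - t *\<^sub>R y) * a y)" by (simp add: case_prod_unfold)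
qed

text \<open>Lebesgue measure is the image of a product measure indexed by the basis vectors; the
  proof reindexes it along \<open>axis\<close> by the coordinates and applies Fubini for product
  functions.\<close>

lemma lborel_prod_integral:
  fixes g :: "'n::finite \<Rightarrow> real \<Rightarrow> complex"
  assumes g: "\<And>i. integrable lborel (g i)"
  shows "integrable lborel (\<lambda>x::real^'n. \<Prod>i\<in>UNIV. g i (x $ i))"
    and "integral\<^sup>L lborel (\<lambda>x::real^'n. \<Prod>i\<in>UNIV. g i (x $ i)) = (\<Prod>i\<in>UNIV. LINT t|lborel. g i t)"
proof -
  interpret product_sigma_finite "\<lambda>_::real^'n. lborel :: real measure" ..
  let ?T = "\<lambda>f. \<Sum>b\<in>Basis. f b *\<^sub>R (b :: real^'n)"
  have [measurable]: "g i \<in> borel_measurable borel" for i using g[of i] by auto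
  have Basis: "Basis = (\<lambda>i. axis i (1::real) :: real^'n) ` UNIV"
    by (auto simp: Basis_vec_def)
  have inj: "inj (\<lambda>i. axis i (1::real) :: real^'n)"
    by (auto simp: inj_on_def axis_eq_axis)
  have T: "?T f $ i = f (axis i 1)" for f i
  proof -
    have "?T f $ i = (\<Sum>j\<in>UNIV. f (axis j 1) * (if i = j then 1 else 0))"
      unfolding Basis by (subst sum.reindex[OF inj]) (simp add: sum_component axis_def if_distrib cong: if_cong)
    also have "\<dots> = (\<Sum>j\<in>UNIV. if i = j then f (axis j 1) else 0)"
      by (rule sum.cong) auto
    finally show ?thesis by simp
  qed
  have prod_eq: "(\<Prod>i\<in>UNIV. g i (?T f $ i)) = (\<Prod>b\<in>Basis. g (axis_index b) (f b))" for f
    unfolding T unfolding Basis by (subst prod.reindex[OF inj]) simp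
  let ?F = "\<lambda>x::real^'n. \<Prod>i\<in>UNIV. g i (x $ i)"
  have F: "?F \<in> borel_measurable borel" by measurable
  have T': "?T \<in> (\<Pi>\<^sub>M b\<in>Basis. lborel) \<rightarrow>\<^sub>M borel" by measurable
  have eq: "(lborel :: (real^'n) measure) = distr (\<Pi>\<^sub>M b\<in>Basis. lborel) borel ?T"
    by (rule lborel_eq)
  have "integrable (distr (\<Pi>\<^sub>M b\<in>Basis. lborel) borel ?T) ?F"
    unfolding integrable_distr_eq[OF T' F] prod_eq
    by (rule product_integrable_prod) (auto intro: g)
  then show "integrable lborel ?F" unfolding eq .
  have "integral\<^sup>L (distr (\<Pi>\<^sub>M b\<in>Basis. lborel) borel ?T) ?F
      = (\<Prod>b\<in>Basis. LINT t|lborel. g (axis_index (b :: real^'n)) t)"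
    unfolding integral_distr[OF T' F] prod_eq
    by (rule product_integral_prod) (auto intro: g)
  also have "\<dots> = (\<Prod>i\<in>UNIV. LINT t|lborel. g i t)"
    unfolding Basis by (subst prod.reindex[OF inj]) simp
  finally show "integral\<^sup>L lborel ?F = (\<Prod>i\<in>UNIV. LINT t|lborel. g i t)" unfolding eq .
qed

lemma integrable_compact_support:
  fixes f :: "real^'n::finite \<Rightarrow> 'b::{banach, second_countable_topology}"
  assumes "continuous_on UNIV f" and "\<And>x. norm x > R \<Longrightarrow> f x = 0"
  shows "integrable lborel f"
proof -
  have "integrable lborel (\<lambda>x. indicator (cball 0 R) x *\<^sub>R f x)"
    by (rule borel_integrable_compact[OF compact_cball continuous_on_subset[OF assms(1)]]) simp
  also have "(\<lambda>x. indicator (cball 0 R) x *\<^sub>R f x) = f"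
    using assms(2) by (auto simp: fun_eq_iff indicator_def)
  finally show ?thesis .
qed

lemma partial_deriv_line:
  assumes "f differentiable at (x + s *\<^sub>R axis j 1)"
  shows "((\<lambda>s. f (x + s *\<^sub>R axis j 1)) has_vector_derivative partial_deriv j f (x + s *\<^sub>R axis j 1)) (at s within S)"
proof -
  let ?D = "frechet_derivative f (at (x + s *\<^sub>R axis j 1))"
  have D: "(f has_derivative ?D) (at (x + s *\<^sub>R axis j 1))"
    using assms frechet_derivative_works by blast
  have "((\<lambda>s. x + s *\<^sub>R axis j 1) has_derivative (\<lambda>h. h *\<^sub>R axis j 1)) (at s)"
    by (auto intro!: derivative_eq_intros)
  from diff_chain_at[OF this D] have "((\<lambda>s. f (x + s *\<^sub>R axis j 1)) has_derivative (\<lambda>h. ?D (h *\<^sub>R axis j 1))) (at s)"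
    by (simp add: o_def)
  moreover have "?D (h *\<^sub>R axis j 1) = h *\<^sub>R partial_deriv j f (x + s *\<^sub>R axis j 1)" for h
    using linear_scale[OF has_derivative_linear[OF D]] by (simp add: partial_deriv_def)
  ultimately show ?thesis
    unfolding has_vector_derivative_def by (auto intro: has_derivative_at_withinI)
qed

text \<open>Integrate \<open>f (x + e\<^sub>j) - f x = \<integral>\<^sub>0\<^sup>1 \<partial>\<^sub>j f (x + s e\<^sub>j) ds\<close> over \<open>x\<close>.\<close>

lemma integral_partial_deriv_eq_0:
  fixes f :: "real^'n::finite \<Rightarrow> complex"
  assumes f: "\<And>x. f differentiable at x" "integrable lborel f"
    and f': "continuous_on UNIV (partial_deriv j f)" "integrable lborel (partial_deriv j f)"
  shows "(LINT x|lborel. partial_deriv j f x) = 0"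
proof -
  let ?e = "axis j (1::real) :: real^'n"
  let ?F = "\<lambda>x s. indicator {0..1::real} s *\<^sub>R partial_deriv j f (x + s *\<^sub>R ?e)"
  have [measurable]: "partial_deriv j f \<in> borel_measurable borel" using f' by auto
  have shift: "(LINT x|lborel. g (x + s *\<^sub>R ?e)) = (LINT x|lborel. g x)"
    if "integrable lborel g" for s and g :: "real^'n \<Rightarrow> 'x::{banach, second_countable_topology}"
    using lborel_shift_integral(2)[OF that] by simp
  have "integrable (lborel \<Otimes>\<^sub>M lborel) (\<lambda>(s, x). ?F x s)"
  proof (rule lborel_pair.Fubini_integrable)
    show "(\<lambda>(s, x). ?F x s) \<in> borel_measurable (lborel \<Otimes>\<^sub>M lborel)" by measurable
    have "(LINT x|lborel. norm (?F x s)) = indicator {0..1} s * (LINT x|lborel. norm (partial_deriv j f x))" for s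
      using shift[of "\<lambda>x. norm (partial_deriv j f x)"] f' by (simp add: indicator_def)
    moreover have "integrable lborel (indicator {0..1::real} :: real \<Rightarrow> real)" by simp
    ultimately show "integrable lborel (\<lambda>s. LINT x|lborel. norm (case (s, x) of (s, x) \<Rightarrow> ?F x s))"
      unfolding prod.case by (simp only:) simp
    show "AE s in lborel. integrable lborel (\<lambda>x. case (s, x) of (s, x) \<Rightarrow> ?F x s)"
      using lborel_shift_integral(1)[OF f'(2)] by simp
  qed
  from lborel_pair.Fubini_integral[OF this]
  have "(LINT x|lborel. LINT s|lborel. ?F x s) = (LINT s|lborel. LINT x|lborel. ?F x s)" .
  moreover have "(LINT s|lborel. ?F x s) = f (x + ?e) - f x" for x
  proof -
    have "(LINT s|lborel. ?F x s) = f (x + 1 *\<^sub>R ?e) - f (x + 0 *\<^sub>R ?e)"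
      by (rule integral_FTC_Icc[of 0 1 "\<lambda>s. f (x + s *\<^sub>R ?e)"])
         (auto intro!: partial_deriv_line f continuous_on_compose2[OF f'(1)] continuous_intros)
    then show ?thesis by simp
  qed
  moreover have "(LINT x|lborel. f (x + ?e) - f x) = 0"
    using lborel_shift_integral[OF f(2), of ?e] f(2) by simp
  moreover have "(LINT s|lborel. LINT x|lborel. ?F x s) = (LINT x|lborel. partial_deriv j f x)"
    using shift[OF f'(2)] by simp
  ultimately show ?thesis by simp
qed

lemma integral_by_parts_test_function:
  assumes \<phi>: "test_function \<phi>" and g: "\<And>x. g differentiable at x" "continuous_on UNIV (partial_deriv j g)"
  shows "(LINT x|lborel. partial_deriv j \<phi> x * g x) = - (LINT x|lborel. \<phi> x * partial_deriv j g x)"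
proof -
  obtain R where R: "\<And>x. norm x > R \<Longrightarrow> \<phi> x = 0"
    by (rule test_function_bounded[OF \<phi>]) (rule that)
  obtain R' where R': "\<And>x. norm x > R' \<Longrightarrow> partial_deriv j \<phi> x = 0"
    by (rule test_function_bounded[OF test_function_partial_deriv[OF \<phi>]]) (rule that)
  have gc: "continuous_on UNIV g" by (rule differentiable_imp_continuous_UNIV[OF g(1)])
  note c = test_functionD(3,4)[OF \<phi>]
  have i1: "integrable lborel (\<lambda>x. \<phi> x * g x)"
    by (rule integrable_compact_support[of _ R]) (auto intro!: continuous_intros c gc simp: R)
  have i2: "integrable lborel (\<lambda>x. \<phi> x * partial_deriv j g x)"
    by (rule integrable_compact_support[of _ R]) (auto intro!: continuous_intros c g simp: R)
  have i3: "integrable lborel (\<lambda>x. partial_deriv j \<phi> x * g x)"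
    by (rule integrable_compact_support[of _ R']) (auto intro!: continuous_intros c gc simp: R')
  have eq: "partial_deriv j (\<lambda>x. \<phi> x * g x) = (\<lambda>x. \<phi> x * partial_deriv j g x + partial_deriv j \<phi> x * g x)"
    by (intro ext partial_deriv_mult test_functionD[OF \<phi>] g)
  have "(LINT x|lborel. partial_deriv j (\<lambda>x. \<phi> x * g x) x) = 0"
    by (rule integral_partial_deriv_eq_0)
       (auto intro!: i1 i2 i3 continuous_intros c gc g differentiable_mult test_functionD(2)[OF \<phi>] simp: eq)
  then show ?thesis unfolding eq using i2 i3 by (simp add: eq_neg_iff_add_eq_0 add.commute)
qed

section \<open>Functions with vanishing integrals\<close>

text \<open>A \<pi>-\<lambda> argument: boxes are stable under intersection and generate the Borel
  sets, and the sets over which the integral vanishes are closed under complements and disjoint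
  unions. Testing with the sets where \<open>f\<close> has one sign then gives the claim.\<close>

lemma AE_zero_if_box_integrals_zero:
  fixes f :: "'a::euclidean_space \<Rightarrow> real"
  assumes f: "integrable lborel f" and box: "\<And>a b. (LINT x|lborel. indicator (box a b) x * f x) = 0"
  shows "AE x in lborel. f x = 0"
proof -
  have [measurable]: "f \<in> borel_measurable borel" using f by auto
  let ?G = "range (\<lambda>(a, b). box a b :: 'a set)"
  have ind: "integrable lborel (\<lambda>x. indicator A x * f x)" if "A \<in> sets borel" for A
    using integrable_mult_indicator[OF _ f, of A] that by simp
  \<comment> \<open>Complements in the Dynkin induction need the integral over the whole space,
    which is exhausted by boxes.\<close>
  have total: "(LINT x|lborel. f x) = 0"
  proof -
    let ?A = "\<lambda>k. box (- real k *\<^sub>R One) (real k *\<^sub>R One) :: 'a set"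
    have "(\<lambda>k. LINT x|lborel. indicator (?A k) x * f x) \<longlonglongrightarrow> (LINT x|lborel. f x)"
    proof (rule integral_dominated_convergence[where w = "\<lambda>x. norm (f x)"])
      show "AE x in lborel. (\<lambda>k. indicator (?A k) x * f x) \<longlonglongrightarrow> f x"
      proof (rule AE_I2)
        fix x :: 'a
        obtain m :: nat where m: "norm x < real m" using reals_Archimedean2 by blast
        have "x \<in> ?A k" if "k \<ge> m" for k
          using m that Basis_le_norm[of _ x] by (fastforce simp: mem_box)
        then have "\<forall>\<^sub>F k in sequentially. indicator (?A k) x * f x = f x"
          by (auto simp: eventually_sequentially intro!: exI[of _ m])
        then show "(\<lambda>k. indicator (?A k) x * f x) \<longlonglongrightarrow> f x" by (rule tendsto_eventually)
      qed
    qed (use f in \<open>auto simp: indicator_def\<close>)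
    then show ?thesis unfolding box by (simp add: LIMSEQ_const_iff)
  qed
  have zero: "(LINT x|lborel. indicator A x * f x) = 0" if A: "A \<in> sets borel" for A
  proof -
    have "Int_stable ?G"
      by (auto simp: Int_stable_def box_Int_box)
    moreover have "?G \<subseteq> Pow UNIV" by simp
    moreover have sets_eq: "sets borel = sigma_sets UNIV ?G" by (subst borel_eq_box) simp
    with A have "A \<in> sigma_sets UNIV ?G" by simp
    ultimately show ?thesis
    proof (induction rule: sigma_sets_induct_disjoint)
      case (basic A)
      then show ?case using box by auto
    next
      case (compl A)
      then have A: "A \<in> sets borel" using sets_eq by simp
      have "(LINT x|lborel. indicator (UNIV - A) x * f x) = (LINT x|lborel. f x - indicator A x * f x)"
        by (rule Bochner_Integration.integral_cong) (auto simp: indicator_def)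
      then show ?case using compl ind[OF A] f total by simp
    next
      case (union A)
      then have A [measurable]: "A i \<in> sets borel" for i using sets_eq by auto
      have sum_ind: "(\<Sum>i<k. indicator (A i) x :: real) = indicator (\<Union>i<k. A i) x" for k x
        using union(1) by (subst indicator_UN_disjoint) (auto simp: disjoint_family_on_def)
      have "(\<lambda>k. LINT x|lborel. (\<Sum>i<k. indicator (A i) x) * f x)
          \<longlonglongrightarrow> (LINT x|lborel. indicator (\<Union>i. A i) x * f x)"
      proof (rule integral_dominated_convergence[where w = "\<lambda>x. norm (f x)"])
        show "AE x in lborel. (\<lambda>k. (\<Sum>i<k. indicator (A i) x) * f x) \<longlonglongrightarrow> indicator (\<Union>i. A i) x * f x"
        proof (intro AE_I2 tendsto_mult_right)
          fix x
          show "(\<lambda>k. \<Sum>i<k. indicator (A i) x :: real) \<longlonglongrightarrow> indicator (\<Union>i. A i) x"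
            unfolding sum_ind by (rule LIMSEQ_indicator_UN)
        qed
        show "AE x in lborel. norm ((\<Sum>i<k. indicator (A i) x) * f x) \<le> norm (f x)" for k
        proof (intro AE_I2)
          fix x
          show "norm ((\<Sum>i<k. indicator (A i) x) * f x) \<le> norm (f x)"
            unfolding sum_ind by (simp add: indicator_def)
        qed
      qed (use f in auto)
      moreover have "(LINT x|lborel. (\<Sum>i<k. indicator (A i) x) * f x) = 0" for k
        unfolding sum_distrib_right using union(3) ind[OF A]
        by (subst Bochner_Integration.integral_sum) simp_all
      ultimately show ?case by (simp add: LIMSEQ_const_iff)
    qed simp
  qed
  have "AE x in lborel. indicator A x * f x = 0"
    if "A \<in> sets borel" "\<And>x. x \<in> A \<Longrightarrow> s * f x \<ge> 0" "s \<noteq> 0" for A s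
  proof -
    have "(LINT x|lborel. s * (indicator A x * f x)) = 0"
      using zero[OF that(1)] by simp
    moreover have "integrable lborel (\<lambda>x. s * (indicator A x * f x))"
      using ind[OF that(1)] by simp
    ultimately have "AE x in lborel. s * (indicator A x * f x) = 0"
      using that by (subst integral_nonneg_eq_0_iff_AE[symmetric]) (auto simp: indicator_def)
    then show ?thesis using that(3) by simp
  qed
  from this[of "{x. f x \<ge> 0}" 1] this[of "{x. f x \<le> 0}" "-1"]
  have "AE x in lborel. indicator {x. f x \<ge> 0} x * f x = 0" "AE x in lborel. indicator {x. f x \<le> 0} x * f x = 0"
    by auto
  then show ?thesis
    by eventually_elim (auto simp: indicator_def split: if_splits)
qed

text \<open>The smooth functions that increase to the indicator of a box turn test integrals into
  box integrals. As \<open>h\<close> is only locally integrable, its real and imaginary parts are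
  first cut to a box; an intersection of two boxes is again a box, so the box criterion still
  applies.\<close>

lemma fundamental_lemma:
  fixes h :: "real^'n::finite \<Rightarrow> complex"
  assumes h: "\<And>a b. integrable lborel (\<lambda>x. indicator (box a b) x *\<^sub>R h x)" "h \<in> borel_measurable borel"
    and test: "\<And>\<phi>. test_function \<phi> \<Longrightarrow> (LINT x|lborel. \<phi> x * h x) = 0"
  shows "AE x in lborel. h x = 0"
proof -
  note [measurable] = h(2)
  have box0: "(LINT x|lborel. indicator (box a b) x *\<^sub>R h x) = 0" for a b
  proof -
    let ?\<phi> = "\<lambda>k x. complex_of_real (1 - (1 - bump a b x) ^ k)"
    have [measurable]: "?\<phi> k \<in> borel_measurable borel" for k
      by (intro borel_measurable_continuous_onI test_functionD(3)[OF test_function_box])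
    have "(\<lambda>k. LINT x|lborel. ?\<phi> k x * h x) \<longlonglongrightarrow> (LINT x|lborel. indicator (box a b) x *\<^sub>R h x)"
    proof (rule integral_dominated_convergence[where w = "\<lambda>x. norm (indicator (box a b) x *\<^sub>R h x)"])
      show "AE x in lborel. (\<lambda>k. ?\<phi> k x * h x) \<longlonglongrightarrow> indicator (box a b) x *\<^sub>R h x"
        unfolding scaleR_conv_of_real by (intro AE_I2 tendsto_mult_right tendsto_of_real box_approx)
      show "AE x in lborel. norm (?\<phi> k x * h x) \<le> norm (indicator (box a b) x *\<^sub>R h x)" for k
      proof (intro AE_I2)
        fix x
        show "norm (?\<phi> k x * h x) \<le> norm (indicator (box a b) x *\<^sub>R h x)"
        proof (cases "x \<in> box a b")
          case True
          have "0 \<le> (1 - bump a b x) ^ k" "(1 - bump a b x) ^ k \<le> 1"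
            using bump_bounds(1,2)[of a b x] by (auto intro: power_le_one)
          then have "norm (?\<phi> k x) \<le> 1" unfolding norm_of_real by simp
          with True show ?thesis by (simp add: norm_mult mult_left_le_one_le del: of_real_diff of_real_power)
        next
          case False
          then have "bump a b x = 0" using bump_bounds[of a b x] by auto
          then show ?thesis by simp
        qed
      qed
      show "integrable lborel (\<lambda>x. norm (indicator (box a b) x *\<^sub>R h x))" 
        by (rule integrable_norm) (rule h(1))
    qed measurable
    then show ?thesis unfolding test[OF test_function_box] by (simp add: LIMSEQ_const_iff)
  qed
  have ae: "AE x in lborel. indicator (box c d) x * Re (h x) = 0" "AE x in lborel. indicator (box c d) x * Im (h x) = 0" for c d
  proof -
    have "integrable lborel (\<lambda>x. Re (indicator (box c d) x *\<^sub>R h x))" "integrable lborel (\<lambda>x. Im (indicator (box c d) x *\<^sub>R h x))"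
      using h(1) by (intro integrable_Re integrable_Im; simp)+
    then have i: "integrable lborel (\<lambda>x. indicator (box c d) x * Re (h x))" "integrable lborel (\<lambda>x. indicator (box c d) x * Im (h x))"
      by simp_all
    have "(LINT x|lborel. indicator (box a b) x * (indicator (box c d) x * Re (h x))) = 0"
      "(LINT x|lborel. indicator (box a b) x * (indicator (box c d) x * Im (h x))) = 0" for a b
    proof -
      obtain a' b' where ab: "box a b \<inter> box c d = box a' b'" unfolding box_Int_box by blast
      have "(LINT x|lborel. Re (indicator (box a' b') x *\<^sub>R h x)) = 0" "(LINT x|lborel. Im (indicator (box a' b') x *\<^sub>R h x)) = 0"
        using box0[of a' b'] h(1)[of a' b'] by (simp_all only: integral_Re integral_Im zero_complex.sel)
      then show "(LINT x|lborel. indicator (box a b) x * (indicator (box c d) x * Re (h x))) = 0"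
        "(LINT x|lborel. indicator (box a b) x * (indicator (box c d) x * Im (h x))) = 0"
        unfolding ab[symmetric] by (simp_all add: indicator_inter_arith mult.assoc)
    qed
    from AE_zero_if_box_integrals_zero[OF i(1) this(1)] AE_zero_if_box_integrals_zero[OF i(2) this(2)]
    show "AE x in lborel. indicator (box c d) x * Re (h x) = 0" "AE x in lborel. indicator (box c d) x * Im (h x) = 0" .
  qed
  let ?A = "\<lambda>k. box (- real k *\<^sub>R One) (real k *\<^sub>R One) :: (real^'n) set"
  have "AE x in lborel. \<forall>k. indicator (?A k) x * Re (h x) = 0 \<and> indicator (?A k) x * Im (h x) = 0"
    unfolding AE_all_countable using ae by auto
  then show ?thesis
  proof eventually_elim
    fix x assume *: "\<forall>k. indicator (?A k) x * Re (h x) = 0 \<and> indicator (?A k) x * Im (h x) = 0"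
    obtain m :: nat where m: "norm x < real m" using reals_Archimedean2 by blast
    have "x \<in> ?A m" using m Basis_le_norm[of _ x] by (fastforce simp: mem_box)
    with spec[OF *, of m] show "h x = 0" by (simp add: complex_eq_iff)
  qed
qed

text \<open>Turns information on ball averages, the form in which V and W are given, into pointwise
  information. Near a point with \<open>h c \<noteq> 0\<close> the function stays within half its
  modulus of \<open>h c\<close>, so a small ball around \<open>c\<close> cannot have integral
  0.\<close>

lemma continuous_zero_if_ball_integrals_zero:
  fixes h :: "real^'n::finite \<Rightarrow> complex"
  assumes c: "continuous_on UNIV h" and ball: "\<And>c r. r > 0 \<Longrightarrow> (LINT x:ball c r|lborel. h x) = 0"
  shows "h c = 0"
proof (rule ccontr)
  assume nz: "h c \<noteq> 0"
  have "isCont h c" using c by (simp add: continuous_on_eq_continuous_at)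
  then obtain r where r: "r > 0" "\<And>x. dist x c < r \<Longrightarrow> dist (h x) (h c) < norm (h c) / 2"
    using nz unfolding continuous_at_eps_delta by (metis half_gt_zero zero_less_norm_iff)
  let ?m = "measure lborel (ball c r)"
  have m: "?m > 0" using r(1) by (simp add: content_ball_pos)
  have fin: "emeasure lborel (ball c r) < \<infinity>" by (rule emeasure_bounded_finite) simp
  have ic: "integrable lborel (\<lambda>x. indicator (ball c r) x *\<^sub>R h c)" using fin by simp
  have ih: "integrable lborel (\<lambda>x. indicator (ball c r) x *\<^sub>R h x)"
  proof -
    have "integrable lborel (\<lambda>x. indicator (cball c r) x *\<^sub>R h x)"
      by (rule borel_integrable_compact[OF compact_cball continuous_on_subset[OF c]]) simp
    from integrable_mult_indicator[OF _ this, of "ball c r"]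
    have "integrable lborel (\<lambda>x. indicator (ball c r) x *\<^sub>R indicator (cball c r) x *\<^sub>R h x)" by simp
    also have "(\<lambda>x. indicator (ball c r) x *\<^sub>R indicator (cball c r) x *\<^sub>R h x) = (\<lambda>x. indicator (ball c r) x *\<^sub>R h x)"
      by (auto simp: indicator_def)
    finally show ?thesis .
  qed
  have "norm (LINT x|lborel. indicator (ball c r) x *\<^sub>R (h x - h c)) \<le> (LINT x|lborel. indicator (ball c r) x * (norm (h c) / 2))"
  proof (rule Bochner_Integration.integral_norm_bound_integral)
    show "integrable lborel (\<lambda>x. indicator (ball c r) x *\<^sub>R (h x - h c))"
      unfolding scaleR_diff_right using ic ih by simp
    show "integrable lborel (\<lambda>x. indicator (ball c r) x * (norm (h c) / 2))" using fin by simp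
    show "norm (indicator (ball c r) x *\<^sub>R (h x - h c)) \<le> indicator (ball c r) x * (norm (h c) / 2)" for x
      using r(2)[of x] by (cases "x \<in> ball c r") (auto simp: dist_norm norm_minus_commute)
  qed
  also have "(LINT x|lborel. indicator (ball c r) x *\<^sub>R (h x - h c)) = - (?m *\<^sub>R h c)"
    unfolding scaleR_diff_right using ic ih ball[OF r(1), of c] fin
    by (simp add: set_lebesgue_integral_def)
  also have "(LINT x|lborel. indicator (ball c r) x * (norm (h c) / 2)) = ?m * (norm (h c) / 2)"
    using fin by simp
  finally have "?m * norm (h c) \<le> ?m * (norm (h c) / 2)"
    using m by (simp only: norm_minus_cancel norm_scaleR abs_of_pos)
  then have "norm (h c) \<le> norm (h c) / 2" using m by (rule mult_left_le_imp_le)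
  then show False using nz by simp
qed

section \<open>Lebesgue spaces\<close>

lemma powr_add_le:
  fixes a b p :: real
  assumes "a \<ge> 0" "b \<ge> 0" "p > 0"
  shows "(a + b) powr p \<le> 2 powr p * (a powr p + b powr p)"
proof -
  have "(a + b) powr p \<le> (2 * max a b) powr p"
    using assms by (intro powr_mono2) auto
  also have "\<dots> = 2 powr p * max a b powr p" using assms by (simp add: powr_mult)
  also have "max a b powr p \<le> a powr p + b powr p" by (auto simp: max_def)
  finally show ?thesis by simp
qed

text \<open>Stands in for Minkowski's inequality: a constant factor is harmless when both terms can
  be made small.\<close>

lemma integrable_powr_add:
  fixes f g :: "'a \<Rightarrow> 'b::{banach, second_countable_topology}"
  assumes [measurable]: "f \<in> borel_measurable M" "g \<in> borel_measurable M"
    and f: "integrable M (\<lambda>x. norm (f x) powr p)" and g: "integrable M (\<lambda>x. norm (g x) powr p)"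
    and p: "p > 0"
  shows "integrable M (\<lambda>x. norm (f x + g x) powr p)"
    and "(LINT x|M. norm (f x + g x) powr p)
      \<le> 2 powr p * ((LINT x|M. norm (f x) powr p) + (LINT x|M. norm (g x) powr p))"
proof -
  have bound: "norm (f x + g x) powr p \<le> 2 powr p * (norm (f x) powr p + norm (g x) powr p)" for x
    using p by (intro order_trans[OF powr_mono2 powr_add_le] norm_triangle_ineq) auto
  have int: "integrable M (\<lambda>x. 2 powr p * (norm (f x) powr p + norm (g x) powr p))"
    using f g by simp
  show i: "integrable M (\<lambda>x. norm (f x + g x) powr p)"
    by (rule Bochner_Integration.integrable_bound[OF int]) (use bound in \<open>auto intro: order_trans\<close>)
  show "(LINT x|M. norm (f x + g x) powr p)
      \<le> 2 powr p * ((LINT x|M. norm (f x) powr p) + (LINT x|M. norm (g x) powr p))"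
    using integral_mono[OF i int bound] f g by simp
qed

lemma LpD:
  assumes "f \<in> Lp p"
  shows "f \<in> borel_measurable borel" "integrable lborel (\<lambda>x. norm (f x) powr p)"
  using assms by (auto simp: Lp_def)

lemma Lp_add: "f \<in> Lp p \<Longrightarrow> g \<in> Lp p \<Longrightarrow> p > 0 \<Longrightarrow> (\<lambda>x. f x + g x) \<in> Lp p"
  unfolding Lp_def by (auto intro: integrable_powr_add)

lemma Lp_bound:
  assumes f: "f \<in> Lp p" and g: "g \<in> borel_measurable borel" and p: "p > 0"
    and le: "\<And>x. norm (g x) \<le> C * norm (f x)"
  shows "g \<in> Lp p" "(LINT x|lborel. norm (g x) powr p) \<le> \<bar>C\<bar> powr p * (LINT x|lborel. norm (f x) powr p)"
proof -
  note [measurable] = g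
  have le': "norm (g x) powr p \<le> \<bar>C\<bar> powr p * norm (f x) powr p" for x
  proof -
    have "norm (g x) \<le> \<bar>C\<bar> * norm (f x)"
      using order_trans[OF le[of x] mult_right_mono[OF abs_ge_self norm_ge_zero]] .
    then have "norm (g x) powr p \<le> (\<bar>C\<bar> * norm (f x)) powr p"
      using p by (intro powr_mono2) auto
    then show ?thesis by (simp add: powr_mult)
  qed
  have int: "integrable lborel (\<lambda>x. \<bar>C\<bar> powr p * norm (f x) powr p)" using LpD(2)[OF f] by simp
  have i: "integrable lborel (\<lambda>x. norm (g x) powr p)"
    by (rule Bochner_Integration.integrable_bound[OF int]) (use le' in auto)
  then show "g \<in> Lp p" using g by (simp add: Lp_def)
  show "(LINT x|lborel. norm (g x) powr p) \<le> \<bar>C\<bar> powr p * (LINT x|lborel. norm (f x) powr p)"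
    using integral_mono[OF i int le'] by simp
qed

lemma Lp_diff: "f \<in> Lp p \<Longrightarrow> g \<in> Lp p \<Longrightarrow> p > 0 \<Longrightarrow> (\<lambda>x. f x - g x) \<in> Lp p"
  using Lp_add[of f p "\<lambda>x. - g x"] Lp_bound(1)[of g p "\<lambda>x. - g x" 1] LpD(1)[of g p] by simp

lemma conj_exp_gt_1: "1 < p \<Longrightarrow> 1 < conj_exp p"
  by (simp add: conj_exp_def)

text \<open>Young's inequality without its constants, so that a case distinction suffices.\<close>

lemma mult_le_powr_conj:
  fixes a b d p :: real
  assumes "a \<ge> 0" "b \<ge> 0" "p > 1" "d > 0"
  shows "a * b \<le> d powr (- p) * a powr p + d powr conj_exp p * b powr conj_exp p"
proof -
  have *: "a * b \<le> a powr p + b powr conj_exp p" if ab: "a \<ge> 0" "b \<ge> 0" for a b :: real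
  proof (cases "a = 0 \<or> b = 0")
    case False
    with ab have pos: "a > 0" "b > 0" by auto
    show ?thesis
    proof (cases "b \<le> a powr (p - 1)")
      case True
      then have "a * b \<le> a * a powr (p - 1)" using pos by simp
      also have "\<dots> = a powr p" using pos by (simp add: powr_diff)
      finally show ?thesis using powr_ge_zero[of b "conj_exp p"] by linarith
    next
      case False
      then have "(a powr (p - 1)) powr (1 / (p - 1)) \<le> b powr (1 / (p - 1))"
        using \<open>p > 1\<close> by (intro powr_mono2) auto
      then have "a \<le> b powr (1 / (p - 1))" using \<open>p > 1\<close> pos by (simp add: powr_powr)
      then have "a * b \<le> b powr (1 / (p - 1)) * b powr 1" using pos by simp
      also have "\<dots> = b powr (1 / (p - 1) + 1)" by (rule powr_add[symmetric])
      also have "1 / (p - 1) + 1 = conj_exp p" using \<open>p > 1\<close> by (simp add: conj_exp_def field_simps)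
      finally show ?thesis using powr_ge_zero[of a p] by linarith
    qed
  qed (use powr_ge_zero[of a p] powr_ge_zero[of b "conj_exp p"] in auto)
  \<comment> \<open>The parameter \<open>d\<close> comes from rescaling the two factors in opposite
    directions.\<close>
  have "a * b = (a / d) * (d * b)" using assms by simp
  also have "\<dots> \<le> (a / d) powr p + (d * b) powr conj_exp p" using assms by (intro *) auto
  also have "\<dots> = d powr (- p) * a powr p + d powr conj_exp p * b powr conj_exp p"
    using assms by (simp add: powr_divide powr_mult powr_minus_divide)
  finally show ?thesis .
qed

text \<open>Stands in for Hoelder's inequality. A small \<open>d\<close> makes the second term
  small, after which the first one can be made small by approximation in L^p.\<close>

lemma integrable_mult_Lp:
  fixes a b :: "'a \<Rightarrow> real"
  assumes [measurable]: "a \<in> borel_measurable M" "b \<in> borel_measurable M"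
    and nn: "\<And>x. a x \<ge> 0" "\<And>x. b x \<ge> 0"
    and int: "integrable M (\<lambda>x. a x powr p)" "integrable M (\<lambda>x. b x powr conj_exp p)" and p: "p > 1"
  shows "integrable M (\<lambda>x. a x * b x)"
    and "d > 0 \<Longrightarrow> (LINT x|M. a x * b x)
      \<le> d powr (- p) * (LINT x|M. a x powr p) + d powr conj_exp p * (LINT x|M. b x powr conj_exp p)"
proof -
  have i: "integrable M (\<lambda>x. d powr (- p) * a x powr p + d powr conj_exp p * b x powr conj_exp p)" for d
    using int by simp
  show *: "integrable M (\<lambda>x. a x * b x)"
    by (rule Bochner_Integration.integrable_bound[OF i[of 1]])
       (use nn mult_le_powr_conj[OF nn p, of 1] in \<open>auto intro!: AE_I2 simp: abs_mult\<close>)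
  assume "d > 0"
  from integral_mono[OF * i mult_le_powr_conj[OF nn p this]]
  show "(LINT x|M. a x * b x)
      \<le> d powr (- p) * (LINT x|M. a x powr p) + d powr conj_exp p * (LINT x|M. b x powr conj_exp p)"
    using int by simp
qed

lemma cinner_norm_le: "norm (cinner x y) \<le> CARD('N) * (norm x * norm y)" for x y :: "complex^'N::finite"
proof -
  have "norm (cinner x y) \<le> (\<Sum>k\<in>UNIV. norm (x $ k * cnj (y $ k)))"
    unfolding cinner_def by (rule norm_sum)
  also have "\<dots> \<le> (\<Sum>k\<in>(UNIV::'N set). norm x * norm y)"
    by (intro sum_mono) (auto simp: norm_mult intro!: mult_mono Finite_Cartesian_Product.norm_nth_le)
  finally show ?thesis by simp
qed

lemma cinner_measurable [measurable]:
  "f \<in> borel_measurable M \<Longrightarrow> g \<in> borel_measurable M \<Longrightarrow> (\<lambda>x. cinner (f x) (g x)) \<in> borel_measurable M"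
proof -
  assume fg: "f \<in> borel_measurable M" "g \<in> borel_measurable M"
  have [measurable]: "(\<lambda>x. f x $ k) \<in> borel_measurable M" "(\<lambda>x. cnj (g x $ k)) \<in> borel_measurable M" for k
    by (rule measurable_compose[OF fg(1)] measurable_compose[OF fg(2)],
        intro borel_measurable_continuous_onI continuous_intros)+
  show ?thesis unfolding cinner_def by measurable
qed

lemma cinner_Lp_integrable:
  assumes "f \<in> Lp p" "g \<in> Lp (conj_exp p)" "p > 1"
  shows "integrable lborel (\<lambda>x. norm (f x) * norm (g x))" "integrable lborel (\<lambda>x. cinner (f x) (g x))"
proof -
  note [measurable] = LpD(1)[OF assms(1)] LpD(1)[OF assms(2)]
  show *: "integrable lborel (\<lambda>x. norm (f x) * norm (g x))"
    by (rule integrable_mult_Lp(1)[OF _ _ _ _ LpD(2)[OF assms(1)] LpD(2)[OF assms(2)] assms(3)]) auto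
  show "integrable lborel (\<lambda>x. cinner (f x) (g x))"
    by (rule Bochner_Integration.integrable_bound[OF integrable_mult_right[OF *, of "real CARD('b)"]])
       (auto intro!: AE_I2 order_trans[OF cinner_norm_le])
qed

lemma Lp_norm_less_iff:
  assumes "p > 0" "e > 0"
  shows "Lp_norm p f < e \<longleftrightarrow> (LINT x|lborel. norm (f x) powr p) < e powr p"
proof -
  let ?I = "LINT x|lborel. norm (f x) powr p"
  have I: "?I \<ge> 0" by simp
  have "?I powr (1 / p) < e \<longleftrightarrow> (?I powr (1 / p)) powr p < e powr p"
    using assms powr_less_mono2[of p "?I powr (1 / p)" e] powr_mono2[of p e "?I powr (1 / p)"]
    by (auto simp: not_less[symmetric])
  also have "(?I powr (1 / p)) powr p = ?I" using assms I by (simp add: powr_powr)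
  finally show ?thesis unfolding Lp_norm_def .
qed

text \<open>Measuring closeness by the p-th power integral instead of its root keeps every later
  estimate additive.\<close>

lemma Lp_closure_iff:
  assumes "p > 0"
  shows "v \<in> Lp_closure p U \<longleftrightarrow> v \<in> Lp p \<and> (\<forall>e>0. \<exists>u\<in>U. (LINT x|lborel. norm (v x - u x) powr p) < e)"
proof (intro iffI conjI allI impI)
  assume v: "v \<in> Lp_closure p U"
  then show "v \<in> Lp p" by (simp add: Lp_closure_def)
  fix e :: real assume "e > 0"
  then have "e powr (1 / p) > 0" by simp
  with v obtain u where "u \<in> U" "Lp_norm p (\<lambda>x. v x - u x) < e powr (1 / p)"
    unfolding Lp_closure_def by blast
  then show "\<exists>u\<in>U. (LINT x|lborel. norm (v x - u x) powr p) < e"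
    using assms \<open>e > 0\<close> \<open>e powr (1 / p) > 0\<close> by (auto simp: Lp_norm_less_iff powr_powr)
next
  assume "v \<in> Lp p \<and> (\<forall>e>0. \<exists>u\<in>U. (LINT x|lborel. norm (v x - u x) powr p) < e)"
  moreover have "e powr p > 0" if "e > 0" for e :: real using that by simp
  ultimately show "v \<in> Lp_closure p U"
    unfolding Lp_closure_def by (auto simp: Lp_norm_less_iff[OF assms])
qed

lemma Lp_closure_add:
  assumes U: "\<And>u v. u \<in> U \<Longrightarrow> v \<in> U \<Longrightarrow> (\<lambda>x. u x + v x) \<in> U" "U \<subseteq> Lp p" and p: "p > 0"
    and f: "f \<in> Lp_closure p U" and g: "g \<in> Lp_closure p U"
  shows "(\<lambda>x. f x + g x) \<in> Lp_closure p U"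
  unfolding Lp_closure_iff[OF p]
proof (intro conjI allI impI)
  show "(\<lambda>x. f x + g x) \<in> Lp p" using f g p by (auto simp: Lp_closure_def intro: Lp_add)
  fix e :: real assume e: "e > 0"
  \<comment> \<open>Chosen so that \<open>2 powr p * (?d + ?d) = e\<close>.\<close>
  let ?d = "e / (2 powr p * 2)"
  have d: "?d > 0" using e by simp
  obtain u v where u: "u \<in> U" "(LINT x|lborel. norm (f x - u x) powr p) < ?d"
    and v: "v \<in> U" "(LINT x|lborel. norm (g x - v x) powr p) < ?d"
    using f g d unfolding Lp_closure_iff[OF p] by meson
  have fu: "(\<lambda>x. f x - u x) \<in> Lp p" "(\<lambda>x. g x - v x) \<in> Lp p"
    using u v f g U p by (auto simp: Lp_closure_def intro!: Lp_diff)
  have "(LINT x|lborel. norm ((f x - u x) + (g x - v x)) powr p) \<le>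
      2 powr p * ((LINT x|lborel. norm (f x - u x) powr p) + (LINT x|lborel. norm (g x - v x) powr p))"
    using LpD[OF fu(1)] LpD[OF fu(2)] p by (intro integrable_powr_add(2)) auto
  also have "\<dots> < 2 powr p * (?d + ?d)"
    using u v by (intro mult_strict_left_mono add_strict_mono) auto
  also have "\<dots> = e" by simp
  finally show "\<exists>w\<in>U. (LINT x|lborel. norm (f x + g x - w x) powr p) < e"
    using U(1)[OF u(1) v(1)] by (intro bexI[of _ "\<lambda>x. u x + v x"]) (simp_all add: algebra_simps)
qed

text \<open>Interpolation between L^1 and uniform bounds. For \<open>p > 1\<close> the factor
  \<open>B powr (p - 1)\<close> is small with \<open>B\<close>, which is how uniform convergence
  together with an L^1 bound gives convergence in L^p.\<close>

lemma integrable_powr_bounded: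
  fixes f :: "'a \<Rightarrow> 'b::{banach, second_countable_topology}"
  assumes f: "integrable M f" and B: "\<And>x. norm (f x) \<le> B" and p: "p \<ge> 1"
  shows "integrable M (\<lambda>x. norm (f x) powr p)"
    and "(LINT x|M. norm (f x) powr p) \<le> B powr (p - 1) * (LINT x|M. norm (f x))"
proof -
  have [measurable]: "f \<in> borel_measurable M" using f by auto
  have le: "norm (f x) powr p \<le> B powr (p - 1) * norm (f x)" for x
  proof (cases "f x = 0")
    case False
    then have "norm (f x) powr p = norm (f x) powr (p - 1) * norm (f x)"
      by (simp add: powr_diff)
    also have "\<dots> \<le> B powr (p - 1) * norm (f x)"
      using B p by (intro mult_right_mono powr_mono2) auto
    finally show ?thesis .
  qed simp
  have int: "integrable M (\<lambda>x. B powr (p - 1) * norm (f x))" using f by simp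
  show i: "integrable M (\<lambda>x. norm (f x) powr p)"
    by (rule Bochner_Integration.integrable_bound[OF int]) (use le in \<open>auto intro: order_trans\<close>)
  show "(LINT x|M. norm (f x) powr p) \<le> B powr (p - 1) * (LINT x|M. norm (f x))"
    using integral_mono[OF i int le] by simp
qed

text \<open>Two dominated convergence arguments: \<open>g\<close> is truncated in space and in size,
  and the truncation is then approximated by continuous functions with a common bound and a common
  bounded support.\<close>

lemma continuous_dense_Lp:
  fixes g :: "real^'n::finite \<Rightarrow> complex"
  assumes [measurable]: "g \<in> borel_measurable borel" and int: "integrable lborel (\<lambda>x. norm (g x) powr p)"
    and p: "p > 0" and e: "e > 0"
  obtains h R where "continuous_on UNIV h" "\<And>x. norm x > R \<Longrightarrow> h x = 0"
    "integrable lborel (\<lambda>x. norm (g x - h x) powr p)" "(LINT x|lborel. norm (g x - h x) powr p) < e"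
proof -
  define d where "d = e / (2 powr p * 2)"
  have d: "d > 0" "2 powr p * (d + d) = e" using e by (auto simp: d_def)
  let ?A = "\<lambda>k::nat. {x. norm x \<le> real k \<and> norm (g x) \<le> real k}"
  let ?g = "\<lambda>k x. indicator (?A k) x *\<^sub>R g x"
  have A [measurable]: "?A k \<in> sets borel" for k by measurable
  have "(\<lambda>k. LINT x|lborel. norm (g x - ?g k x) powr p) \<longlonglongrightarrow> integral\<^sup>L lborel (\<lambda>x::real^'n. 0)"
  proof (rule integral_dominated_convergence[where w = "\<lambda>x. norm (g x) powr p"])
    show "AE x in lborel. (\<lambda>k. norm (g x - ?g k x) powr p) \<longlonglongrightarrow> 0"
    proof (intro AE_I2 tendsto_eventually)
      fix x
      obtain m :: nat where m: "max (norm x) (norm (g x)) \<le> real m" using real_arch_simple by blast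
      have "norm (g x - ?g k x) powr p = 0" if "k \<ge> m" for k
      proof -
        have "x \<in> ?A k" using m that by auto
        then show ?thesis by simp
      qed
      then show "\<forall>\<^sub>F k in sequentially. norm (g x - ?g k x) powr p = 0"
        by (auto simp: eventually_sequentially)
    qed
    show "AE x in lborel. norm (norm (g x - ?g k x) powr p) \<le> norm (g x) powr p" for k
      by (intro AE_I2) (auto simp: indicator_def)
  qed (use int in measurable)
  then have "\<forall>\<^sub>F k in sequentially. (LINT x|lborel. norm (g x - ?g k x) powr p) < d"
    using d by (intro order_tendstoD) auto
  then obtain k where k: "(LINT x|lborel. norm (g x - ?g k x) powr p) < d"
    by (auto simp: eventually_sequentially)
  have int1: "integrable lborel (\<lambda>x. norm (g x - ?g k x) powr p)"
    by (rule Bochner_Integration.integrable_bound[OF int]) (auto simp: indicator_def)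
  \<comment> \<open>The extra 1 leaves room for the cut-off \<open>ct\<close> to fall from 1 at
    radius \<open>k\<close> to 0 at radius \<open>K\<close>.\<close>
  define K where "K = real k + 1"
  have K: "K > 0" by (simp add: K_def)
  have gK: "norm (?g k x) \<le> K" for x by (auto simp: indicator_def K_def)
  \<comment> \<open>A measurable function is an almost everywhere limit of continuous ones. These
    carry neither bounds nor bounded supports; \<open>clamp\<close> and \<open>ct\<close> supply
    both without changing the limit.\<close>
  have "?g k measurable_on UNIV"
    by (rule lebesgue_measurable_imp_measurable_on) (auto intro!: measurable_completion)
  then obtain N hn where N: "negligible N" and hn: "\<And>n. continuous_on UNIV (hn n)"
    "\<And>x. x \<notin> N \<Longrightarrow> (\<lambda>n. hn n x) \<longlonglongrightarrow> ?g k x"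
    unfolding measurable_on_def by auto
  \<comment> \<open>The radial retraction onto the disc of radius \<open>K\<close>, which fixes the
    values of the truncated function.\<close>
  define clamp where "clamp z = z / complex_of_real (max 1 (norm z / K))" for z
  define ct where "ct x = max 0 (min 1 (K - norm x))" for x :: "real^'n"
  define h where "h n x = complex_of_real (ct x) * clamp (hn n x)" for n x
  have ct: "0 \<le> ct x" "ct x \<le> 1" "norm x > K \<Longrightarrow> ct x = 0" "norm x \<le> real k \<Longrightarrow> ct x = 1" for x
    by (auto simp: ct_def K_def)
  have max0: "max 1 (norm z / K) \<noteq> 0" for z :: complex by (auto simp: max_def)
  have clamp_cont: "continuous_on UNIV clamp"
    unfolding clamp_def[abs_def] using K max0 by (intro continuous_intros) auto
  have clamp_id: "clamp z = z" if "norm z \<le> K" for z using that K by (simp add: clamp_def)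
  have clamp_le: "norm (clamp z) \<le> K" for z
    using K by (simp add: clamp_def norm_divide field_simps max_def)
  have hc: "continuous_on UNIV (h n)" for n
    unfolding h_def ct_def by (intro continuous_intros continuous_on_compose2[OF clamp_cont] hn) auto
  then have [measurable]: "h n \<in> borel_measurable borel" for n by (rule borel_measurable_continuous_onI)
  have h0: "h n x = 0" if "norm x > K" for n x using ct(3)[OF that] by (simp add: h_def)
  have hle: "norm (h n x) \<le> K" for n x
    using ct[of x] clamp_le[of "hn n x"] mult_mono[of "ct x" 1 "norm (clamp (hn n x))" K]
    by (simp add: h_def norm_mult)
  have bnd: "norm (?g k x - h n x) powr p \<le> (2 * K) powr p * indicator (cball 0 K) x" for n x
  proof (cases "norm x \<le> K")
    case True
    have "norm (?g k x - h n x) \<le> 2 * K"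
      using norm_triangle_ineq4[of "?g k x" "h n x"] gK[of x] hle[of n x] by linarith
    then have "norm (?g k x - h n x) powr p \<le> (2 * K) powr p"
      using p by (intro powr_mono2) auto
    with True show ?thesis by simp
  next
    case False
    then have "?g k x = 0" by (auto simp: indicator_def K_def)
    with False h0 show ?thesis by simp
  qed
  have int_w: "integrable lborel (\<lambda>x::real^'n. (2 * K) powr p * indicator (cball 0 K) x)"
    using emeasure_bounded_finite[of "cball (0 :: real^'n) K"] by simp
  have AEN: "AE x in lborel. x \<notin> N"
    using N AE_not_in[of N lebesgue] by (simp add: negligible_iff_null_sets AE_completion_iff)
  have "(\<lambda>n. LINT x|lborel. norm (?g k x - h n x) powr p) \<longlonglongrightarrow> integral\<^sup>L lborel (\<lambda>x::real^'n. 0)"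
  proof (rule integral_dominated_convergence[OF _ _ int_w])
    show "AE x in lborel. (\<lambda>n. norm (?g k x - h n x) powr p) \<longlonglongrightarrow> 0"
      using AEN
    proof eventually_elim
      fix x assume "x \<notin> N"
      have "isCont clamp (?g k x)" using clamp_cont by (simp add: continuous_on_eq_continuous_at)
      from isCont_tendsto_compose[OF this hn(2)[OF \<open>x \<notin> N\<close>]]
      have "(\<lambda>n. clamp (hn n x)) \<longlonglongrightarrow> ?g k x" unfolding clamp_id[OF gK] .
      then have "(\<lambda>n. h n x) \<longlonglongrightarrow> complex_of_real (ct x) * ?g k x"
        unfolding h_def by (intro tendsto_intros)
      also have "complex_of_real (ct x) * ?g k x = ?g k x"
        using ct(4)[of x] by (auto simp: indicator_def)
      finally have "(\<lambda>n. norm (?g k x - h n x)) \<longlonglongrightarrow> norm (?g k x - ?g k x)" by (intro tendsto_intros)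
      then have "(\<lambda>n. norm (?g k x - h n x)) \<longlonglongrightarrow> 0" by simp
      from tendsto_zero_powrI[OF this tendsto_const, of p] p
      show "(\<lambda>n. norm (?g k x - h n x) powr p) \<longlonglongrightarrow> 0" by simp
    qed
    show "AE x in lborel. norm (norm (?g k x - h n x) powr p) \<le> (2 * K) powr p * indicator (cball 0 K) x" for n
      using bnd by (intro AE_I2) simp
  qed measurable
  then have "\<forall>\<^sub>F n in sequentially. (LINT x|lborel. norm (?g k x - h n x) powr p) < d"
    using d by (intro order_tendstoD) auto
  then obtain n where n: "(LINT x|lborel. norm (?g k x - h n x) powr p) < d"
    by (auto simp: eventually_sequentially)
  have int2: "integrable lborel (\<lambda>x. norm (?g k x - h n x) powr p)"
    by (rule Bochner_Integration.integrable_bound[OF int_w]) (use bnd in auto)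
  have eq: "g x - h n x = (g x - ?g k x) + (?g k x - h n x)" for x by simp
  show ?thesis
  proof (rule that[of "h n" K])
    show "integrable lborel (\<lambda>x. norm (g x - h n x) powr p)"
      unfolding eq[of] by (rule integrable_powr_add(1)[OF _ _ int1 int2 p]) measurable
    have "(LINT x|lborel. norm (g x - h n x) powr p) \<le> 2 powr p *
        ((LINT x|lborel. norm (g x - ?g k x) powr p) + (LINT x|lborel. norm (?g k x - h n x) powr p))"
      unfolding eq[of] by (rule integrable_powr_add(2)[OF _ _ int1 int2 p]) measurable
    also have "\<dots> < 2 powr p * (d + d)" using k n by (intro mult_strict_left_mono add_strict_mono) auto
    finally show "(LINT x|lborel. norm (g x - h n x) powr p) < e" unfolding d(2) .
  qed (use hc h0 in auto)
qed

section \<open>Rapidly decreasing functions\<close>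

text \<open>A product, so that integrability reduces to dimension one; its reciprocal is a
  polynomial, so that a bound by it can be checked after multiplication by coordinates, which the
  Fourier integral turns into derivatives.\<close>

definition decay_wt :: "real^'n::finite \<Rightarrow> real" where
  "decay_wt x = (\<Prod>j\<in>UNIV. inverse (1 + (x $ j)\<^sup>2))"

lemma decay_wt_pos: "0 < decay_wt x" and decay_wt_le_1: "decay_wt x \<le> 1"
proof -
  have *: "0 < 1 + (x $ j)\<^sup>2" for j by (smt (verit) zero_le_power2)
  show "0 < decay_wt x" unfolding decay_wt_def by (intro prod_pos) (use * in simp)
  show "decay_wt x \<le> 1" unfolding decay_wt_def
    by (intro prod_le_1) (use * in \<open>auto simp: inverse_le_1_iff intro: less_imp_le\<close>)
qed

lemma decay_wt_cancel: "(\<Prod>j\<in>UNIV. 1 + (x $ j)\<^sup>2) * decay_wt x = 1" for x :: "real^'n::finite"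
proof -
  have "1 + (x $ j)\<^sup>2 \<noteq> 0" for j by (smt (verit) zero_le_power2)
  then show ?thesis unfolding decay_wt_def prod.distrib[symmetric] by simp
qed

lemma decay_wt_integrable: "integrable lborel (decay_wt :: real^'n::finite \<Rightarrow> real)"
proof -
  have "einterval (-\<infinity>) \<infinity> = (UNIV :: real set)" by (auto simp: einterval_def)
  then have "integrable lborel (\<lambda>t::real. inverse (1 + t\<^sup>2))"
    using integrable_inverse_1_plus_square by (simp add: set_integrable_def)
  then have "integrable lborel (\<lambda>t::real. complex_of_real (inverse (1 + t\<^sup>2)))"
    unfolding complex_of_real_integrable_eq .
  from lborel_prod_integral(1)[OF this]
  have "integrable lborel (\<lambda>x::real^'n. complex_of_real (decay_wt x))"
    unfolding decay_wt_def of_real_prod .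
  then show ?thesis unfolding complex_of_real_integrable_eq .
qed

lemma integrable_decay_wt_bound:
  fixes f :: "real^'n::finite \<Rightarrow> 'b::{banach, second_countable_topology}"
  assumes "f \<in> borel_measurable borel" "\<And>x. norm (f x) \<le> C * decay_wt x"
  shows "integrable lborel f"
  by (rule Bochner_Integration.integrable_bound[OF integrable_mult_right[OF decay_wt_integrable, of C]])
     (use assms in \<open>auto intro!: AE_I2 intro: order_trans[OF _ abs_ge_self]\<close>)

text \<open>The index counts the derivatives and coordinate factors that may still be applied.\<close>

fun sch :: "nat \<Rightarrow> (real^'n::finite \<Rightarrow> complex) \<Rightarrow> bool" where
  "sch 0 h \<longleftrightarrow> continuous_on UNIV h \<and> (\<exists>C. \<forall>x. norm (h x) \<le> C * decay_wt x)"
| "sch (Suc k) h \<longleftrightarrow> sch 0 h \<and> (\<forall>x. h differentiable at x)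
    \<and> (\<forall>j. sch k (\<lambda>x. complex_of_real (x $ j) * h x)) \<and> (\<forall>j. sch k (partial_deriv j h))"

definition schwartz :: "(real^'n::finite \<Rightarrow> complex) \<Rightarrow> bool" where
  "schwartz h \<longleftrightarrow> (\<forall>k. sch k h)"

lemma schwartz_bound:
  assumes "schwartz h"
  obtains C where "C \<ge> 0" "\<And>x. norm (h x) \<le> C * decay_wt x"
proof -
  obtain C where C: "\<And>x. norm (h x) \<le> C * decay_wt x"
    using spec[OF assms[unfolded schwartz_def], of 0] by auto
  have "C \<ge> 0"
    using order_trans[OF norm_ge_zero C] decay_wt_pos by (metis mult_less_0_iff not_less)
  then show ?thesis using C that by blast
qed

lemma schwartzD:
  assumes h: "schwartz h"
  shows "continuous_on UNIV h" "h differentiable at x" "integrable lborel h"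
    "schwartz (\<lambda>x. complex_of_real (x $ j) * h x)" "schwartz (partial_deriv j h)"
    "h \<in> borel_measurable borel"
proof -
  from h have *: "sch k h" for k by (simp add: schwartz_def)
  from *[of 0] show c: "continuous_on UNIV h" by simp
  then show m: "h \<in> borel_measurable borel" by (rule borel_measurable_continuous_onI)
  from *[of 1] show "h differentiable at x" by simp
  from *[of "Suc _"] show "schwartz (\<lambda>x. complex_of_real (x $ j) * h x)" "schwartz (partial_deriv j h)"
    by (simp_all add: schwartz_def)
  obtain C where "\<And>x. norm (h x) \<le> C * decay_wt x" by (rule schwartz_bound[OF h]) (rule that)
  then show "integrable lborel h" by (rule integrable_decay_wt_bound[OF m])
qed

lemma sch_add: "sch k f \<Longrightarrow> sch k g \<Longrightarrow> sch k (\<lambda>x. f x + g x)"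
proof (induction k arbitrary: f g)
  case 0
  then obtain C D where "\<And>x. norm (f x) \<le> C * decay_wt x" "\<And>x. norm (g x) \<le> D * decay_wt x" by auto
  then have "norm (f x + g x) \<le> (C + D) * decay_wt x" for x
    by (simp add: distrib_right norm_triangle_mono)
  with 0 show ?case by (auto intro: continuous_intros)
next
  case (Suc k)
  have "partial_deriv j (\<lambda>x. f x + g x) = (\<lambda>x. partial_deriv j f x + partial_deriv j g x)" for j
    using Suc.prems by (intro ext partial_deriv_add) auto
  moreover have "sch 0 (\<lambda>x. f x + g x)"
  proof -
    from Suc.prems obtain C D where "\<And>x. norm (f x) \<le> C * decay_wt x" "\<And>x. norm (g x) \<le> D * decay_wt x" by auto
    then have "norm (f x + g x) \<le> (C + D) * decay_wt x" for x
      by (simp add: distrib_right norm_triangle_mono)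
    with Suc.prems show ?thesis by (auto intro: continuous_intros)
  qed
  ultimately show ?case using Suc by (auto simp: distrib_left)
qed

lemma sch_cmult: "sch k f \<Longrightarrow> sch k (\<lambda>x. c * f x)"
proof (induction k arbitrary: f)
  case 0
  then obtain C where "\<And>x. norm (f x) \<le> C * decay_wt x" by auto
  then have "norm (c * f x) \<le> (norm c * C) * decay_wt x" for x
    by (simp add: norm_mult mult.assoc mult_left_mono)
  with 0 show ?case by (auto intro: continuous_intros)
next
  case (Suc k)
  have "partial_deriv j (\<lambda>x. c * f x) = (\<lambda>x. c * partial_deriv j f x)" for j
    using Suc.prems by (intro ext, subst partial_deriv_mult) auto
  moreover have "sch 0 (\<lambda>x. c * f x)"
  proof -
    from Suc.prems obtain C where "\<And>x. norm (f x) \<le> C * decay_wt x" by auto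
    then have "norm (c * f x) \<le> (norm c * C) * decay_wt x" for x
      by (simp add: norm_mult mult.assoc mult_left_mono)
    with Suc.prems show ?thesis by (auto intro: continuous_intros)
  qed
  ultimately show ?case using Suc by (auto simp: mult.left_commute[of _ c])
qed

lemma schwartz_add: "schwartz f \<Longrightarrow> schwartz g \<Longrightarrow> schwartz (\<lambda>x. f x + g x)"
  and schwartz_cmult: "schwartz f \<Longrightarrow> schwartz (\<lambda>x. c * f x)"
  unfolding schwartz_def using sch_add sch_cmult by blast+

lemma schwartz_cpoly_mult:
  assumes "cpoly P"
  shows "schwartz h \<Longrightarrow> schwartz (\<lambda>x. P x * h x)"
  using assms
proof (induction arbitrary: h rule: cpoly.induct)
  case (const c)
  then show ?case by (rule schwartz_cmult)
next
  case (coord j)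
  then show ?case by (rule schwartzD(4))
next
  case (add f g)
  show ?case unfolding distrib_right by (intro schwartz_add add)
next
  case (mult f g)
  show ?case unfolding mult.assoc by (intro mult)
qed

lemma power_le_exp: "t \<ge> 0 \<Longrightarrow> t ^ d \<le> real d ^ d * exp t"
proof (cases "d = 0")
  case False
  assume t: "t \<ge> 0"
  have "(t / real d) ^ d \<le> exp (t / real d) ^ d"
    using t exp_ge_add_one_self[of "t / real d"] by (intro power_mono) (linarith, simp)
  also have "\<dots> = exp t" using False by (simp add: exp_of_nat_mult[symmetric])
  finally show ?thesis using False by (simp add: power_divide field_simps)
qed simp

text \<open>The rate may depend on the member of the family. Decay is asked only for
  \<open>y \<ge> 0\<close>, the values taken by the polynomial \<open>b\<close> into which the
  profile is inserted.\<close>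

definition exp_decay :: "(real \<Rightarrow> real) set \<Rightarrow> bool" where
  "exp_decay S \<longleftrightarrow> deriv_closed S \<and> (\<forall>\<sigma>\<in>S. \<exists>C s. s > 0 \<and> (\<forall>y\<ge>0. \<bar>\<sigma> y\<bar> \<le> C * exp (- s * y)))"

text \<open>As \<open>norm x\<close> is at most linear in \<open>1 + b x\<close>, exponential decay
  in \<open>b x\<close> beats every polynomial in \<open>x\<close>, in particular \<open>P\<close>
  times the reciprocal of the weight.\<close>

lemma exp_decay_bound:
  assumes S: "exp_decay S" "\<sigma> \<in> S" and P: "cpoly P"
    and b: "\<And>x::real^'n::finite. b x \<ge> 0" "\<And>x. norm x \<le> A * (1 + b x)" and A: "A > 0"
  shows "\<exists>C. \<forall>x. norm (P x * complex_of_real (\<sigma> (b x))) \<le> C * decay_wt x"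
proof -
  from S obtain C s where s: "s > 0" and C: "\<And>y. y \<ge> 0 \<Longrightarrow> \<bar>\<sigma> y\<bar> \<le> C * exp (- s * y)"
    unfolding exp_decay_def by metis
  have C0: "C \<ge> 0" using C[of 0] by simp
  let ?Q = "\<lambda>x. P x * (\<Prod>j\<in>UNIV. 1 + complex_of_real (x $ j) ^ 2)"
  have "cpoly ?Q"
    by (intro P cpoly.mult cpoly_prod cpoly.add cpoly.const cpoly_power cpoly.coord)
  then obtain K d where K: "K \<ge> 0" "\<And>x. norm (?Q x) \<le> K * (1 + norm x) ^ d"
    by (rule cpoly_growth) (rule that)
  \<comment> \<open>The quantity 1 + A + A b(x) dominates 1 + |x|, and \<open>?c\<close> is the rate
    at which exp(-s b(x)) decays in it.\<close>
  let ?c = "s / A"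
  let ?M = "real d ^ d * exp (?c * (1 + A)) / ?c ^ d"
  have c: "?c > 0" using s A by simp
  have main: "(1 + norm x) ^ d * exp (- s * b x) \<le> ?M" for x
  proof -
    let ?t = "?c * (1 + A + A * b x)"
    have t0: "1 + A + A * b x \<ge> 0" using A b(1)[of x] by simp
    have "(1 + norm x) ^ d * exp (- s * b x) \<le> (1 + A + A * b x) ^ d * exp (- s * b x)"
      using b(2)[of x] A by (intro mult_right_mono power_mono) (auto simp: algebra_simps)
    also have "\<dots> = ?t ^ d / ?c ^ d * (exp (?c * (1 + A)) * exp (- ?t))"
    proof -
      have "exp (- s * b x) = exp (?c * (1 + A)) * exp (- ?t)"
        using A by (simp add: exp_add[symmetric] field_simps)
      moreover have "(1 + A + A * b x) ^ d = ?t ^ d / ?c ^ d"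
      proof -
        have "1 + A + A * b x = ?t / ?c" using s A by simp
        then have "(1 + A + A * b x) ^ d = (?t / ?c) ^ d" by (rule arg_cong)
        then show ?thesis by (simp only: power_divide)
      qed
      ultimately show ?thesis by simp
    qed
    also have "\<dots> \<le> (real d ^ d * exp ?t) / ?c ^ d * (exp (?c * (1 + A)) * exp (- ?t))"
      using c t0 by (intro mult_right_mono divide_right_mono power_le_exp mult_nonneg_nonneg) simp_all
    also have "\<dots> = ?M" by (simp add: exp_minus field_simps)
    finally show ?thesis .
  qed
  show ?thesis
  proof (intro exI allI)
    fix x :: "real^'n"
    let ?w = "\<Prod>j\<in>UNIV. 1 + (x $ j)\<^sup>2"
    have w: "?w \<ge> 0" by (intro prod_nonneg) auto
    have "(\<Prod>j\<in>UNIV. 1 + complex_of_real (x $ j) ^ 2) = complex_of_real ?w" by simp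
    then have nQ: "norm (?Q x) = norm (P x) * ?w" using w by (simp only: norm_mult norm_of_real abs_of_nonneg)
    have "norm (P x) * ?w * \<bar>\<sigma> (b x)\<bar> \<le> (K * (1 + norm x) ^ d) * (C * exp (- s * b x))"
      using K(2)[of x] C[OF b(1)[of x]] K(1) w unfolding nQ
      by (intro mult_mono[of "norm (P x) * ?w" _ "\<bar>\<sigma> (b x)\<bar>"]) simp_all
    also have "\<dots> = K * C * ((1 + norm x) ^ d * exp (- s * b x))" by simp
    also have "\<dots> \<le> K * C * ?M" using K(1) C0 main by (intro mult_left_mono) auto
    finally have "norm (P x) * ?w * \<bar>\<sigma> (b x)\<bar> * decay_wt x \<le> K * C * ?M * decay_wt x"
      using decay_wt_pos[of x] by (intro mult_right_mono) auto
    moreover have "norm (P x) * ?w * \<bar>\<sigma> (b x)\<bar> * decay_wt x = norm (P x) * \<bar>\<sigma> (b x)\<bar> * (?w * decay_wt x)"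
      by (simp only: mult_ac)
    ultimately show "norm (P x * complex_of_real (\<sigma> (b x))) \<le> K * C * ?M * decay_wt x"
      unfolding decay_wt_cancel by (simp only: norm_mult norm_of_real mult_1_right)
  qed
qed

text \<open>The derivative of P \<sigma>(b) is P (\<partial>b) \<sigma>'(b) + (\<partial>P)
  \<sigma>(b), a sum of functions of the same form. The induction must therefore generalize over
  both \<open>P\<close> and \<open>\<sigma>\<close>.\<close>

lemma schwartz_exp_decay:
  assumes S: "exp_decay S" and b: "cpoly (\<lambda>x. complex_of_real (b x))"
    "\<And>x::real^'n::finite. b x \<ge> 0" "\<And>x. norm x \<le> A * (1 + b x)" "A > 0"
    and \<sigma>: "\<sigma> \<in> S" and P: "cpoly P"
  shows "schwartz (\<lambda>x. P x * complex_of_real (\<sigma> (b x)))"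
  unfolding schwartz_def
proof
  have cl: "deriv_closed S" using S by (simp add: exp_decay_def)
  have 0: "sch 0 (\<lambda>x. P x * complex_of_real (\<sigma> (b x)))" if "\<sigma> \<in> S" "cpoly P" for \<sigma> P
    using exp_decay_bound[OF S that b(2-4)] Ck_continuous[OF Ck_comp[OF cl b(1) that(1), of 0]]
      cpoly_continuous[OF that(2)] by (auto intro: continuous_intros)
  fix k show "sch k (\<lambda>x. P x * complex_of_real (\<sigma> (b x)))"
    using \<sigma> P
  proof (induction k arbitrary: P \<sigma>)
    case (Suc k)
    then obtain \<sigma>' where \<sigma>': "\<sigma>' \<in> S" "\<And>t. (\<sigma> has_real_derivative \<sigma>' t) (at t)"
      using cl by (auto simp: deriv_closed_def)
    note d = real_comp_partial_deriv[OF b(1) \<sigma>'(2)]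
    have eq: "partial_deriv j (\<lambda>x. P x * complex_of_real (\<sigma> (b x))) = (\<lambda>x.
      (P x * partial_deriv j (\<lambda>x. complex_of_real (b x)) x) * complex_of_real (\<sigma>' (b x))
      + partial_deriv j P x * complex_of_real (\<sigma> (b x)))" for j
      by (rule ext, subst partial_deriv_mult[OF cpoly_differentiable[OF Suc.prems(2)] d(1)])
         (simp add: d(2))
    have "sch k (partial_deriv j (\<lambda>x. P x * complex_of_real (\<sigma> (b x))))" for j
      unfolding eq using Suc.prems \<sigma>'(1)
      by (intro sch_add Suc.IH cpoly.mult cpoly_partial_deriv b)
    moreover have "sch k (\<lambda>x. complex_of_real (x $ j) * (P x * complex_of_real (\<sigma> (b x))))" for j
      unfolding mult.assoc[symmetric] using Suc.prems by (intro Suc.IH cpoly.mult cpoly.coord)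
    ultimately show ?case
      using 0[OF Suc.prems] d(1) cpoly_differentiable[OF Suc.prems(2)] by auto
  qed (rule 0)
qed

section \<open>The Fourier integral\<close>

text \<open>The inverse Fourier transform without the factor \<open>(2 \<pi>)\<^sup>-\<^sup>n\<close>.\<close>

definition ift :: "(real^'n::finite \<Rightarrow> complex) \<Rightarrow> real^'n \<Rightarrow> complex" where
  "ift h x = (LINT \<xi>|lborel. h \<xi> * cis (x \<bullet> \<xi>))"

lemma cis_measurable [measurable]: "f \<in> borel_measurable M \<Longrightarrow> (\<lambda>x. cis (f x)) \<in> borel_measurable M"
  by (rule measurable_compose[of f M borel cis borel])
     (auto intro!: borel_measurable_continuous_onI continuous_intros)

lemma integrable_mult_cis:
  "integrable lborel h \<Longrightarrow> integrable lborel (\<lambda>\<xi>::real^'n::finite. h \<xi> * cis (x \<bullet> \<xi>))"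
  by (rule Bochner_Integration.integrable_bound[of _ h]) (auto simp: norm_mult)

lemma ift_norm_le: "norm (ift h x) \<le> (LINT \<xi>|lborel. norm (h \<xi>))"
  unfolding ift_def using integral_norm_bound[of lborel "\<lambda>\<xi>. h \<xi> * cis (x \<bullet> \<xi>)"] by (simp add: norm_mult)

lemma ift_add:
  assumes "integrable lborel f" "integrable lborel g"
  shows "ift (\<lambda>\<xi>. f \<xi> + g \<xi>) x = ift f x + ift g x"
  using integrable_mult_cis[OF assms(1)] integrable_mult_cis[OF assms(2)]
  by (simp add: ift_def distrib_right)

lemma ift_cmult: "ift (\<lambda>\<xi>. c * f \<xi>) x = c * ift f x"
  by (simp add: ift_def mult.assoc)

lemma ift_sum:
  assumes "\<And>i. i \<in> I \<Longrightarrow> integrable lborel (f i)"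
  shows "ift (\<lambda>\<xi>. \<Sum>i\<in>I. f i \<xi>) x = (\<Sum>i\<in>I. ift (f i) x)"
  unfolding ift_def sum_distrib_right
  by (rule Bochner_Integration.integral_sum) (intro integrable_mult_cis assms)

lemma cis_approx: "norm (cis t - 1 - \<i> * complex_of_real t) \<le> t\<^sup>2 / 2"
  using iexp_approx1[of t 1] by (simp add: cis_conv_exp numeral_2_eq_2 algebra_simps)

text \<open>The quadratic Taylor estimate for \<open>cis\<close> bounds the remainder by |h(\<xi>)|
  |\<xi>|^2 |y|^2 / 2, which is integrable in \<xi> because |\<xi>|^2 is a polynomial
  factor.\<close>

lemma ift_has_derivative:
  assumes h: "schwartz h"
  shows "(ift h has_derivative (\<lambda>y. \<Sum>j\<in>UNIV. complex_of_real (y $ j) *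
      ift (\<lambda>\<xi>. \<i> * (complex_of_real (\<xi> $ j) * h \<xi>)) x)) (at x)"
proof -
  let ?hj = "\<lambda>j \<xi>. \<i> * (complex_of_real (\<xi> $ j) * h \<xi>)"
  let ?D = "\<lambda>y. \<Sum>j\<in>UNIV. complex_of_real (y $ j) * ift (?hj j) x"
  have hj: "integrable lborel (?hj j)" for j
    by (intro schwartzD(3) schwartz_cmult schwartzD(4) h)
  let ?C = "LINT \<xi>|lborel. norm (h \<xi>) * (norm \<xi>)\<^sup>2"
  have int2: "integrable lborel (\<lambda>\<xi>. norm (h \<xi>) * (norm \<xi>)\<^sup>2)"
  proof -
    have "schwartz (\<lambda>\<xi>. (\<Sum>j\<in>UNIV. complex_of_real (\<xi> $ j) * complex_of_real (\<xi> $ j)) * h \<xi>)"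
      by (intro schwartz_cpoly_mult h cpoly_sum cpoly.mult cpoly.coord)
    from integrable_norm[OF schwartzD(3)[OF this]]
    have "integrable lborel (\<lambda>\<xi>. norm (\<Sum>j\<in>UNIV. complex_of_real (\<xi> $ j) * complex_of_real (\<xi> $ j)) * norm (h \<xi>))"
      by (simp only: norm_mult)
    moreover have "norm (\<Sum>j\<in>UNIV. complex_of_real (\<xi> $ j) * complex_of_real (\<xi> $ j)) = (norm \<xi>)\<^sup>2" for \<xi> :: "real^'a"
    proof -
      have "(\<Sum>j\<in>UNIV. complex_of_real (\<xi> $ j) * complex_of_real (\<xi> $ j)) = complex_of_real (\<xi> \<bullet> \<xi>)"
        by (simp add: inner_vec_def)
      then show ?thesis by (simp only: norm_of_real) (simp add: power2_norm_eq_inner)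
    qed
    ultimately show ?thesis by (simp add: mult.commute)
  qed
  have quad: "norm (ift h (x + y) - ift h x - ?D y) \<le> ?C / 2 * (norm y)\<^sup>2" for y
  proof -
    have D: "?D y = (LINT \<xi>|lborel. h \<xi> * (\<i> * complex_of_real (y \<bullet> \<xi>)) * cis (x \<bullet> \<xi>))"
      and iD: "integrable lborel (\<lambda>\<xi>. h \<xi> * (\<i> * complex_of_real (y \<bullet> \<xi>)) * cis (x \<bullet> \<xi>))"
    proof -
      have eq: "h \<xi> * (\<i> * complex_of_real (y \<bullet> \<xi>)) * cis (x \<bullet> \<xi>)
          = (\<Sum>j\<in>UNIV. complex_of_real (y $ j) * (?hj j \<xi> * cis (x \<bullet> \<xi>)))" for \<xi>
        by (simp add: inner_vec_def sum_distrib_left sum_distrib_right mult_ac)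
      show "?D y = (LINT \<xi>|lborel. h \<xi> * (\<i> * complex_of_real (y \<bullet> \<xi>)) * cis (x \<bullet> \<xi>))"
        "integrable lborel (\<lambda>\<xi>. h \<xi> * (\<i> * complex_of_real (y \<bullet> \<xi>)) * cis (x \<bullet> \<xi>))"
        unfolding eq using integrable_mult_cis[OF hj] by (simp_all add: ift_def)
    qed
    have i1: "integrable lborel (\<lambda>\<xi>. h \<xi> * cis ((x + y) \<bullet> \<xi>))" "integrable lborel (\<lambda>\<xi>. h \<xi> * cis (x \<bullet> \<xi>))"
      using schwartzD(3)[OF h] by (rule integrable_mult_cis)+
    let ?R = "\<lambda>\<xi>. h \<xi> * cis ((x + y) \<bullet> \<xi>) - h \<xi> * cis (x \<bullet> \<xi>) - h \<xi> * (\<i> * complex_of_real (y \<bullet> \<xi>)) * cis (x \<bullet> \<xi>)"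
    have "ift h (x + y) - ift h x - ?D y = (LINT \<xi>|lborel. ?R \<xi>)"
      unfolding D unfolding ift_def using i1 iD by simp
    also have "norm \<dots> \<le> (LINT \<xi>|lborel. norm (h \<xi>) * (norm \<xi>)\<^sup>2 * ((norm y)\<^sup>2 / 2))"
    proof (rule Bochner_Integration.integral_norm_bound_integral)
      show "integrable lborel ?R" using i1 iD by (intro Bochner_Integration.integrable_diff)
      show "integrable lborel (\<lambda>\<xi>. norm (h \<xi>) * (norm \<xi>)\<^sup>2 * ((norm y)\<^sup>2 / 2))" using int2 by simp
      fix \<xi>
      have "?R \<xi> = h \<xi> * cis (x \<bullet> \<xi>) * (cis (y \<bullet> \<xi>) - 1 - \<i> * complex_of_real (y \<bullet> \<xi>))"
        by (simp add: inner_add_left cis_mult[symmetric] algebra_simps)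
      then have "norm (?R \<xi>) = norm (h \<xi>) * norm (cis (y \<bullet> \<xi>) - 1 - \<i> * complex_of_real (y \<bullet> \<xi>))"
        by (simp only: norm_mult norm_cis mult_1_right)
      also have "\<dots> \<le> norm (h \<xi>) * ((y \<bullet> \<xi>)\<^sup>2 / 2)"
        by (intro mult_left_mono cis_approx) simp
      also have "\<dots> \<le> norm (h \<xi>) * ((norm y * norm \<xi>)\<^sup>2 / 2)"
        using Cauchy_Schwarz_ineq2[of y \<xi>] abs_le_square_iff[of "y \<bullet> \<xi>" "norm y * norm \<xi>"]
        by (intro mult_left_mono) auto
      finally show "norm (?R \<xi>) \<le> norm (h \<xi>) * (norm \<xi>)\<^sup>2 * ((norm y)\<^sup>2 / 2)"
        by (simp add: power_mult_distrib mult_ac)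
    qed
    also have "\<dots> = ?C / 2 * (norm y)\<^sup>2" by simp
    finally show ?thesis .
  qed
  have lin: "bounded_linear ?D"
    by (intro bounded_linear_sum bounded_linear_mult_const bounded_linear_compose[OF bounded_linear_of_real bounded_linear_vec_nth])
  have "((\<lambda>y. norm (ift h (x + y) - ift h x - ?D y) / norm y) \<longlongrightarrow> 0) (at 0)"
  proof (rule tendsto_sandwich[of "\<lambda>_. 0" _ _ "\<lambda>y. ?C / 2 * norm y"])
    show "\<forall>\<^sub>F y in at 0. norm (ift h (x + y) - ift h x - ?D y) / norm y \<le> ?C / 2 * norm y"
    proof (rule always_eventually, rule allI)
      fix y :: "real^'a"
      show "norm (ift h (x + y) - ift h x - ?D y) / norm y \<le> ?C / 2 * norm y"
        using divide_right_mono[OF quad[of y] norm_ge_zero[of y]] by (cases "y = 0") (auto simp: power2_eq_square)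
    qed
    show "((\<lambda>y. ?C / 2 * norm y) \<longlongrightarrow> 0) (at 0)" by (intro tendsto_eq_intros) auto
  qed auto
  then show ?thesis using lin by (simp add: has_derivative_at)
qed

lemma ift_differentiable: "schwartz h \<Longrightarrow> ift h differentiable at x"
  using ift_has_derivative differentiable_def by blast

lemma partial_deriv_ift:
  "schwartz h \<Longrightarrow> partial_deriv j (ift h) = ift (\<lambda>\<xi>. \<i> * (complex_of_real (\<xi> $ j) * h \<xi>))"
  by (rule ext, subst partial_deriv_eq[OF ift_has_derivative])
     (auto simp: axis_def if_distrib[of complex_of_real] if_distrib[of "\<lambda>x. x * _"] cong: if_cong)

lemma ift_continuous: "schwartz h \<Longrightarrow> continuous_on UNIV (ift h)"
  by (intro differentiable_imp_continuous_UNIV ift_differentiable)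

lemma Ck_ift: "schwartz h \<Longrightarrow> Ck k (ift h)"
  by (induction k arbitrary: h)
     (auto simp: partial_deriv_ift intro: ift_continuous ift_differentiable schwartz_cmult schwartzD(4))

section \<open>Multiplication by coordinates and decay of the transform\<close>

lemma cis_inner_has_derivative:
  "((\<lambda>\<xi>::real^'n::finite. cis (x \<bullet> \<xi>)) has_derivative (\<lambda>y. (x \<bullet> y) *\<^sub>R (\<i> * cis (x \<bullet> \<xi>)))) (at \<xi>)"
proof -
  have 1: "((\<lambda>\<xi>. x \<bullet> \<xi>) has_derivative (\<lambda>y. x \<bullet> y)) (at \<xi>)" by (auto intro!: derivative_eq_intros)
  have 2: "(cis has_derivative (\<lambda>t. t *\<^sub>R (\<i> * cis (x \<bullet> \<xi>)))) (at (x \<bullet> \<xi>))"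
  proof -
    have "((\<lambda>z. exp (\<i> * z)) has_field_derivative \<i> * cis (x \<bullet> \<xi>)) (at (complex_of_real (x \<bullet> \<xi>)))"
      by (auto intro!: derivative_eq_intros simp: cis_conv_exp)
    from has_vector_derivative_real_field[OF this, unfolded has_vector_derivative_def]
    show ?thesis unfolding cis_conv_exp[symmetric] by simp
  qed
  from diff_chain_at[OF 1 2] show ?thesis by (simp add: o_def)
qed

text \<open>Integration by parts: the \<xi>_j-derivative of h(\<xi>) cis (x \<bullet> \<xi>) has
  integral zero.\<close>

lemma mult_ift_eq:
  assumes h: "schwartz h"
  shows "complex_of_real (x $ j) * ift h x = ift (\<lambda>\<xi>. \<i> * partial_deriv j h \<xi>) x"
proof -
  let ?f = "\<lambda>\<xi>. h \<xi> * cis (x \<bullet> \<xi>)"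
  have "partial_deriv j (\<lambda>\<xi>. cis (x \<bullet> \<xi>)) \<xi> = complex_of_real (x $ j) * (\<i> * cis (x \<bullet> \<xi>))" for \<xi>
    by (subst partial_deriv_eq[OF cis_inner_has_derivative]) (simp add: inner_axis scaleR_conv_of_real)
  then have eq: "partial_deriv j ?f = (\<lambda>\<xi>. \<i> * complex_of_real (x $ j) * (h \<xi> * cis (x \<bullet> \<xi>)) + partial_deriv j h \<xi> * cis (x \<bullet> \<xi>))"
    using cis_inner_has_derivative[of x]
    by (intro ext, subst partial_deriv_mult) (auto simp: differentiable_def mult_ac intro: schwartzD(2)[OF h, unfolded differentiable_def])
  have cc: "continuous_on UNIV (\<lambda>\<xi>. cis (x \<bullet> \<xi>))" by (intro continuous_intros)
  have i: "integrable lborel ?f" "integrable lborel (\<lambda>\<xi>. partial_deriv j h \<xi> * cis (x \<bullet> \<xi>))"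
    by (intro integrable_mult_cis schwartzD(3) schwartzD(5) h)+
  have "(LINT \<xi>|lborel. partial_deriv j ?f \<xi>) = 0"
  proof (rule integral_partial_deriv_eq_0)
    show "?f differentiable at \<xi>" for \<xi>
      using cis_inner_has_derivative[of x \<xi>] schwartzD(2)[OF h, of \<xi>]
      by (intro differentiable_mult) (auto simp: differentiable_def)
    show "continuous_on UNIV (partial_deriv j ?f)"
      unfolding eq by (intro continuous_intros cc schwartzD(1) schwartzD(5) h)
  qed (use i in \<open>auto simp: eq\<close>)
  then have "\<i> * complex_of_real (x $ j) * ift h x + ift (partial_deriv j h) x = 0"
    unfolding eq ift_def using i by simp
  then have "\<i> * (\<i> * complex_of_real (x $ j) * ift h x + ift (partial_deriv j h) x) = 0" by simp
  then have "complex_of_real (x $ j) * ift h x = \<i> * ift (partial_deriv j h) x"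
    by (simp add: algebra_simps)
  then show ?thesis by (simp add: ift_cmult)
qed

text \<open>Multiplying the transform by 1 + x_j^2 corresponds to applying 1 - \<partial>_j^2 to
  \<open>h\<close>. Doing this once per coordinate gives the transform of another rapidly decreasing
  function, which is bounded.\<close>

lemma ift_decay:
  assumes h: "schwartz h"
  obtains C where "C \<ge> 0" "\<And>x. norm (ift h x) \<le> C * decay_wt x"
proof -
  have "\<exists>h'. schwartz h' \<and> (\<forall>x. (\<Prod>j\<in>J. 1 + complex_of_real (x $ j) ^ 2) * ift h x = ift h' x)" for J
  proof (induction J rule: infinite_finite_induct)
    case (insert i J)
    then obtain h' where h': "schwartz h'" "\<And>x. (\<Prod>j\<in>J. 1 + complex_of_real (x $ j) ^ 2) * ift h x = ift h' x" by blast
    let ?g = "\<lambda>\<xi>. \<i> * partial_deriv i h' \<xi>"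
    let ?h = "\<lambda>\<xi>. h' \<xi> + \<i> * partial_deriv i ?g \<xi>"
    have g: "schwartz ?g" by (intro schwartz_cmult schwartzD(5) h')
    have sg: "schwartz (\<lambda>\<xi>. \<i> * partial_deriv i ?g \<xi>)" by (intro schwartz_cmult schwartzD(5) g)
    have "ift ?h x = ift h' x + complex_of_real (x $ i) * (complex_of_real (x $ i) * ift h' x)" for x
      unfolding mult_ift_eq[OF h'(1)] mult_ift_eq[OF g]
      by (rule ift_add(1)) (intro schwartzD(3) h' sg)+
    then have "(\<Prod>j\<in>insert i J. 1 + complex_of_real (x $ j) ^ 2) * ift h x = ift ?h x" for x
      using insert h'(2)[of x] by (simp add: mult.assoc) (simp add: algebra_simps power2_eq_square)
    moreover have "schwartz ?h" by (intro schwartz_add h' sg)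
    ultimately show ?case by blast
  qed (use h in auto)
  then obtain h' where h': "\<And>x. (\<Prod>j\<in>UNIV. 1 + complex_of_real (x $ j) ^ 2) * ift h x = ift h' x" by blast
  let ?C = "LINT \<xi>|lborel. norm (h' \<xi>)"
  show ?thesis
  proof (rule that[of ?C])
    fix x :: "real^'a"
    let ?w = "\<Prod>j\<in>UNIV. 1 + (x $ j)\<^sup>2"
    have w: "?w \<ge> 0" by (intro prod_nonneg) auto
    have "complex_of_real ?w * ift h x = ift h' x" using h'[of x] by simp
    then have "?w * norm (ift h x) = norm (ift h' x)"
      using w by (metis norm_mult norm_of_real abs_of_nonneg)
    then have "?w * norm (ift h x) * decay_wt x \<le> ?C * decay_wt x"
      using ift_norm_le[of h' x] decay_wt_pos[of x] by (intro mult_right_mono) auto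
    moreover have "?w * norm (ift h x) * decay_wt x = norm (ift h x) * (?w * decay_wt x)" by (simp only: mult_ac)
    ultimately show "norm (ift h x) \<le> ?C * decay_wt x" unfolding decay_wt_cancel by simp
  qed simp
qed

lemma ift_measurable: "schwartz h \<Longrightarrow> ift h \<in> borel_measurable borel"
  by (rule borel_measurable_continuous_onI[OF ift_continuous])

lemma ift_integrable: "schwartz h \<Longrightarrow> integrable lborel (ift h)"
  by (rule ift_decay, assumption, rule integrable_decay_wt_bound[OF ift_measurable])

section \<open>Fourier inversion\<close>

definition gauss :: "real^'n::finite \<Rightarrow> real" where "gauss x = exp (- (norm x)\<^sup>2 / 2)"

text \<open>Read off from the characteristic function of the standard normal distribution.\<close>

lemma gaussian_integral_1D:
  "integrable lborel (\<lambda>t::real. complex_of_real (exp (- t\<^sup>2 / 2)) * cis (s * t))"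
  "(LINT t|lborel. complex_of_real (exp (- t\<^sup>2 / 2)) * cis (s * t)) = complex_of_real (sqrt (2 * pi) * exp (- s\<^sup>2 / 2))"
proof -
  have "integrable lborel (\<lambda>t. complex_of_real (sqrt (2 * pi) * std_normal_density t))"
    unfolding complex_of_real_integrable_eq by (intro integrable_mult_right integrable_normal_density) simp
  then have i: "integrable lborel (\<lambda>t::real. complex_of_real (exp (- t\<^sup>2 / 2)))"
    by (simp add: std_normal_density_def)
  show "integrable lborel (\<lambda>t::real. complex_of_real (exp (- t\<^sup>2 / 2)) * cis (s * t))"
    by (rule Bochner_Integration.integrable_bound[OF i]) (auto simp: norm_mult)
  have "char std_normal_distribution s = (LINT t|lborel. std_normal_density t *\<^sub>R iexp (s * t))"
    unfolding char_def by (subst integral_density) auto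
  also have "\<dots> = (LINT t|lborel. complex_of_real (1 / sqrt (2 * pi)) * (complex_of_real (exp (- t\<^sup>2 / 2)) * cis (s * t)))"
    by (simp add: std_normal_density_def scaleR_conv_of_real cis_conv_exp)
  also have "\<dots> = complex_of_real (1 / sqrt (2 * pi)) * (LINT t|lborel. complex_of_real (exp (- t\<^sup>2 / 2)) * cis (s * t))"
    by (rule Bochner_Integration.integral_mult_right_zero)
  finally have "complex_of_real (sqrt (2 * pi)) * complex_of_real (exp (- s\<^sup>2 / 2))
      = complex_of_real (sqrt (2 * pi)) * (complex_of_real (1 / sqrt (2 * pi)) * (LINT t|lborel. complex_of_real (exp (- t\<^sup>2 / 2)) * cis (s * t)))"
    by (simp add: char_std_normal_distribution)
  also have "complex_of_real (sqrt (2 * pi)) * (complex_of_real (1 / sqrt (2 * pi)) * z) = z" for z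
    by (simp add: mult.assoc[symmetric] of_real_mult[symmetric] del: of_real_mult)
  finally show "(LINT t|lborel. complex_of_real (exp (- t\<^sup>2 / 2)) * cis (s * t)) = complex_of_real (sqrt (2 * pi) * exp (- s\<^sup>2 / 2))"
    by simp
qed

lemma gaussian_integral:
  fixes s :: "real^'n::finite"
  shows "integrable lborel (\<lambda>x. complex_of_real (gauss x) * cis (s \<bullet> x))"
    and "(LINT x|lborel. complex_of_real (gauss x) * cis (s \<bullet> x))
      = complex_of_real (sqrt (2 * pi) ^ CARD('n) * gauss s)"
proof -
  have norm2: "(norm x)\<^sup>2 = (\<Sum>j\<in>UNIV. (x $ j)\<^sup>2)" for x :: "real^'n"
    unfolding power2_norm_eq_inner inner_vec_def by (simp add: power2_eq_square)
  have g: "complex_of_real (gauss x) = (\<Prod>j\<in>UNIV. complex_of_real (exp (- (x $ j)\<^sup>2 / 2)))" for x :: "real^'n"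
    by (simp add: gauss_def norm2 exp_sum[symmetric] sum_negf sum_divide_distrib of_real_prod[symmetric] del: of_real_prod)
  have c: "cis (s \<bullet> x) = (\<Prod>j\<in>UNIV. cis (s $ j * x $ j))" for x
    by (simp add: cis_conv_exp exp_sum[symmetric] inner_vec_def sum_distrib_left)
  have eq: "complex_of_real (gauss x) * cis (s \<bullet> x) = (\<Prod>j\<in>UNIV. complex_of_real (exp (- (x $ j)\<^sup>2 / 2)) * cis (s $ j * x $ j))" for x
    unfolding g c prod.distrib ..
  show "integrable lborel (\<lambda>x. complex_of_real (gauss x) * cis (s \<bullet> x))"
    unfolding eq by (rule lborel_prod_integral(1)) (rule gaussian_integral_1D(1))
  have "(LINT x|lborel. complex_of_real (gauss x) * cis (s \<bullet> x)) = (\<Prod>j\<in>UNIV. complex_of_real (sqrt (2 * pi) * exp (- (s $ j)\<^sup>2 / 2)))"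
    unfolding eq gaussian_integral_1D(2)[symmetric] by (rule lborel_prod_integral(2)) (rule gaussian_integral_1D(1))
  also have "\<dots> = complex_of_real (sqrt (2 * pi) ^ CARD('n)) * (\<Prod>j\<in>UNIV. complex_of_real (exp (- (s $ j)\<^sup>2 / 2)))"
    by (simp add: prod.distrib)
  finally show "(LINT x|lborel. complex_of_real (gauss x) * cis (s \<bullet> x))
      = complex_of_real (sqrt (2 * pi) ^ CARD('n) * gauss s)" unfolding g[symmetric] by simp
qed

lemma gauss_bounds: "0 < gauss x" "gauss x \<le> 1" by (auto simp: gauss_def)

lemma abs_gauss [simp]: "\<bar>gauss x\<bar> = gauss x" by (simp add: gauss_def)

lemma gauss_continuous: "continuous_on S gauss"
  unfolding gauss_def[abs_def] by (intro continuous_intros) auto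

lemma gauss_measurable [measurable]: "gauss \<in> borel_measurable borel"
  by (rule borel_measurable_continuous_onI[OF gauss_continuous])

lemma gauss_integrable: "integrable lborel (gauss :: real^'n::finite \<Rightarrow> real)"
  using gaussian_integral(1)[of 0] by (simp add: complex_of_real_integrable_eq)

definition fourier_const :: "'n::finite itself \<Rightarrow> complex" where
  "fourier_const _ = complex_of_real ((2 * pi) ^ CARD('n))"

lemma fourier_const_nz: "fourier_const TYPE('n::finite) \<noteq> 0"
  by (simp add: fourier_const_def)

lemma gaussian_integral_scaled:
  fixes s :: "real^'n::finite"
  assumes e: "e > 0"
  shows "(LINT x|lborel. complex_of_real (gauss (e *\<^sub>R x)) * cis (x \<bullet> s))
    = complex_of_real (inverse (e ^ CARD('n)) * sqrt (2 * pi) ^ CARD('n) * gauss (s /\<^sub>R e))"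
    and "integrable lborel (\<lambda>x::real^'n. complex_of_real (gauss (e *\<^sub>R x)))"
proof -
  have eq: "(s /\<^sub>R e) \<bullet> (e *\<^sub>R x) = x \<bullet> s" for x using e by (simp add: inner_commute)
  have "complex_of_real (sqrt (2 * pi) ^ CARD('n) * gauss (s /\<^sub>R e))
      = (LINT x|lborel. complex_of_real (gauss x) * cis ((s /\<^sub>R e) \<bullet> x))"
    by (rule gaussian_integral(2)[symmetric])
  also have "\<dots> = e ^ CARD('n) *\<^sub>R (LINT x|lborel. complex_of_real (gauss (e *\<^sub>R x)) * cis (x \<bullet> s))"
    using lborel_affine_integral(2)[OF gaussian_integral(1)[of "s /\<^sub>R e"], of e 0] e
    by (simp add: eq del: inner_scaleR_left inner_scaleR_right)
  finally show "(LINT x|lborel. complex_of_real (gauss (e *\<^sub>R x)) * cis (x \<bullet> s))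
    = complex_of_real (inverse (e ^ CARD('n)) * sqrt (2 * pi) ^ CARD('n) * gauss (s /\<^sub>R e))"
    using e by (simp add: scaleR_conv_of_real field_simps)
  show "integrable lborel (\<lambda>x::real^'n. complex_of_real (gauss (e *\<^sub>R x)))"
    using lborel_affine_integral(1)[OF gauss_integrable, of e 0] e by (simp add: complex_of_real_integrable_eq)
qed

text \<open>Regularize by Gaussians \<open>gauss (e x)\<close> with \<open>e \<rightarrow> 0\<close>.\<close>

lemma fourier_inversion:
  fixes h :: "real^'n::finite \<Rightarrow> complex"
  assumes h: "schwartz h"
  shows "(LINT x|lborel. ift h x * cis (- (x \<bullet> \<eta>))) = fourier_const TYPE('n) * h \<eta>"
proof -
  let ?c = "sqrt (2 * pi) ^ CARD('n)"
  define e where "e k = inverse (real (Suc k))" for k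
  have e: "e k > 0" for k by (simp add: e_def)
  have e0: "e \<longlonglongrightarrow> 0" unfolding e_def by (rule LIMSEQ_inverse_real_of_nat)
  note [measurable] = schwartzD(6)[OF h] ift_measurable[OF h]
  have gcont: "isCont gauss x" for x :: "real^'n" using gauss_continuous[of "UNIV :: (real^'n) set"] by (simp add: continuous_on_eq_continuous_at)
  let ?I = "\<lambda>k. LINT x|lborel. ift h x * cis (- (x \<bullet> \<eta>)) * complex_of_real (gauss (e k *\<^sub>R x))"
  have lim1: "?I \<longlonglongrightarrow> (LINT x|lborel. ift h x * cis (- (x \<bullet> \<eta>)))"
  proof (rule integral_dominated_convergence[where w = "\<lambda>x. norm (ift h x)"])
    show "AE x in lborel. (\<lambda>k. ift h x * cis (- (x \<bullet> \<eta>)) * complex_of_real (gauss (e k *\<^sub>R x))) \<longlonglongrightarrow> ift h x * cis (- (x \<bullet> \<eta>))"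
    proof (rule AE_I2)
      fix x :: "real^'n"
      have "(\<lambda>k. e k *\<^sub>R x) \<longlonglongrightarrow> 0 *\<^sub>R x" by (rule tendsto_scaleR[OF e0 tendsto_const])
      from isCont_tendsto_compose[OF gcont this] have "(\<lambda>k. gauss (e k *\<^sub>R x)) \<longlonglongrightarrow> 1" by (simp add: gauss_def)
      then have "(\<lambda>k. ift h x * cis (- (x \<bullet> \<eta>)) * complex_of_real (gauss (e k *\<^sub>R x))) \<longlonglongrightarrow> ift h x * cis (- (x \<bullet> \<eta>)) * complex_of_real 1"
        by (intro tendsto_intros)
      then show "(\<lambda>k. ift h x * cis (- (x \<bullet> \<eta>)) * complex_of_real (gauss (e k *\<^sub>R x))) \<longlonglongrightarrow> ift h x * cis (- (x \<bullet> \<eta>))" by simp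
    qed
    show "AE x in lborel. norm (ift h x * cis (- (x \<bullet> \<eta>)) * complex_of_real (gauss (e k *\<^sub>R x))) \<le> norm (ift h x)" for k
      by (intro AE_I2) (simp add: norm_mult mult_left_le gauss_bounds)
    show "integrable lborel (\<lambda>x. norm (ift h x))" by (intro integrable_norm ift_integrable h)
  qed measurable
  \<comment> \<open>Fubini brings in the transform of the scaled Gaussian, which concentrates at
    \<eta>; the substitution \<eta> + e \<xi> moves the scale from the Gaussian to the argument of
    \<open>h\<close>.\<close>
  have Ik: "?I k = complex_of_real ?c * integral\<^sup>L lborel (\<lambda>\<xi>::real^'n. h (\<eta> + e k *\<^sub>R \<xi>) * complex_of_real (gauss \<xi>))" for k
  proof -
    let ?G = "\<lambda>\<xi> x. h \<xi> * (complex_of_real (gauss (e k *\<^sub>R x)) * cis (x \<bullet> (\<xi> - \<eta>)))"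
    have "integrable (lborel \<Otimes>\<^sub>M lborel) (\<lambda>(\<xi>, x). ?G \<xi> x)"
      by (rule Bochner_Integration.integrable_bound[OF integrable_pair_mult[OF schwartzD(3)[OF h] gaussian_integral_scaled(2)[OF e, of k]]])
         (auto simp: norm_mult)
    from lborel_pair.Fubini_integral[OF this]
    have fub: "(LINT x|lborel. LINT \<xi>|lborel. ?G \<xi> x) = (LINT \<xi>|lborel. LINT x|lborel. ?G \<xi> x)" .
    have inner1: "(LINT \<xi>|lborel. ?G \<xi> x) = ift h x * cis (- (x \<bullet> \<eta>)) * complex_of_real (gauss (e k *\<^sub>R x))" for x
    proof -
      have "(LINT \<xi>|lborel. ?G \<xi> x) = (LINT \<xi>|lborel. (h \<xi> * cis (x \<bullet> \<xi>)) * (cis (- (x \<bullet> \<eta>)) * complex_of_real (gauss (e k *\<^sub>R x))))"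
        by (rule Bochner_Integration.integral_cong) (auto simp: inner_diff_right cis_mult mult_ac)
      also have "\<dots> = ift h x * (cis (- (x \<bullet> \<eta>)) * complex_of_real (gauss (e k *\<^sub>R x)))"
        unfolding ift_def by (rule Bochner_Integration.integral_mult_left_zero)
      finally show ?thesis by (simp only: mult.assoc)
    qed
    have inner2: "(LINT x|lborel. ?G \<xi> x) = complex_of_real (?c * inverse (e k ^ CARD('n))) * (h \<xi> * complex_of_real (gauss ((\<xi> - \<eta>) /\<^sub>R e k)))" for \<xi>
      by (simp only: Bochner_Integration.integral_mult_right_zero gaussian_integral_scaled(1)[OF e]) simp
    have scale: "(LINT \<xi>|lborel. h \<xi> * complex_of_real (gauss ((\<xi> - \<eta>) /\<^sub>R e k)))
        = e k ^ CARD('n) *\<^sub>R integral\<^sup>L lborel (\<lambda>\<xi>::real^'n. h (\<eta> + e k *\<^sub>R \<xi>) * complex_of_real (gauss \<xi>))"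
    proof -
      have "integrable lborel (\<lambda>\<xi>. h \<xi> * complex_of_real (gauss ((\<xi> - \<eta>) /\<^sub>R e k)))"
        by (rule Bochner_Integration.integrable_bound[OF schwartzD(3)[OF h]])
           (auto simp: norm_mult mult_left_le gauss_bounds)
      from lborel_affine_integral(2)[OF this, of "e k" \<eta>] show ?thesis using e[of k] by simp
    qed
    let ?J = "integral\<^sup>L lborel (\<lambda>\<xi>::real^'n. h (\<eta> + e k *\<^sub>R \<xi>) * complex_of_real (gauss \<xi>))"
    have "?I k = (LINT x|lborel. LINT \<xi>|lborel. ?G \<xi> x)" by (simp only: inner1)
    also have "\<dots> = (LINT \<xi>|lborel. LINT x|lborel. ?G \<xi> x)" by (rule fub)
    also have "\<dots> = (LINT \<xi>|lborel. complex_of_real (?c * inverse (e k ^ CARD('n)))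
        * (h \<xi> * complex_of_real (gauss ((\<xi> - \<eta>) /\<^sub>R e k))))"
      by (simp only: inner2)
    also have "\<dots> = complex_of_real (?c * inverse (e k ^ CARD('n))) * (e k ^ CARD('n) *\<^sub>R ?J)"
      by (simp only: Bochner_Integration.integral_mult_right_zero scale)
    also have "\<dots> = complex_of_real ?c * ?J"
      using e[of k] by (simp add: scaleR_conv_of_real field_simps)
    finally show ?thesis .
  qed
  have lim2: "(\<lambda>k. integral\<^sup>L lborel (\<lambda>\<xi>::real^'n. h (\<eta> + e k *\<^sub>R \<xi>) * complex_of_real (gauss \<xi>))) \<longlonglongrightarrow> integral\<^sup>L lborel (\<lambda>\<xi>::real^'n. h \<eta> * complex_of_real (gauss \<xi>))"
  proof -
    obtain C where C: "C \<ge> 0" "\<And>x. norm (h x) \<le> C * decay_wt x" by (rule schwartz_bound[OF h]) (rule that)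
    have hb: "norm (h x) \<le> C" for x
      using C(2)[of x] mult_left_mono[OF decay_wt_le_1 C(1), of x] by simp
    show ?thesis
    proof (rule integral_dominated_convergence[where w = "\<lambda>x. C * gauss x"])
      show "AE \<xi> in lborel. (\<lambda>k. h (\<eta> + e k *\<^sub>R \<xi>) * complex_of_real (gauss \<xi>)) \<longlonglongrightarrow> h \<eta> * complex_of_real (gauss \<xi>)"
      proof (rule AE_I2)
        fix \<xi> :: "real^'n"
        have "(\<lambda>k. \<eta> + e k *\<^sub>R \<xi>) \<longlonglongrightarrow> \<eta> + 0 *\<^sub>R \<xi>" by (rule tendsto_add[OF tendsto_const tendsto_scaleR[OF e0 tendsto_const]])
        moreover have "isCont h \<eta>" using schwartzD(1)[OF h] by (simp add: continuous_on_eq_continuous_at)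
        ultimately have "(\<lambda>k. h (\<eta> + e k *\<^sub>R \<xi>)) \<longlonglongrightarrow> h \<eta>" by (intro isCont_tendsto_compose[of _ h]) simp_all
        then show "(\<lambda>k. h (\<eta> + e k *\<^sub>R \<xi>) * complex_of_real (gauss \<xi>)) \<longlonglongrightarrow> h \<eta> * complex_of_real (gauss \<xi>)"
          by (intro tendsto_intros)
      qed
      show "AE \<xi> in lborel. norm (h (\<eta> + e k *\<^sub>R \<xi>) * complex_of_real (gauss \<xi>)) \<le> C * gauss \<xi>" for k
        using hb by (intro AE_I2) (simp add: norm_mult mult_right_mono less_imp_le[OF gauss_bounds(1)])
      show "integrable lborel (\<lambda>x. C * gauss x)" by (intro integrable_mult_right gauss_integrable)
    qed measurable
  qed
  have val: "integral\<^sup>L lborel (\<lambda>\<xi>::real^'n. h \<eta> * complex_of_real (gauss \<xi>)) = complex_of_real ?c * h \<eta>"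
    using gaussian_integral(2)[of "0 :: real^'n"] by (simp add: gauss_def)
  \<comment> \<open>The constant \<open>?c\<close> occurs twice, once from the transform of the
    Gaussian and once from its total mass; its square is (2 \<pi>)^n.\<close>
  have "?I \<longlonglongrightarrow> complex_of_real ?c * (complex_of_real ?c * h \<eta>)"
    unfolding Ik by (rule tendsto_mult_left[OF lim2[unfolded val]])
  then have "(LINT x|lborel. ift h x * cis (- (x \<bullet> \<eta>))) = complex_of_real ?c * (complex_of_real ?c * h \<eta>)"
    by (rule LIMSEQ_unique[OF lim1])
  also have "complex_of_real ?c * (complex_of_real ?c * h \<eta>) = complex_of_real (?c * ?c) * h \<eta>"
    by (simp only: of_real_mult mult.assoc)
  also have "?c * ?c = (sqrt (2 * pi) * sqrt (2 * pi)) ^ CARD('n)" by (rule power_mult_distrib[symmetric])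
  also have "sqrt (2 * pi) * sqrt (2 * pi) = 2 * pi" by simp
  finally show ?thesis by (simp add: fourier_const_def)
qed

lemma ift_zero_imp_zero:
  fixes h :: "real^'n::finite \<Rightarrow> complex"
  assumes "schwartz h" "\<And>x. ift h x = 0"
  shows "h \<eta> = 0"
  using fourier_inversion[OF assms(1), of \<eta>] assms(2) fourier_const_nz[where 'n = 'n] by simp

definition exp_family :: "(real \<Rightarrow> real) set" where
  "exp_family = {\<sigma>. \<exists>c s. s > 0 \<and> \<sigma> = (\<lambda>y. c * exp (- s * y))}"

lemma exp_family_decay: "exp_decay exp_family"
  unfolding exp_decay_def deriv_closed_def
proof (intro conjI ballI)
  fix \<sigma> assume "\<sigma> \<in> exp_family"
  then obtain c s where s: "s > 0" and \<sigma>: "\<sigma> = (\<lambda>y. c * exp (- s * y))" by (auto simp: exp_family_def)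
  have "(\<lambda>y. (- s * c) * exp (- s * y)) \<in> exp_family" using s unfolding exp_family_def by blast
  moreover have "(\<sigma> has_real_derivative (- s * c) * exp (- s * t)) (at t)" for t
    unfolding \<sigma> by (auto intro!: derivative_eq_intros)
  ultimately show "\<exists>\<sigma>'\<in>exp_family. \<forall>t. (\<sigma> has_real_derivative \<sigma>' t) (at t)"
    by (intro bexI[of _ "\<lambda>y. (- s * c) * exp (- s * y)"]) auto
  show "\<exists>C s. s > 0 \<and> (\<forall>y\<ge>0. \<bar>\<sigma> y\<bar> \<le> C * exp (- s * y))"
    using s unfolding \<sigma> by (intro exI[of _ "\<bar>c\<bar>"] exI[of _ s]) (simp add: abs_mult)
qed

lemma cpoly_norm2: "cpoly (\<lambda>x::real^'n::finite. complex_of_real ((norm x)\<^sup>2))"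
proof -
  have "complex_of_real ((norm x)\<^sup>2) = (\<Sum>j\<in>UNIV. complex_of_real (x $ j) * complex_of_real (x $ j))" for x :: "real^'n"
    by (simp add: power2_norm_eq_inner inner_vec_def)
  then show ?thesis by (simp only:) (intro cpoly_sum cpoly.mult cpoly.coord)
qed

text \<open>The profile exp(-y/2) at y = |x|^2. The Gaussian has no zeros, so it can be divided out
  again after Fourier inversion.\<close>

lemma schwartz_cpoly_gauss:
  assumes "cpoly P" shows "schwartz (\<lambda>x. P x * complex_of_real (gauss x))"
proof -
  have A: "norm x \<le> 1 * (1 + (norm x)\<^sup>2)" for x :: "real^'a"
  proof -
    have "0 \<le> (norm x - 1)\<^sup>2" by simp
    then have "2 * norm x \<le> 1 + (norm x)\<^sup>2" by (simp add: power2_diff)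
    moreover have "norm x \<le> 2 * norm x" by simp
    ultimately show ?thesis unfolding mult_1_left by (rule order_trans[rotated])
  qed
  have "(\<lambda>y. 1 * exp (- (1/2) * y)) \<in> exp_family"
    unfolding exp_family_def by (rule CollectI, rule exI[of _ 1], rule exI[of _ "1/2"]) simp
  note * = schwartz_exp_decay[where b = "\<lambda>x. (norm x)\<^sup>2", OF exp_family_decay cpoly_norm2 zero_le_power2 A zero_less_one this assms]
  have eq: "gauss x = 1 * exp (- (1/2) * (norm x)\<^sup>2)" for x :: "real^'a"
    by (simp add: gauss_def)
  show ?thesis unfolding eq by (rule *)
qed

section \<open>Convolutions and weak derivatives\<close>

lemma partial_deriv_shift:
  assumes "\<And>x. g differentiable at x"
  shows "(\<lambda>x. g (x - y)) differentiable at x"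
    and "partial_deriv j (\<lambda>x. g (x - y)) = (\<lambda>x. partial_deriv j g (x - y))"
proof -
  have "((\<lambda>x. g (x - y)) has_derivative frechet_derivative g (at (x - y))) (at x)" for x
  proof -
    have "((\<lambda>x. x - y) has_derivative (\<lambda>h. h)) (at x)" by (auto intro!: derivative_eq_intros)
    from diff_chain_at[OF this assms[of "x - y", unfolded frechet_derivative_works]] show ?thesis by (simp add: o_def)
  qed
  then show "(\<lambda>x. g (x - y)) differentiable at x"
    and "partial_deriv j (\<lambda>x. g (x - y)) = (\<lambda>x. partial_deriv j g (x - y))"
    by (auto simp: differentiable_def fun_eq_iff partial_deriv_eq partial_deriv_def[of j g])
qed

text \<open>The operator \<partial>_j as seen on the frequency side.\<close>

abbreviation freq_mult :: "'n::finite \<Rightarrow> (real^'n \<Rightarrow> complex) \<Rightarrow> real^'n \<Rightarrow> complex" where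
  "freq_mult j h \<equiv> (\<lambda>\<xi>. \<i> * (complex_of_real (\<xi> $ j) * h \<xi>))"

lemma schwartz_freq_mult: "schwartz h \<Longrightarrow> schwartz (freq_mult j h)"
  by (intro schwartz_cmult schwartzD(4))

lemma weak_deriv_ift:
  assumes \<phi>: "test_function \<phi>" and h: "schwartz h"
  shows "(LINT x|lborel. partial_deriv j \<phi> x * ift h (x - y)) = - (LINT x|lborel. \<phi> x * ift (freq_mult j h) (x - y))"
proof -
  note d = partial_deriv_shift[where g = "ift h", OF ift_differentiable[OF h]]
  have "continuous_on UNIV (\<lambda>x. ift (freq_mult j h) (x - y))"
    by (intro continuous_on_compose2[OF ift_continuous[OF schwartz_freq_mult[OF h]]] continuous_intros) auto
  then show ?thesis
    using integral_by_parts_test_function[OF \<phi> d(1), of j y] by (simp add: d(2) partial_deriv_ift[OF h])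
qed

lemma test_function_integrable: "test_function \<phi> \<Longrightarrow> integrable lborel \<phi>"
  by (rule test_function_bounded, assumption, rule integrable_compact_support[OF test_functionD(3)])

definition conv :: "(real^'n::finite \<Rightarrow> complex) \<Rightarrow> (real^'n \<Rightarrow> complex) \<Rightarrow> real^'n \<Rightarrow> complex" where
  "conv k g x = (LINT y|lborel. k (x - y) * g y)"

lemma conv_integrable:
  assumes k: "integrable lborel k" "\<And>x. norm (k x) \<le> B" and g: "integrable lborel g"
  shows "integrable lborel (conv k g)" "norm (conv k g x) \<le> B * (LINT y|lborel. norm (g y))"
    "integrable lborel (\<lambda>y. k (x - y) * g y)"
proof -
  from lborel_pair.integrable_fst'[OF integrable_pair_shift(2)[OF g k(1), of 1]]
  show "integrable lborel (conv k g)" by (simp add: conv_def[abs_def])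
  have [measurable]: "k \<in> borel_measurable borel" "g \<in> borel_measurable borel" using k g by auto
  have b: "norm (k (x - y) * g y) \<le> B * norm (g y)" for y
    using k(2)[of "x - y"] by (simp add: norm_mult mult_right_mono)
  have i: "integrable lborel (\<lambda>y. B * norm (g y))" using g by simp
  show ii: "integrable lborel (\<lambda>y. k (x - y) * g y)"
    by (rule Bochner_Integration.integrable_bound[OF i]) (use b in \<open>auto intro: order_trans[OF _ abs_ge_self]\<close>)
  show "norm (conv k g x) \<le> B * (LINT y|lborel. norm (g y))"
    unfolding conv_def using Bochner_Integration.integral_norm_bound_integral[OF ii i b] by simp
qed

text \<open>Fubini moves the pairing onto translates of the kernel. A derivative then falls on the
  kernel alone, and \<open>g\<close> needs no regularity.\<close>

lemma conv_pairing:
  assumes k: "k \<in> borel_measurable borel" "\<And>x. norm (k x) \<le> B" and g: "integrable lborel g" and \<psi>: "integrable lborel \<psi>"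
  shows "(LINT x|lborel. \<psi> x * conv k g x) = (LINT y|lborel. g y * (LINT x|lborel. \<psi> x * k (x - y)))"
proof -
  note [measurable] = k(1) borel_measurable_integrable[OF g] borel_measurable_integrable[OF \<psi>]
  have "integrable (lborel \<Otimes>\<^sub>M lborel) (\<lambda>(x, y). \<psi> x * (k (x - y) * g y))"
  proof (rule Bochner_Integration.integrable_bound[OF integrable_mult_right[OF integrable_norm[OF integrable_pair_mult[OF \<psi> g]], of B]])
    show "AE z in lborel \<Otimes>\<^sub>M lborel. norm (case z of (x, y) \<Rightarrow> \<psi> x * (k (x - y) * g y))
        \<le> norm (B * norm (case z of (x, y) \<Rightarrow> \<psi> x * g y))"
    proof (intro AE_I2, clarify)
      fix x y
      have "norm (\<psi> x * (k (x - y) * g y)) \<le> B * (norm (\<psi> x) * norm (g y))"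
        using mult_right_mono[OF k(2)[of "x - y"], of "norm (\<psi> x) * norm (g y)"] by (simp add: norm_mult mult_ac)
      then show "norm (\<psi> x * (k (x - y) * g y)) \<le> norm (B * norm (\<psi> x * g y))"
        by (simp add: norm_mult)
    qed
  qed measurable
  from lborel_pair.Fubini_integral[OF this]
  have "(LINT y|lborel. LINT x|lborel. \<psi> x * (k (x - y) * g y)) = (LINT x|lborel. LINT y|lborel. \<psi> x * (k (x - y) * g y))" .
  moreover have "(LINT x|lborel. \<psi> x * (k (x - y) * g y)) = g y * (LINT x|lborel. \<psi> x * k (x - y))" for y
    by (subst Bochner_Integration.integral_mult_right_zero[symmetric]) (simp add: mult_ac)
  ultimately show ?thesis by (simp add: conv_def)
qed

lemma weak_deriv_conv:
  assumes \<phi>: "test_function \<phi>" and h: "schwartz h" and g: "integrable lborel g"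
  shows "(LINT x|lborel. partial_deriv j \<phi> x * conv (ift h) g x) = - (LINT x|lborel. \<phi> x * conv (ift (freq_mult j h)) g x)"
  by (subst (1 2) conv_pairing[OF ift_measurable ift_norm_le g])
     (auto intro!: h schwartz_freq_mult test_function_integrable test_function_partial_deriv \<phi> simp: weak_deriv_ift[OF \<phi> h])

text \<open>For t > 0 this is the convolution with t^(-n) k(x/t), after the substitution that leaves
  \<open>t\<close> only in the argument of \<open>g\<close>; L^1 bounds are then visibly uniform in
  \<open>t\<close>.\<close>

definition dilate_conv :: "(real^'n::finite \<Rightarrow> complex) \<Rightarrow> real \<Rightarrow> (real^'n \<Rightarrow> complex) \<Rightarrow> real^'n \<Rightarrow> complex" where
  "dilate_conv k t g x = (LINT z|lborel. k z * g (x - t *\<^sub>R z))"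

lemma dilate_conv_integrable:
  assumes k: "integrable lborel k" and g: "integrable lborel g"
  shows "integrable lborel (dilate_conv k t g)"
    and "(LINT x|lborel. norm (dilate_conv k t g x)) \<le> (LINT z|lborel. norm (k z)) * (LINT x|lborel. norm (g x))"
proof -
  let ?F = "\<lambda>x z. g (x - t *\<^sub>R z) * k z"
  note int = integrable_pair_shift[OF k g, of t]
  have eq: "dilate_conv k t g x = (LINT z|lborel. ?F x z)" for x
    by (simp add: dilate_conv_def mult.commute)
  from lborel_pair.integrable_fst'[OF int(2)] show i: "integrable lborel (dilate_conv k t g)"
    by (simp add: eq[abs_def])
  have n: "integrable (lborel \<Otimes>\<^sub>M lborel) (\<lambda>(x, z). norm (?F x z))"
    using integrable_norm[OF int(2)] by (simp add: case_prod_unfold)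
  have n': "integrable (lborel \<Otimes>\<^sub>M lborel) (\<lambda>(z, x). norm (?F x z))"
    using integrable_norm[OF int(1)] by (simp add: case_prod_unfold)
  have "(LINT x|lborel. norm (dilate_conv k t g x)) \<le> (LINT x|lborel. LINT z|lborel. norm (?F x z))"
    using lborel_pair.integrable_fst'[OF n]
    by (intro integral_mono integrable_norm i) (auto simp: eq simp del: norm_mult intro!: integral_norm_bound)
  also have "\<dots> = (LINT z|lborel. LINT x|lborel. norm (?F x z))"
    using lborel_pair.Fubini_integral[OF n'] .
  also have "\<dots> = (LINT z|lborel. norm (k z) * (LINT x|lborel. norm (g x)))"
    using lborel_shift_integral(4)[OF integrable_norm[OF g]] by (simp add: norm_mult mult.commute)
  also have "\<dots> = (LINT z|lborel. norm (k z)) * (LINT x|lborel. norm (g x))" by simp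
  finally show "(LINT x|lborel. norm (dilate_conv k t g x)) \<le> (LINT z|lborel. norm (k z)) * (LINT x|lborel. norm (g x))" .
qed

lemma dilate_conv_small:
  fixes g :: "real^'n::finite \<Rightarrow> complex"
  assumes k: "k \<in> borel_measurable borel" "\<And>x. norm (k x) \<le> B" and g: "integrable lborel g" and t: "t > 0"
  shows "norm (dilate_conv k t g x) \<le> B * (LINT x|lborel. norm (g x)) / t ^ CARD('n)"
proof -
  note [measurable] = k(1) borel_measurable_integrable[OF g]
  have i: "integrable lborel (\<lambda>z. g (x - t *\<^sub>R z))"
    using lborel_affine_integral(1)[OF g, of "- t" x] t by simp
  have "norm (k z * g (x - t *\<^sub>R z)) \<le> B * norm (g (x - t *\<^sub>R z))" for z
    using k(2)[of z] by (simp add: norm_mult mult_right_mono)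
  moreover have "integrable lborel (\<lambda>z. B * norm (g (x - t *\<^sub>R z)))" using i by simp
  moreover have "integrable lborel (\<lambda>z. k z * g (x - t *\<^sub>R z))"
    by (rule Bochner_Integration.integrable_bound[OF calculation(2)])
       (use calculation(1) in \<open>auto intro: order_trans[OF _ abs_ge_self]\<close>)
  ultimately have "norm (dilate_conv k t g x) \<le> (LINT z|lborel. B * norm (g (x - t *\<^sub>R z)))"
    unfolding dilate_conv_def by (intro Bochner_Integration.integral_norm_bound_integral)
  also have "\<dots> = B * ((LINT x|lborel. norm (g x)) / t ^ CARD('n))"
    using lborel_affine_integral(2)[OF integrable_norm[OF g], of "- t" x] t by (simp add: field_simps)
  finally show ?thesis by simp
qed

text \<open>The approximate identity argument in the uniform norm: beyond some radius the kernel has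
  little mass, and within it a small \<open>t\<close> keeps the shift below the modulus of
  continuity of \<open>g\<close>.\<close>

lemma dilate_conv_tendsto:
  fixes g :: "real^'n::finite \<Rightarrow> complex"
  assumes k: "integrable lborel k" and g: "continuous_on UNIV g" "\<And>x. norm x > R \<Longrightarrow> g x = 0" and e: "e > 0"
  shows "\<exists>t>0. \<forall>x. norm (dilate_conv k t g x - (LINT z|lborel. k z) * g x) \<le> e"
proof -
  note [measurable] = borel_measurable_integrable[OF k] borel_measurable_continuous_onI[OF g(1)]
  obtain B where B: "B > 0" "\<And>x. norm (g x) \<le> B"
  proof -
    have "bounded (g ` cball 0 R)"
      by (intro compact_imp_bounded compact_continuous_image continuous_on_subset[OF g(1)]) auto
    then obtain B where B: "B > 0" "\<And>x. norm x \<le> R \<Longrightarrow> norm (g x) \<le> B"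
      by (auto simp: bounded_pos)
    then have "norm (g x) \<le> B" for x using g(2)[of x] by (cases "norm x \<le> R") auto
    then show ?thesis using that B(1) by blast
  qed
  \<comment> \<open>Compactness gives this on the ball of radius \<open>R + 1\<close>. If one of two
    points at distance below 1 is outside that ball, both are outside the ball of radius
    \<open>R\<close>, where \<open>g\<close> vanishes.\<close>
  have uc: "uniformly_continuous_on UNIV g"
    unfolding uniformly_continuous_on_def
  proof (intro allI impI)
    fix d :: real assume d: "d > 0"
    have "uniformly_continuous_on (cball 0 (R + 1)) g"
      by (intro compact_uniformly_continuous continuous_on_subset[OF g(1)]) auto
    then obtain s where s: "s > 0" "\<And>x x'. x \<in> cball 0 (R + 1) \<Longrightarrow> x' \<in> cball 0 (R + 1) \<Longrightarrow> dist x' x < s \<Longrightarrow> dist (g x') (g x) < d"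
      using d unfolding uniformly_continuous_on_def by metis
    show "\<exists>s>0. \<forall>x\<in>UNIV. \<forall>x'\<in>UNIV. dist x' x < s \<longrightarrow> dist (g x') (g x) < d"
    proof (intro exI[of _ "min s 1"] conjI ballI impI)
      fix x x' :: "real^'n" assume dd: "dist x' x < min s 1"
      then have n: "norm x \<le> norm x' + 1" "norm x' \<le> norm x + 1"
        using norm_triangle_ineq2[of x x'] norm_triangle_ineq2[of x' x] by (auto simp: dist_norm norm_minus_commute)
      show "dist (g x') (g x) < d"
      proof (cases "norm x \<le> R + 1 \<and> norm x' \<le> R + 1")
        case True then show ?thesis using s(2)[of x x'] dd by simp
      next
        case False
        then have "norm x > R" "norm x' > R" using n by auto
        then show ?thesis using d by (simp add: g(2))
      qed
    qed (use s in auto)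
  qed
  define K where "K = (LINT z|lborel. norm (k z))"
  have K: "K \<ge> 0" by (simp add: K_def)
  let ?tail = "\<lambda>m z. norm (k z) * indicator {z. norm z > real m} z"
  have "(\<lambda>m. LINT z|lborel. ?tail m z) \<longlonglongrightarrow> integral\<^sup>L lborel (\<lambda>z::real^'n. 0)"
  proof (rule integral_dominated_convergence[where w = "\<lambda>z. norm (k z)"])
    show "AE z in lborel. (\<lambda>m. ?tail m z) \<longlonglongrightarrow> 0"
    proof (intro AE_I2 tendsto_eventually)
      fix z :: "real^'n"
      obtain n :: nat where "norm z \<le> real n" using real_arch_simple by blast
      then show "\<forall>\<^sub>F m in sequentially. ?tail m z = 0"
        by (auto simp: eventually_sequentially indicator_def intro!: exI[of _ n])
    qed
    show "AE z in lborel. norm (?tail m z) \<le> norm (k z)" for m by (auto simp: indicator_def)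
  qed (use k in auto)
  then have "\<forall>\<^sub>F m in sequentially. (LINT z|lborel. ?tail m z) < e / (4 * B)"
    using e B by (intro order_tendstoD) auto
  then obtain m where m: "(LINT z|lborel. ?tail m z) < e / (4 * B)" by (auto simp: eventually_sequentially)
  \<comment> \<open>The central part contributes at most d K, hence at most e/2, and the tail at
    most 2 B times e / (4 B), again e/2. The 1 in \<open>K + 1\<close> avoids a division by
    zero.\<close>
  define d where "d = e / (2 * (K + 1))"
  have d: "d > 0" "d * K \<le> e / 2" using e K by (auto simp: d_def field_simps)
  obtain s where s: "s > 0" "\<And>x x'. dist x' x < s \<Longrightarrow> dist (g x') (g x) < d"
    using uc d(1) unfolding uniformly_continuous_on_def by (metis UNIV_I)
  \<comment> \<open>Shifts \<open>t *\<^sub>R z\<close> with \<open>norm z \<le> real m\<close> are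
    then shorter than \<open>s\<close>.\<close>
  define t where "t = s / (real m + 1)"
  have t: "t > 0" using s by (simp add: t_def)
  have bound: "norm (k z * (g (x - t *\<^sub>R z) - g x)) \<le> d * norm (k z) + 2 * B * ?tail m z" for x z
  proof (cases "norm z > real m")
    case True
    have "norm (g (x - t *\<^sub>R z) - g x) \<le> 2 * B"
      using norm_triangle_ineq4[of "g (x - t *\<^sub>R z)" "g x"] B(2)[of "x - t *\<^sub>R z"] B(2)[of x] by linarith
    then have "norm (k z * (g (x - t *\<^sub>R z) - g x)) \<le> norm (k z) * (2 * B)"
      by (simp only: norm_mult mult_left_mono norm_ge_zero)
    moreover have "0 \<le> d * norm (k z)" using d by simp
    ultimately show ?thesis using True by (simp add: mult.commute)
  next
    case False
    have "norm (t *\<^sub>R z) < s"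
    proof -
      have "norm (t *\<^sub>R z) \<le> t * real m" using False t by (simp add: mult_left_mono)
      also have "\<dots> < s" using s by (simp add: t_def field_simps)
      finally show ?thesis .
    qed
    then have "norm (g (x - t *\<^sub>R z) - g x) \<le> d"
      using s(2)[of "x - t *\<^sub>R z" x] by (simp add: dist_norm less_imp_le)
    then have "norm (k z * (g (x - t *\<^sub>R z) - g x)) \<le> norm (k z) * d"
      by (simp only: norm_mult mult_left_mono norm_ge_zero)
    with False show ?thesis by (simp add: mult.commute)
  qed
  have ti: "integrable lborel (?tail m)"
    by (rule Bochner_Integration.integrable_bound[OF integrable_norm[OF k]]) (auto simp: indicator_def)
  have i: "integrable lborel (\<lambda>z. d * norm (k z) + 2 * B * ?tail m z)" using k ti by simp
  have i1: "integrable lborel (\<lambda>z. k z * g (x - t *\<^sub>R z))" for x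
    by (rule Bochner_Integration.integrable_bound[OF integrable_mult_right[OF integrable_norm[OF k], of B]])
       (use B in \<open>auto intro!: AE_I2 simp: norm_mult mult.commute[of "norm (k _)"] mult_right_mono\<close>)
  show ?thesis
  proof (intro exI[of _ t] conjI allI t)
    fix x
    have i2: "integrable lborel (\<lambda>z. k z * (g (x - t *\<^sub>R z) - g x))"
      unfolding right_diff_distrib using i1 k by simp
    have "dilate_conv k t g x - (LINT z|lborel. k z) * g x = (LINT z|lborel. k z * (g (x - t *\<^sub>R z) - g x))"
      unfolding right_diff_distrib dilate_conv_def using i1 k by simp
    also have "norm \<dots> \<le> (LINT z|lborel. d * norm (k z) + 2 * B * ?tail m z)"
      by (rule Bochner_Integration.integral_norm_bound_integral[OF i2 i bound])
    also have "\<dots> = d * K + 2 * B * (LINT z|lborel. ?tail m z)" using k ti by (simp add: K_def)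
    also have "\<dots> \<le> e / 2 + 2 * B * (e / (4 * B))"
      using d(2) B m by (intro add_mono mult_left_mono) auto
    also have "\<dots> = e" using B by simp
    finally show "norm (dilate_conv k t g x - (LINT z|lborel. k z) * g x) \<le> e" .
  qed
qed

section \<open>The operator in components\<close>

lemma norm_smult_vec: "norm (c *s x) = norm c * norm x" for x :: "complex^'N::finite"
  by (simp add: norm_vec_def norm_mult L2_set_right_distrib)

lemma norm_vec_le_sum: "norm x \<le> (\<Sum>k\<in>UNIV. norm (x $ k))" for x :: "complex^'N::finite"
  unfolding norm_vec_def by (rule L2_set_le_sum) simp

lemma vec_measurableI:
  fixes f :: "'a \<Rightarrow> complex^'N::finite"
  assumes "\<And>k. (\<lambda>x. f x $ k) \<in> borel_measurable M"
  shows "f \<in> borel_measurable M"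
proof (subst borel_measurable_euclidean_space, rule ballI)
  fix b :: "complex^'N" assume "b \<in> Basis"
  then obtain k c where b: "b = axis k c" by (auto simp: Basis_vec_def)
  show "(\<lambda>x. f x \<bullet> b) \<in> borel_measurable M"
    unfolding b inner_axis using assms[of k] by measurable
qed

lemma nth_measurable: "f \<in> borel_measurable M \<Longrightarrow> (\<lambda>x. (f x :: complex^'N::finite) $ k) \<in> borel_measurable M"
  by (rule measurable_compose[of f M borel _ borel])
     (auto intro!: borel_measurable_continuous_onI continuous_intros)

lemma integrable_vecI:
  fixes f :: "'a \<Rightarrow> complex^'N::finite"
  assumes "\<And>k. integrable M (\<lambda>x. f x $ k)"
  shows "integrable M f"
proof -
  have i: "integrable M (\<lambda>x. \<Sum>k\<in>UNIV. norm (f x $ k))" using assms by simp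
  show ?thesis
    by (rule Bochner_Integration.integrable_bound[OF i vec_measurableI])
       (use assms in \<open>auto intro!: AE_I2 order_trans[OF norm_vec_le_sum]\<close>)
qed

lemma integral_nth: "integrable M f \<Longrightarrow> (LINT x|M. f x) $ k = (LINT x|M. (f x :: complex^'N::finite) $ k)"
  by (rule integral_bounded_linear[OF bounded_linear_vec_nth, symmetric])

lemma Lp_nth:
  assumes "f \<in> Lp p" "p > 0"
  shows "(\<lambda>x. f x $ k) \<in> borel_measurable borel" "integrable lborel (\<lambda>x. norm (f x $ k) powr p)"
proof -
  show m: "(\<lambda>x. f x $ k) \<in> borel_measurable borel" using LpD(1)[OF assms(1)] by (rule nth_measurable)
  show "integrable lborel (\<lambda>x. norm (f x $ k) powr p)"
    by (rule Bochner_Integration.integrable_bound[OF LpD(2)[OF assms(1)]])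
       (use m assms(2) Finite_Cartesian_Product.norm_nth_le in \<open>auto intro!: AE_I2 powr_mono2\<close>)
qed

lemma Lp_vecI:
  fixes f :: "real^'n::finite \<Rightarrow> complex^'N::finite"
  assumes i: "\<And>k. integrable lborel (\<lambda>x. f x $ k)" and b: "\<And>k x. norm (f x $ k) \<le> B" and p: "p \<ge> 1"
  shows "f \<in> Lp p"
proof -
  have f: "integrable lborel f" using i by (rule integrable_vecI)
  have "norm (f x) \<le> CARD('N) * B" for x
    using norm_vec_le_sum[of "f x"] sum_mono[of UNIV "\<lambda>k. norm (f x $ k)" "\<lambda>_. B"] b by fastforce
  from integrable_powr_bounded(1)[OF f this p] show ?thesis using f by (simp add: Lp_def)
qed

lemma le_1_plus_powr: "a \<le> 1 + a powr p" if "a \<ge> 0" "p \<ge> 1" for a p :: real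
proof (cases "a \<le> 1")
  case False
  then have "a powr 1 \<le> a powr p" using that by (intro powr_mono) auto
  then show ?thesis using False by simp
qed (use powr_ge_zero[of a p] in linarith)

text \<open>From |f| \<le> 1 + |f|^p, with the 1 integrated over the bounded set only.\<close>

lemma locally_integrable:
  fixes f :: "real^'n::finite \<Rightarrow> 'b::{banach, second_countable_topology}"
  assumes [measurable]: "f \<in> borel_measurable borel" and i: "integrable lborel (\<lambda>x. norm (f x) powr p)" and p: "p \<ge> 1"
    and A: "bounded A" "A \<in> sets borel"
  shows "integrable lborel (\<lambda>x. indicator A x *\<^sub>R f x)"
proof (rule Bochner_Integration.integrable_bound)
  show "integrable lborel (\<lambda>x. indicator A x + norm (f x) powr p)"
    using i A emeasure_bounded_finite[OF A(1)] by simp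
  show "AE x in lborel. norm (indicator A x *\<^sub>R f x) \<le> norm (indicator A x + norm (f x) powr p)"
    using le_1_plus_powr[OF norm_ge_zero p] by (intro AE_I2) (auto simp: indicator_def)
qed (use A in measurable)

lemma integrable_mult_test_function:
  fixes f :: "real^'n::finite \<Rightarrow> complex"
  assumes f: "f \<in> borel_measurable borel" "\<And>A. bounded A \<Longrightarrow> A \<in> sets borel \<Longrightarrow> integrable lborel (\<lambda>x. indicator A x *\<^sub>R f x)"
    and \<phi>: "test_function \<phi>"
  shows "integrable lborel (\<lambda>x. \<phi> x * f x)"
proof -
  obtain B R where B: "B \<ge> 0" "\<And>x. norm (\<phi> x) \<le> B" "\<And>x. norm x > R \<Longrightarrow> \<phi> x = 0"
    by (rule test_function_bounded[OF \<phi>]) (rule that)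
  have [measurable]: "\<phi> \<in> borel_measurable borel"
    by (rule borel_measurable_continuous_onI[OF test_functionD(3)[OF \<phi>]])
  note [measurable] = f(1)
  show ?thesis
  proof (rule Bochner_Integration.integrable_bound)
    show "integrable lborel (\<lambda>x. B * norm (indicator (cball 0 R) x *\<^sub>R f x))"
      by (intro integrable_mult_right integrable_norm f(2)) auto
    show "AE x in lborel. norm (\<phi> x * f x) \<le> norm (B * norm (indicator (cball 0 R) x *\<^sub>R f x))"
    proof (rule AE_I2)
      fix x
      show "norm (\<phi> x * f x) \<le> norm (B * norm (indicator (cball 0 R) x *\<^sub>R f x))"
      proof (cases "norm x \<le> R")
        case True
        then show ?thesis using B(1) mult_right_mono[OF B(2)[of x] norm_ge_zero[of "f x"]] by (simp add: norm_mult)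
      next
        case False
        then show ?thesis using B(3)[of x] by simp
      qed
    qed
  qed measurable
qed

lemma Lp_test_integrable:
  assumes "f \<in> Lp p" "p \<ge> 1" "test_function \<phi>"
  shows "integrable lborel (\<lambda>x. \<phi> x * f x $ k)" "integrable lborel (\<lambda>x. \<phi> x *s f x)"
proof -
  have p: "p > 0" using assms(2) by simp
  show *: "integrable lborel (\<lambda>x. \<phi> x * f x $ k)" for k
    by (rule integrable_mult_test_function[OF Lp_nth(1)[OF assms(1) p] locally_integrable[OF Lp_nth[OF assms(1) p] assms(2)] assms(3)])
  show "integrable lborel (\<lambda>x. \<phi> x *s f x)" by (rule integrable_vecI) (simp add: *)
qed

text \<open>Components may be taken under the integral sign only for integrable vector functions;
  the memberships in L^p provide that for products with test functions.\<close>

lemma weak_D_components: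
  assumes u: "u \<in> Lp p" and f: "f \<in> Lp p" and p: "p \<ge> 1"
  shows "weak_D Dh u f \<longleftrightarrow> (\<forall>\<phi> l. test_function \<phi> \<longrightarrow> (LINT x|lborel. \<phi> x * f x $ l)
    = \<i> * (\<Sum>j\<in>UNIV. \<Sum>m\<in>UNIV. Dh j $ l $ m * (LINT x|lborel. partial_deriv j \<phi> x * u x $ m)))"
  unfolding weak_D_def vec_eq_iff
  using Lp_test_integrable[OF f p] Lp_test_integrable[OF u p test_function_partial_deriv]
  by (auto simp: integral_nth sum_component matrix_vector_mult_def)

lemma D_graph_components:
  assumes "(u, f) \<in> D_graph Dh p" "p \<ge> 1" "test_function \<phi>"
  shows "(LINT x|lborel. \<phi> x * f x $ l)
    = \<i> * (\<Sum>j\<in>UNIV. \<Sum>m\<in>UNIV. Dh j $ l $ m * (LINT x|lborel. partial_deriv j \<phi> x * u x $ m))"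
  using assms weak_D_components[of u p f Dh] by (auto simp: D_graph_def)

lemma symbol_nth: "symbol Dh \<xi> $ l $ m = (\<Sum>j\<in>UNIV. complex_of_real (\<xi> $ j) * Dh j $ l $ m)"
  unfolding symbol_def sum_component vector_scaleR_component by (simp add: scaleR_conv_of_real)

lemma cpoly_symbol: "cpoly (\<lambda>\<xi>. symbol Dh \<xi> $ l $ m)"
  unfolding symbol_nth by (intro cpoly_sum cpoly.mult cpoly.coord cpoly.const)

lemma schwartz_sum: "finite I \<Longrightarrow> I \<noteq> {} \<Longrightarrow> (\<And>i. i \<in> I \<Longrightarrow> schwartz (h i)) \<Longrightarrow> schwartz (\<lambda>\<xi>. \<Sum>i\<in>I. h i \<xi>)"
  by (induction I rule: finite_ne_induct) (auto intro: schwartz_add)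

text \<open>\<open>T\<close> stands for a translated Fourier integral or for a convolution with one.\<close>

lemma D_graph_fourier:
  fixes T :: "(real^'n::finite \<Rightarrow> complex) \<Rightarrow> real^'n \<Rightarrow> complex" and h :: "'N::finite \<Rightarrow> real^'n \<Rightarrow> complex"
  assumes weak: "\<And>\<phi> j h. test_function \<phi> \<Longrightarrow> schwartz h \<Longrightarrow>
      (LINT x|lborel. partial_deriv j \<phi> x * T h x) = - (LINT x|lborel. \<phi> x * T (freq_mult j h) x)"
    and add: "\<And>h h' x. schwartz h \<Longrightarrow> schwartz h' \<Longrightarrow> T (\<lambda>\<xi>. h \<xi> + h' \<xi>) x = T h x + T h' x"
    and cmult: "\<And>c h x. schwartz h \<Longrightarrow> T (\<lambda>\<xi>. c * h \<xi>) x = c * T h x"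
    and int: "\<And>h. schwartz h \<Longrightarrow> integrable lborel (T h)"
    and bdd: "\<And>h. schwartz h \<Longrightarrow> \<exists>B. \<forall>x. norm (T h x) \<le> B"
    and h: "\<And>l. schwartz (h l)" and p: "p \<ge> 1"
  shows "(\<lambda>x. \<chi> l. T (h l) x, \<lambda>x. \<chi> l. T (\<lambda>\<xi>. \<Sum>m\<in>UNIV. symbol Dh \<xi> $ l $ m * h m \<xi>) x) \<in> D_graph Dh p"
proof -
  let ?h' = "\<lambda>l \<xi>. \<Sum>m\<in>UNIV. symbol Dh \<xi> $ l $ m * h m \<xi>"
  have sum: "T (\<lambda>\<xi>. \<Sum>i\<in>I. k i \<xi>) x = (\<Sum>i\<in>I. T (k i) x)"
    if "finite I" "I \<noteq> {}" "\<And>i. i \<in> I \<Longrightarrow> schwartz (k i)" for I :: "'i set" and k x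
    using that by (induction I rule: finite_ne_induct) (auto simp: add schwartz_sum)
  have sh': "schwartz (?h' l)" for l
    by (intro schwartz_sum schwartz_cpoly_mult cpoly_symbol h) auto
  have Lp: "(\<lambda>x. \<chi> l. T (k l) x) \<in> Lp p" if k: "\<And>l. schwartz (k l)" for k :: "'N \<Rightarrow> real^'n \<Rightarrow> complex"
  proof -
    obtain B where B: "\<And>l x. norm (T (k l) x) \<le> B l" using bdd[OF k] by metis
    have "norm (T (k l) x) \<le> (\<Sum>l\<in>UNIV. \<bar>B l\<bar>)" for l x
      using B[of l x] member_le_sum[of l UNIV "\<lambda>l. \<bar>B l\<bar>"] by fastforce
    then show ?thesis using int[OF k] p by (intro Lp_vecI) auto
  qed
  \<comment> \<open>The identity D = -i \<Sum> D_j \<partial>_j on the frequency side: the factor -i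
    cancels the factor i in \<open>freq_mult\<close>.\<close>
  have T': "T (?h' l) x = (\<Sum>j\<in>UNIV. \<Sum>m\<in>UNIV. (- \<i> * Dh j $ l $ m) * T (freq_mult j (h m)) x)" for l x
  proof -
    let ?k = "\<lambda>j m \<xi>. (- \<i> * Dh j $ l $ m) * freq_mult j (h m) \<xi>"
    have k: "schwartz (?k j m)" for j m by (rule schwartz_cmult[OF schwartz_freq_mult[OF h]])
    have eq: "?h' l = (\<lambda>\<xi>. \<Sum>j\<in>UNIV. \<Sum>m\<in>UNIV. ?k j m \<xi>)"
      unfolding symbol_nth sum_distrib_right by (subst sum.swap) (simp add: mult_ac)
    have "T (?h' l) x = (\<Sum>j\<in>UNIV. T (\<lambda>\<xi>. \<Sum>m\<in>UNIV. ?k j m \<xi>) x)"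
      unfolding eq by (rule sum[OF finite UNIV_not_empty schwartz_sum[OF finite UNIV_not_empty k]])
    also have "\<dots> = (\<Sum>j\<in>UNIV. \<Sum>m\<in>UNIV. T (?k j m) x)"
      by (intro sum.cong refl sum[OF finite UNIV_not_empty k])
    also have "\<dots> = (\<Sum>j\<in>UNIV. \<Sum>m\<in>UNIV. (- \<i> * Dh j $ l $ m) * T (freq_mult j (h m)) x)"
      by (intro sum.cong refl cmult schwartz_freq_mult h)
    finally show ?thesis .
  qed
  have "weak_D Dh (\<lambda>x. \<chi> l. T (h l) x) (\<lambda>x. \<chi> l. T (?h' l) x)"
    unfolding weak_D_components[OF Lp[OF h] Lp[OF sh'] p] vec_lambda_beta
  proof (intro allI impI)
    fix \<phi> :: "real^'n \<Rightarrow> complex" and l assume \<phi>: "test_function \<phi>"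
    have i: "integrable lborel (\<lambda>x. \<phi> x * T (freq_mult j (h m)) x)" for j m
      using Lp_test_integrable(1)[OF Lp[of "\<lambda>_. freq_mult j (h m)"] p \<phi>] by (simp add: schwartz_freq_mult h)
    have "(LINT x|lborel. \<phi> x * T (?h' l) x)
        = (LINT x|lborel. (\<Sum>j\<in>UNIV. \<Sum>m\<in>UNIV. (- \<i> * Dh j $ l $ m) * (\<phi> x * T (freq_mult j (h m)) x)))"
      unfolding T' by (simp add: sum_distrib_left mult_ac)
    also have "\<dots> = (\<Sum>j\<in>UNIV. \<Sum>m\<in>UNIV. (- \<i> * Dh j $ l $ m) * (LINT x|lborel. \<phi> x * T (freq_mult j (h m)) x))"
      using i by simp
    also have "\<dots> = \<i> * (\<Sum>j\<in>UNIV. \<Sum>m\<in>UNIV. Dh j $ l $ m * (LINT x|lborel. partial_deriv j \<phi> x * T (h m) x))"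
      unfolding weak[OF \<phi> h] by (simp add: sum_distrib_left mult_ac)
    finally show "(LINT x|lborel. \<phi> x * T (?h' l) x)
      = \<i> * (\<Sum>j\<in>UNIV. \<Sum>m\<in>UNIV. Dh j $ l $ m * (LINT x|lborel. partial_deriv j \<phi> x * T (h m) x))" .
  qed
  then show ?thesis using Lp[OF h] Lp[OF sh'] by (simp add: D_graph_def)
qed

lemma D_graph_ift:
  assumes "\<And>l. schwartz (h l)" "p \<ge> 1"
  shows "(\<lambda>x. \<chi> l. ift (h l) (x - y), \<lambda>x. \<chi> l. ift (\<lambda>\<xi>. \<Sum>m\<in>UNIV. symbol Dh \<xi> $ l $ m * h m \<xi>) (x - y)) \<in> D_graph Dh p"
  by (rule D_graph_fourier[where T = "\<lambda>h x. ift h (x - y)"])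
     (use assms ift_norm_le in \<open>auto simp: weak_deriv_ift ift_add[OF schwartzD(3) schwartzD(3)]
        ift_cmult intro: lborel_shift_integral(3)[OF ift_integrable]\<close>)

lemma conv_linear:
  assumes "schwartz h" "schwartz h'" "integrable lborel g"
  shows "conv (ift (\<lambda>\<xi>. h \<xi> + h' \<xi>)) g x = conv (ift h) g x + conv (ift h') g x"
    and "conv (ift (\<lambda>\<xi>. c * h \<xi>)) g x = c * conv (ift h) g x"
  using conv_integrable(3)[OF ift_integrable[OF assms(1)] ift_norm_le assms(3)]
    conv_integrable(3)[OF ift_integrable[OF assms(2)] ift_norm_le assms(3)]
  by (simp_all add: conv_def ift_add[OF schwartzD(3)[OF assms(1)] schwartzD(3)[OF assms(2)]] ift_cmult distrib_right mult.assoc)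

lemma D_graph_conv:
  assumes "\<And>l. schwartz (h l)" "integrable lborel g" "p \<ge> 1"
  shows "(\<lambda>x. \<chi> l. conv (ift (h l)) g x, \<lambda>x. \<chi> l. conv (ift (\<lambda>\<xi>. \<Sum>m\<in>UNIV. symbol Dh \<xi> $ l $ m * h m \<xi>)) g x) \<in> D_graph Dh p"
proof (rule D_graph_fourier[where T = "\<lambda>h. conv (ift h) g"])
  show "\<exists>B. \<forall>x. norm (conv (ift h) g x) \<le> B" if "schwartz h" for h
    using conv_integrable(2)[OF ift_integrable[OF that] ift_norm_le assms(2)] by blast
qed (use assms in \<open>auto simp: weak_deriv_conv intro: conv_linear conv_integrable(1)[OF ift_integrable ift_norm_le]\<close>)

section \<open>Enlarging the class of test functions\<close>

lemma Ck_scale: "Ck k f \<Longrightarrow> Ck k (\<lambda>x. f (c *\<^sub>R x))"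
  and partial_deriv_scale: "(\<And>x. f differentiable at x) \<Longrightarrow>
    partial_deriv j (\<lambda>x. f (c *\<^sub>R x)) = (\<lambda>x. complex_of_real c * partial_deriv j f (c *\<^sub>R x))"
proof -
  have d: "((\<lambda>x. f (c *\<^sub>R x)) has_derivative (\<lambda>h. frechet_derivative f (at (c *\<^sub>R x)) (c *\<^sub>R h))) (at x)"
    if "\<And>x. f differentiable at x" for f :: "real^'n::finite \<Rightarrow> complex" and x
  proof -
    have "((\<lambda>x. c *\<^sub>R x) has_derivative (\<lambda>h. c *\<^sub>R h)) (at x)" by (auto intro!: derivative_eq_intros)
    from diff_chain_at[OF this that[of "c *\<^sub>R x", unfolded frechet_derivative_works]] show ?thesis by (simp add: o_def)
  qed
  have pd: "partial_deriv j (\<lambda>x. f (c *\<^sub>R x)) = (\<lambda>x. complex_of_real c * partial_deriv j f (c *\<^sub>R x))"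
    if "\<And>x. f differentiable at x" for f :: "real^'n::finite \<Rightarrow> complex" and j
  proof
    fix x
    have "linear (frechet_derivative f (at (c *\<^sub>R x)))"
      using that[of "c *\<^sub>R x", unfolded frechet_derivative_works] by (rule has_derivative_linear)
    then show "partial_deriv j (\<lambda>x. f (c *\<^sub>R x)) x = complex_of_real c * partial_deriv j f (c *\<^sub>R x)"
      by (subst partial_deriv_eq[OF d[OF that]], subst linear_scale)
         (simp_all add: partial_deriv_def[of j f] scaleR_conv_of_real)
  qed
  show "(\<And>x. f differentiable at x) \<Longrightarrow>
    partial_deriv j (\<lambda>x. f (c *\<^sub>R x)) = (\<lambda>x. complex_of_real c * partial_deriv j f (c *\<^sub>R x))" by (rule pd)
  show "Ck k f \<Longrightarrow> Ck k (\<lambda>x. f (c *\<^sub>R x))"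
  proof (induction k arbitrary: f)
    case 0
    then have "continuous_on UNIV f" by simp
    from continuous_on_compose2[OF this, of UNIV "\<lambda>x. c *\<^sub>R x"] show ?case
      by (simp add: continuous_on_scaleR)
  next
    case (Suc k)
    then have *: "\<And>x. f differentiable at x" by simp
    show ?case using Suc d[OF *] by (auto simp: pd[OF *] differentiable_def intro: Ck_mult Ck_const)
  qed
qed

lemma cutoff_exists:
  obtains \<psi> :: "real^'n::finite \<Rightarrow> complex" where "test_function \<psi>" "\<psi> 0 = 1"
proof -
  let ?a = "(\<chi> i. - 1) :: real^'n" and ?b = "(\<chi> i. 1) :: real^'n"
  let ?\<psi> = "\<lambda>x::real^'n. complex_of_real (inverse (bump ?a ?b 0)) * complex_of_real (bump ?a ?b x)"
  have "bump ?a ?b (0 :: real^'n) > 0" unfolding bump_bounds(3) by (simp add: mem_box_cart)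
  then have "?\<psi> 0 = 1" by (simp flip: of_real_mult)
  moreover have "bump ?a ?b x = 0" if "x \<notin> box ?a ?b" for x
    using bump_bounds[of ?a ?b x] that by auto
  then have "test_function ?\<psi>"
    unfolding test_function_def
    by (intro conjI allI Ck_mult Ck_const Ck_bump compact_support_boxI[of ?a ?b]) auto
  ultimately show ?thesis using that by blast
qed

lemma compact_support_normI:
  fixes f :: "real^'n::finite \<Rightarrow> complex"
  assumes "\<And>x. norm x > R \<Longrightarrow> f x = 0"
  shows "compact (closure {x. f x \<noteq> 0})"
proof -
  have "{x. f x \<noteq> 0} \<subseteq> cball 0 R"
  proof
    fix x assume "x \<in> {x. f x \<noteq> 0}"
    with assms[of x] show "x \<in> cball 0 R" by (cases "norm x > R") simp_all
  qed
  then have "closure {x. f x \<noteq> 0} \<subseteq> cball 0 R" by (rule closure_minimal) simp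
  then show ?thesis by (metis compact_Int_closed compact_cball closed_closure inf.absorb_iff2)
qed

text \<open>Dominated convergence for a cut-off that is stretched to the whole space. It serves for
  the cut-off itself and for its partial derivatives.\<close>

lemma scaled_pairing_tendsto:
  fixes g F :: "real^'n::finite \<Rightarrow> complex"
  assumes g: "continuous_on UNIV g" "\<And>x. norm (g x) \<le> B" and F: "integrable lborel F" and s: "s \<longlonglongrightarrow> 0"
  shows "integrable lborel (\<lambda>x. g (s k *\<^sub>R x) * F x)"
    and "(\<lambda>k. LINT x|lborel. g (s k *\<^sub>R x) * F x) \<longlonglongrightarrow> (LINT x|lborel. g 0 * F x)"
proof -
  note [measurable] = borel_measurable_integrable[OF F] borel_measurable_continuous_onI[OF g(1)]
  have m: "(\<lambda>x. g (s k *\<^sub>R x) * F x) \<in> borel_measurable lborel" for k by measurable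
  have m0: "(\<lambda>x. g 0 * F x) \<in> borel_measurable lborel" by measurable
  have w: "integrable lborel (\<lambda>x. B * norm (F x))" using F by simp
  have lim: "AE x in lborel. (\<lambda>k. g (s k *\<^sub>R x) * F x) \<longlonglongrightarrow> g 0 * F x"
  proof (rule AE_I2)
    fix x :: "real^'n"
    have "(\<lambda>k. s k *\<^sub>R x) \<longlonglongrightarrow> 0 *\<^sub>R x" by (rule tendsto_scaleR[OF s tendsto_const])
    moreover have "isCont g 0" using g(1) by (simp add: continuous_on_eq_continuous_at)
    ultimately have "(\<lambda>k. g (s k *\<^sub>R x)) \<longlonglongrightarrow> g 0" by (intro isCont_tendsto_compose[of _ g]) simp_all
    then show "(\<lambda>k. g (s k *\<^sub>R x) * F x) \<longlonglongrightarrow> g 0 * F x" by (rule tendsto_mult_right)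
  qed
  have b: "AE x in lborel. norm (g (s k *\<^sub>R x) * F x) \<le> B * norm (F x)" for k
    using g(2) by (intro AE_I2) (simp add: norm_mult mult_right_mono)
  show "integrable lborel (\<lambda>x. g (s k *\<^sub>R x) * F x)"
    by (rule integrable_dominated_convergence2[OF m0 m w lim b])
  show "(\<lambda>k. LINT x|lborel. g (s k *\<^sub>R x) * F x) \<longlonglongrightarrow> (LINT x|lborel. g 0 * F x)"
    by (rule integral_dominated_convergence[OF m0 m w lim b])
qed

text \<open>Test with the cut-offs \<open>\<psi> (x / k) ift h x\<close> and let \<open>k\<close> tend to infinity.\<close>

lemma D_graph_ift_pairing:
  fixes Dh :: "'n::finite \<Rightarrow> complex^'N::finite^'N"
  assumes uf: "(u, f) \<in> D_graph Dh p" and p: "p > 1" and h: "schwartz h"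
  shows "integrable lborel (\<lambda>x. ift h x * f x $ l)" "integrable lborel (\<lambda>x. ift h x * u x $ l)"
    "(LINT x|lborel. ift h x * f x $ l)
      = \<i> * (\<Sum>j\<in>UNIV. \<Sum>m\<in>UNIV. Dh j $ l $ m * (LINT x|lborel. ift (freq_mult j h) x * u x $ m))"
proof -
  have u: "u \<in> Lp p" and f: "f \<in> Lp p" using uf by (auto simp: D_graph_def)
  have p0: "p > 0" using p by simp
  have int: "integrable lborel (\<lambda>x. ift h x * g x $ l)" if g: "g \<in> Lp p" and h: "schwartz h" for g :: "real^'n \<Rightarrow> complex^'N" and h l
  proof -
    note [measurable] = ift_measurable[OF h] Lp_nth(1)[OF g p0]
    have "integrable lborel (\<lambda>x. norm (ift h x) powr conj_exp p)"
      using conj_exp_gt_1[OF p] by (intro integrable_powr_bounded(1)[OF ift_integrable[OF h] ift_norm_le]) auto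
    from integrable_mult_Lp(1)[OF _ _ _ _ Lp_nth(2)[OF g p0] this p]
    have "integrable lborel (\<lambda>x. norm (g x $ l) * norm (ift h x))" by simp
    then show ?thesis
      by (rule Bochner_Integration.integrable_bound) (auto simp: norm_mult mult.commute)
  qed
  show "integrable lborel (\<lambda>x. ift h x * f x $ l)" "integrable lborel (\<lambda>x. ift h x * u x $ l)"
    by (rule int[OF f h] int[OF u h])+
  obtain \<psi> :: "real^'n \<Rightarrow> complex" where \<psi>: "test_function \<psi>" "\<psi> 0 = 1" by (rule cutoff_exists)
  obtain B R where B: "B \<ge> 0" "\<And>x. norm (\<psi> x) \<le> B" and R: "\<And>x. norm x > R \<Longrightarrow> \<psi> x = 0"
    by (rule test_function_bounded[OF \<psi>(1)]) (rule that)
  define s where "s k = inverse (real (Suc k))" for k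
  have s: "0 < s k" "s k \<le> 1" for k by (auto simp: s_def inverse_le_1_iff)
  have s0: "s \<longlonglongrightarrow> 0" unfolding s_def by (rule LIMSEQ_inverse_real_of_nat)
  note cont = test_functionD(3,4)[OF \<psi>(1)]
  note lim = scaled_pairing_tendsto[OF cont(1) B(2) _ s0]
  let ?\<phi> = "\<lambda>k x. \<psi> (s k *\<^sub>R x) * ift h x"
  have \<phi>: "test_function (?\<phi> k)" for k
  proof -
    have "compact (closure {x. ?\<phi> k x \<noteq> 0})"
    proof (rule compact_support_normI[where R = "R / s k"])
      fix x :: "real^'n" assume "norm x > R / s k"
      then have "norm (s k *\<^sub>R x) > R" using s[of k] by (simp add: field_simps)
      then show "?\<phi> k x = 0" using R[of "s k *\<^sub>R x"] by simp
    qed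
    then show ?thesis unfolding test_function_def
      by (intro conjI allI Ck_mult Ck_scale Ck_ift h test_functionD(1)[OF \<psi>(1)])
  qed
  have pd: "partial_deriv j (?\<phi> k) x = \<psi> (s k *\<^sub>R x) * ift (freq_mult j h) x
      + complex_of_real (s k) * partial_deriv j \<psi> (s k *\<^sub>R x) * ift h x" for j k x
  proof -
    have "(\<lambda>x. \<psi> (s k *\<^sub>R x)) differentiable at x"
      using Ck_scale[OF test_functionD(1)[OF \<psi>(1), of 1], of "s k"] by simp
    then show ?thesis
      by (subst partial_deriv_mult[OF _ ift_differentiable[OF h]])
         (simp_all add: partial_deriv_scale[OF test_functionD(2)[OF \<psi>(1)]] partial_deriv_ift[OF h])
  qed
  \<comment> \<open>The term in which the cut-off is differentiated carries the factor
    \<open>s k\<close>, so it disappears in the limit.\<close>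
  have lim_u: "(\<lambda>k. LINT x|lborel. partial_deriv j (?\<phi> k) x * u x $ m) \<longlonglongrightarrow> (LINT x|lborel. ift (freq_mult j h) x * u x $ m)" for j m
  proof -
    let ?F = "\<lambda>x. ift (freq_mult j h) x * u x $ m" and ?G = "\<lambda>x. ift h x * u x $ m"
    have F: "integrable lborel ?F" "integrable lborel ?G"
      by (intro int u schwartz_freq_mult h)+
    obtain B' where B': "\<And>x. norm (partial_deriv j \<psi> x) \<le> B'"
      by (rule test_function_bounded[OF test_function_partial_deriv[OF \<psi>(1)]]) (rule that)
    note lim' = scaled_pairing_tendsto[OF cont(2) B' F(2) s0]
    have "(LINT x|lborel. partial_deriv j (?\<phi> k) x * u x $ m)
        = (LINT x|lborel. \<psi> (s k *\<^sub>R x) * ?F x + complex_of_real (s k) * (partial_deriv j \<psi> (s k *\<^sub>R x) * ?G x))" for k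
      unfolding pd by (simp add: algebra_simps)
    moreover have "(LINT x|lborel. \<psi> (s k *\<^sub>R x) * ?F x + complex_of_real (s k) * (partial_deriv j \<psi> (s k *\<^sub>R x) * ?G x))
        = (LINT x|lborel. \<psi> (s k *\<^sub>R x) * ?F x)
        + complex_of_real (s k) * (LINT x|lborel. partial_deriv j \<psi> (s k *\<^sub>R x) * ?G x)" for k
      using lim(1)[OF F(1)] lim'(1) by simp
    ultimately show ?thesis
      using tendsto_add[OF lim(2)[OF F(1)] tendsto_mult[OF tendsto_of_real[OF s0] lim'(2)]] \<psi>(2) by simp
  qed
  have "(\<lambda>k. \<i> * (\<Sum>j\<in>UNIV. \<Sum>m\<in>UNIV. Dh j $ l $ m * (LINT x|lborel. partial_deriv j (?\<phi> k) x * u x $ m)))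
      \<longlonglongrightarrow> \<i> * (\<Sum>j\<in>UNIV. \<Sum>m\<in>UNIV. Dh j $ l $ m * (LINT x|lborel. ift (freq_mult j h) x * u x $ m))"
    by (intro tendsto_intros lim_u)
  moreover have "(LINT x|lborel. ?\<phi> k x * f x $ l)
      = \<i> * (\<Sum>j\<in>UNIV. \<Sum>m\<in>UNIV. Dh j $ l $ m * (LINT x|lborel. partial_deriv j (?\<phi> k) x * u x $ m))" for k
    using p by (intro D_graph_components[OF uf _ \<phi>]) simp
  ultimately have "(\<lambda>k. LINT x|lborel. \<psi> (s k *\<^sub>R x) * (ift h x * f x $ l))
      \<longlonglongrightarrow> \<i> * (\<Sum>j\<in>UNIV. \<Sum>m\<in>UNIV. Dh j $ l $ m * (LINT x|lborel. ift (freq_mult j h) x * u x $ m))"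
    by (simp add: mult.assoc)
  from LIMSEQ_unique[OF lim(2)[OF int[OF f h], unfolded \<psi>(2) mult_1_left] this]
  show "(LINT x|lborel. ift h x * f x $ l)
      = \<i> * (\<Sum>j\<in>UNIV. \<Sum>m\<in>UNIV. Dh j $ l $ m * (LINT x|lborel. ift (freq_mult j h) x * u x $ m))" .
qed

text \<open>By \<open>ann\<close> the row vector h(\<xi>) annihilates the range of the symbol. The
  conjugate makes the sesquilinear pairing with Du bilinear; moving D onto the transforms multiplies
  them by the symbol from the right, which gives 0.\<close>

lemma null_adjoint_ift:
  fixes Dh :: "'n::finite \<Rightarrow> complex^'N::finite^'N"
  assumes p: "p > 1" and h: "\<And>l. schwartz (h l)"
    and ann: "\<And>\<xi> m. (\<Sum>l\<in>UNIV. h l \<xi> * symbol Dh \<xi> $ l $ m) = 0"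
  shows "(\<lambda>x. \<chi> l. cnj (ift (h l) x)) \<in> null_adjoint Dh p"
proof -
  let ?w = "\<lambda>x. \<chi> l. cnj (ift (h l) x)"
  let ?B = "\<Sum>l\<in>UNIV. LINT \<xi>|lborel. norm (h l \<xi>)"
  have "norm (ift (h l) x) \<le> ?B" for l x
    using ift_norm_le[of "h l" x] member_le_sum[of l UNIV "\<lambda>l. LINT \<xi>|lborel. norm (h l \<xi>)"] by force
  then have w: "?w \<in> Lp (conj_exp p)"
    using conj_exp_gt_1[OF p] ift_integrable[OF h] by (intro Lp_vecI) auto
  have "(LINT x|lborel. cinner (f x) (?w x)) = 0" if uf: "(u, f) \<in> D_graph Dh p" for u f
  proof -
    note pair = D_graph_ift_pairing[OF uf p h] D_graph_ift_pairing[OF uf p schwartz_freq_mult[OF h]]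
    have "(LINT x|lborel. cinner (f x) (?w x)) = (\<Sum>l\<in>UNIV. LINT x|lborel. ift (h l) x * f x $ l)"
      using pair(1) by (simp add: cinner_def mult.commute)
    also have "\<dots> = (\<Sum>l\<in>UNIV. \<Sum>j\<in>UNIV. \<Sum>m\<in>UNIV. \<i> * Dh j $ l $ m * (LINT x|lborel. ift (freq_mult j (h l)) x * u x $ m))"
      unfolding pair(3) by (simp add: sum_distrib_left mult_ac)
    also have "\<dots> = (\<Sum>m\<in>UNIV. \<Sum>l\<in>UNIV. \<Sum>j\<in>UNIV. \<i> * Dh j $ l $ m * (LINT x|lborel. ift (freq_mult j (h l)) x * u x $ m))"
      by (subst (2) sum.swap, subst sum.swap) (rule refl)
    also have "\<dots> = (\<Sum>m\<in>UNIV. LINT x|lborel. (\<Sum>l\<in>UNIV. \<Sum>j\<in>UNIV. \<i> * Dh j $ l $ m * ift (freq_mult j (h l)) x) * u x $ m)"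
      using pair(5) by (simp add: sum_distrib_right mult.assoc)
    finally have eq: "(LINT x|lborel. cinner (f x) (?w x))
        = (\<Sum>m\<in>UNIV. LINT x|lborel. (\<Sum>l\<in>UNIV. \<Sum>j\<in>UNIV. \<i> * Dh j $ l $ m * ift (freq_mult j (h l)) x) * u x $ m)" .
    have "(\<Sum>l\<in>UNIV. \<Sum>j\<in>UNIV. \<i> * Dh j $ l $ m * ift (freq_mult j (h l)) x) = 0" for m x
    proof -
      have s: "schwartz (\<lambda>\<xi>. \<i> * Dh j $ l $ m * freq_mult j (h l) \<xi>)" for j l
        by (intro schwartz_cmult schwartz_freq_mult h)
      have "(\<Sum>l\<in>UNIV. \<Sum>j\<in>UNIV. \<i> * Dh j $ l $ m * ift (freq_mult j (h l)) x)
          = (\<Sum>l\<in>UNIV. \<Sum>j\<in>UNIV. ift (\<lambda>\<xi>. \<i> * Dh j $ l $ m * freq_mult j (h l) \<xi>) x)"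
        by (intro sum.cong refl ift_cmult[symmetric])
      also have "\<dots> = ift (\<lambda>\<xi>. \<Sum>l\<in>UNIV. \<Sum>j\<in>UNIV. \<i> * Dh j $ l $ m * freq_mult j (h l) \<xi>) x"
      proof -
        have s': "schwartz (\<lambda>\<xi>. \<Sum>j\<in>UNIV. \<i> * Dh j $ l $ m * freq_mult j (h l) \<xi>)" for l
          by (rule schwartz_sum) (simp_all only: s finite UNIV_not_empty not_False_eq_True)
        have "ift (\<lambda>\<xi>. \<Sum>l\<in>UNIV. \<Sum>j\<in>UNIV. \<i> * Dh j $ l $ m * freq_mult j (h l) \<xi>) x
            = (\<Sum>l\<in>UNIV. ift (\<lambda>\<xi>. \<Sum>j\<in>UNIV. \<i> * Dh j $ l $ m * freq_mult j (h l) \<xi>) x)"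
          by (rule ift_sum) (rule schwartzD(3)[OF s'])
        also have "\<dots> = (\<Sum>l\<in>UNIV. \<Sum>j\<in>UNIV. ift (\<lambda>\<xi>. \<i> * Dh j $ l $ m * freq_mult j (h l) \<xi>) x)"
          by (intro sum.cong refl ift_sum schwartzD(3) s)
        finally show ?thesis by (rule sym)
      qed
      \<comment> \<open>One factor \<i> comes from the weak formulation and one from
        \<open>freq_mult\<close>; together they give the minus sign in front of the sum in
        \<open>ann\<close>.\<close>
      also have "(\<lambda>\<xi>. \<Sum>l\<in>UNIV. \<Sum>j\<in>UNIV. \<i> * Dh j $ l $ m * freq_mult j (h l) \<xi>) = (\<lambda>\<xi>. - (\<Sum>l\<in>UNIV. h l \<xi> * symbol Dh \<xi> $ l $ m))"
        unfolding symbol_nth by (simp add: sum_distrib_left sum_negf[symmetric] mult_ac)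
      finally show ?thesis unfolding ann by (simp add: ift_def)
    qed
    then show ?thesis unfolding eq by simp
  qed
  moreover have "(\<lambda>x. 0) \<in> Lp (conj_exp p)" by (simp add: Lp_def)
  ultimately show ?thesis using w by (auto simp: null_adjoint_def adjoint_graph_def cinner_def)
qed

section \<open>Linear algebra of the symbol\<close>

text \<open>An algebraic description of V; that the averages generate this very space for every
  exponent is \<open>V_space_eq\<close>.\<close>

definition range_span :: "('n::finite \<Rightarrow> complex^'N::finite^'N) \<Rightarrow> (complex^'N) set" where
  "range_span Dh = vec.span (\<Union>j. range ((*v) (Dh j)))"

definition constant_range :: "('n::finite \<Rightarrow> complex^'N::finite^'N) \<Rightarrow> bool" where
  "constant_range Dh \<longleftrightarrow> (\<forall>\<xi>. \<xi> \<noteq> 0 \<longrightarrow> range ((*v) (symbol Dh \<xi>)) = range_span Dh)"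

lemma subspace_range_span: "vec.subspace (range_span Dh)"
  unfolding range_span_def by (rule vec.subspace_span)

lemma range_span_base: "Dh j *v x \<in> range_span Dh"
  unfolding range_span_def by (rule vec.span_base) blast

lemma symbol_mult_vec: "symbol Dh \<xi> *v x = (\<Sum>j\<in>UNIV. complex_of_real (\<xi> $ j) *s (Dh j *v x))"
  by (simp add: vec_eq_iff matrix_vector_mult_def symbol_nth sum_component sum_distrib_left sum_distrib_right mult.assoc)
     (rule allI, rule sum.swap)

lemma symbol_in_range_span: "symbol Dh \<xi> *v x \<in> range_span Dh"
  unfolding symbol_mult_vec
  by (intro vec.subspace_sum[OF subspace_range_span] vec.subspace_scale[OF subspace_range_span] range_span_base)

section \<open>Cramer's rule with polynomial entries\<close>

lemma det_nonzero_if_kernel_trivial: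
  fixes A :: "complex^'N::finite^'N"
  assumes "\<And>x. A *v x = 0 \<Longrightarrow> x = 0"
  shows "det A \<noteq> 0"
proof -
  obtain B where "B ** A = mat 1" using matrix_left_invertible_ker[of A] assms by blast
  then have "invertible A" unfolding invertible_def using matrix_left_right_inverse[of B A] by blast
  then show ?thesis by (simp add: invertible_det_nz)
qed

text \<open>Written as in Cramer's rule, with a column replaced by a unit vector: each entry is a
  determinant, hence polynomial in the entries of \<open>A\<close>.\<close>

definition adjugate :: "complex^'N::finite^'N \<Rightarrow> complex^'N^'N" where
  "adjugate A = (\<chi> k l. det (\<chi> i j. if j = k then axis l 1 $ i else A $ i $ j))"

lemma adjugate_mult:
  assumes d: "det A \<noteq> 0"
  shows "A *v (adjugate A *v x) = det A *s x" "adjugate A *v (A *v x) = det A *s x"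
proof -
  let ?B = "\<chi> k l. adjugate A $ k $ l / det A"
  have "A ** ?B = mat 1"
  proof -
    have "(A ** ?B) $ i $ l = mat 1 $ i $ l" for i l
    proof -
      have "A *v (\<chi> k. adjugate A $ k $ l / det A) = axis l 1"
        unfolding cramer[OF d] by (simp add: adjugate_def)
      then have "(A *v (\<chi> k. adjugate A $ k $ l / det A)) $ i = axis l 1 $ i" by simp
      then show ?thesis
        by (simp add: matrix_matrix_mult_def matrix_vector_mult_def mat_def axis_def)
    qed
    then show ?thesis by (simp add: vec_eq_iff)
  qed
  then have AB: "A ** ?B = mat 1" "?B ** A = mat 1" using matrix_left_right_inverse[of A ?B] by auto
  have adj: "adjugate A *v y = det A *s (?B *v y)" for y
    using d by (simp add: vec_eq_iff matrix_vector_mult_def sum_distrib_left)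
  show "A *v (adjugate A *v x) = det A *s x"
    unfolding adj vec.scale unfolding matrix_vector_mul_assoc AB by simp
  show "adjugate A *v (A *v x) = det A *s x"
    unfolding adj unfolding matrix_vector_mul_assoc AB by simp
qed

lemma cpoly_adjugate:
  assumes "\<And>i j. cpoly (\<lambda>\<xi>. M \<xi> $ i $ j)"
  shows "cpoly (\<lambda>\<xi>. adjugate (M \<xi>) $ i $ j)"
  unfolding adjugate_def vec_lambda_beta
proof (rule cpoly_det)
  fix i' j' show "cpoly (\<lambda>\<xi>. (\<chi> i' j'. if j' = i then axis j 1 $ i' else M \<xi> $ i' $ j') $ i' $ j')"
    by (cases "j' = i") (simp_all add: assms cpoly.const)
qed

lemma cpoly_matrix_mult:
  assumes "\<And>i j. cpoly (\<lambda>\<xi>. A \<xi> $ i $ j)" "\<And>i j. cpoly (\<lambda>\<xi>. B \<xi> $ i $ j)"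
  shows "cpoly (\<lambda>\<xi>. (A \<xi> ** B \<xi>) $ i $ j)"
  unfolding matrix_matrix_mult_def vec_lambda_beta by (intro cpoly_sum cpoly.mult assms)

text \<open>At a point \<open>\<xi>0\<close> of maximal rank, the symbol is perturbed by the projection \<open>P\<close> onto its kernel
  along its range. Wherever \<open>M \<xi> = symbol \<xi> + P\<close> is invertible, the kernel of \<open>P (M \<xi>)\<^sup>-\<^sup>1\<close> is
  the range of \<open>symbol \<xi>\<close>; Cramer's rule makes this matrix polynomial in \<open>\<xi>\<close>.\<close>

lemma polynomial_annihilator:
  fixes Dh :: "'n::finite \<Rightarrow> complex^'N::finite^'N"
  assumes \<kappa>: "\<kappa> > 0"
    and bound: "\<And>\<xi> e. e \<in> range (\<lambda>x. symbol Dh \<xi> *v x) \<Longrightarrow> \<kappa> * norm \<xi> * norm e \<le> norm (symbol Dh \<xi> *v e)"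
  obtains Q :: "real^'n \<Rightarrow> complex^'N^'N" and m where "\<And>i j. cpoly (\<lambda>\<xi>. Q \<xi> $ i $ j)" "cpoly m" "\<exists>\<xi>. m \<xi> \<noteq> 0"
    "\<And>\<xi>. Q \<xi> ** symbol Dh \<xi> = 0"
    "\<And>\<xi> v. m \<xi> \<noteq> 0 \<Longrightarrow> Q \<xi> *v v = 0 \<Longrightarrow> v \<in> range ((*v) (symbol Dh \<xi>))"
proof -
  let ?R = "\<lambda>\<xi>. range ((*v) (symbol Dh \<xi>))"
  have sub: "vec.subspace (?R \<xi>)" for \<xi> by (intro vec.subspace_image vec.subspace_UNIV)
  \<comment> \<open>A frequency of maximal rank exists because ranks are at most
    \<open>CARD('N)\<close>; the \<open>+ 1\<close> below turns this into the strict bound that the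
    rule asks for.\<close>
  have "\<exists>\<xi>0. True \<and> (\<forall>\<xi>. True \<longrightarrow> vec.dim (?R \<xi>) \<le> vec.dim (?R \<xi>0))"
    by (rule ex_has_greatest_nat[where b = "CARD('N) + 1"])
       (rule TrueI, intro allI impI, simp only: Suc_eq_plus1[symmetric] less_Suc_eq_le, rule dim_subset_UNIV_cart_gen)
  then obtain \<xi>0 where max: "\<And>\<xi>. vec.dim (?R \<xi>) \<le> vec.dim (?R \<xi>0)" by blast
  let ?D0 = "symbol Dh \<xi>0"
  \<comment> \<open>The lower bound on the symbol enters here: range and kernel at
    \<open>\<xi>0\<close> intersect trivially, so they are complementary. If
    \<open>\<xi>0 = 0\<close> the range is zero.\<close>
  have inj0: "x = 0" if "x \<in> ?R \<xi>0" "?D0 *v x = 0" for x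
  proof (cases "\<xi>0 = 0")
    case True
    then show ?thesis using that(1) by (auto simp: symbol_mult_vec)
  next
    case False
    then have "0 < \<kappa> * norm \<xi>0" using \<kappa> by simp
    moreover have "\<kappa> * norm \<xi>0 * norm x \<le> 0" using bound[OF that(1)] that(2) by simp
    ultimately show ?thesis by (metis mult_le_0_iff norm_le_zero_iff not_le)
  qed
  have "inj_on ((*v) ?D0) (?R \<xi>0)"
  proof (rule inj_onI)
    fix x y assume xy: "x \<in> ?R \<xi>0" "y \<in> ?R \<xi>0" "?D0 *v x = ?D0 *v y"
    have "?D0 *v (x - y) = 0" unfolding matrix_vector_mult_diff_distrib xy(3) by simp
    from inj0[OF vec.subspace_diff[OF sub xy(1,2)] this] show "x = y" by simp
  qed
  from vec.linear_exists_left_inverse_on[OF matrix_vector_mul_linear_gen sub this]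
  obtain g where g: "range g \<subseteq> ?R \<xi>0" "Vector_Spaces.linear (*s) (*s) g" "\<And>x. x \<in> ?R \<xi>0 \<Longrightarrow> g (?D0 *v x) = x" by auto
  define P where "P = mat 1 - matrix g ** ?D0"
  have P: "P *v x = x - g (?D0 *v x)" for x
    unfolding P_def using g(2) by (simp add: matrix_vector_mult_diff_rdistrib matrix_vector_mul_assoc[symmetric] matrix_works)
  have P0: "P *v x = 0" if "x \<in> ?R \<xi>0" for x using g(3)[OF that] by (simp add: P)
  define M where "M \<xi> = symbol Dh \<xi> + P" for \<xi>
  have M: "M \<xi> *v x = symbol Dh \<xi> *v x + P *v x" for \<xi> x by (simp add: M_def matrix_vector_mult_add_rdistrib)
  define m where "m \<xi> = det (M \<xi>)" for \<xi>
  have Mpoly: "cpoly (\<lambda>\<xi>. M \<xi> $ i $ j)" for i j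
    unfolding M_def vector_add_component by (intro cpoly.add cpoly_symbol cpoly.const)
  have m0: "m \<xi>0 \<noteq> 0"
    unfolding m_def
  proof (rule det_nonzero_if_kernel_trivial)
    fix x assume "M \<xi>0 *v x = 0"
    then have *: "x = g (?D0 *v x) - ?D0 *v x" unfolding M P by (simp add: algebra_simps)
    have "g (?D0 *v x) - ?D0 *v x \<in> ?R \<xi>0" using g(1) by (intro vec.subspace_diff[OF sub]) auto
    then have x: "x \<in> ?R \<xi>0" using * by simp
    then have "?D0 *v x = 0" using \<open>M \<xi>0 *v x = 0\<close> P0 unfolding M by simp
    then show "x = 0" using x inj0 by blast
  qed
  \<comment> \<open>As \<open>P\<close> vanishes on \<open>?R \<xi>0\<close>, invertibility of
    \<open>M \<xi>\<close> makes the symbol at \<xi> injective there. The image then has the maximal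
    possible dimension, so it is the whole range.\<close>
  have range: "?R \<xi> = (*v) (symbol Dh \<xi>) ` ?R \<xi>0" if m: "m \<xi> \<noteq> 0" for \<xi>
  proof -
    have inj: "inj_on ((*v) (symbol Dh \<xi>)) (vec.span (?R \<xi>0))"
      unfolding vec.span_eq_iff[THEN iffD2, OF sub]
    proof (rule inj_onI)
      fix x y assume xy: "x \<in> ?R \<xi>0" "y \<in> ?R \<xi>0" "symbol Dh \<xi> *v x = symbol Dh \<xi> *v y"
      then have "M \<xi> *v x = M \<xi> *v y" unfolding M using P0 by simp
      then have "det (M \<xi>) *s x = det (M \<xi>) *s y" using adjugate_mult(2)[of "M \<xi>"] m unfolding m_def by metis
      then show "x = y" using m unfolding m_def by simp
    qed
    have "(*v) (symbol Dh \<xi>) ` ?R \<xi>0 = ?R \<xi>"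
    proof (rule vec.subspace_dim_equal)
      show "vec.subspace ((*v) (symbol Dh \<xi>) ` ?R \<xi>0)" by (intro vec.subspace_image sub)
      show "vec.dim (?R \<xi>) \<le> vec.dim ((*v) (symbol Dh \<xi>) ` ?R \<xi>0)"
        using vec.dim_image_eq[OF matrix_vector_mul_linear_gen inj] max[of \<xi>] by simp
    qed (use sub in auto)
    then show ?thesis by simp
  qed
  \<comment> \<open>The factor \<open>m \<xi>\<close> makes \<open>Q \<xi>\<close> vanish wherever
    \<open>M \<xi>\<close> is singular, so that the annihilation holds at every frequency.\<close>
  define Q where "Q \<xi> = (mat (m \<xi>) ** P) ** adjugate (M \<xi>)" for \<xi>
  have mat_mult: "mat c *v x = c *s x" for c :: complex and x :: "complex^'N"
    by (simp add: vec_eq_iff matrix_vector_mult_def mat_def if_distrib[of "\<lambda>z. z * _"] cong: if_cong)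
  have Q: "Q \<xi> *v x = m \<xi> *s (P *v (adjugate (M \<xi>) *v x))" for \<xi> x
    by (simp add: Q_def matrix_vector_mul_assoc[symmetric] mat_mult)
  show ?thesis
  proof (rule that[of Q m])
    show mp: "cpoly m" unfolding m_def by (intro cpoly_det Mpoly)
    have "cpoly (\<lambda>\<xi>. mat (m \<xi>) $ i $ j)" for i j :: 'N
      by (cases "i = j") (simp_all add: mat_def mp cpoly.const)
    then show "cpoly (\<lambda>\<xi>. Q \<xi> $ i $ j)" for i j
      unfolding Q_def by (intro cpoly_matrix_mult cpoly_adjugate Mpoly cpoly.const)
    show "\<exists>\<xi>. m \<xi> \<noteq> 0" using m0 by blast
    show "Q \<xi> ** symbol Dh \<xi> = 0" for \<xi>
    proof -
      have "Q \<xi> *v (symbol Dh \<xi> *v x) = 0" for x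
      proof (cases "m \<xi> = 0")
        case False
        then obtain y where y: "y \<in> ?R \<xi>0" "symbol Dh \<xi> *v x = symbol Dh \<xi> *v y"
          using range by blast
        then have "symbol Dh \<xi> *v x = M \<xi> *v y" using P0 by (simp add: M)
        then have "Q \<xi> *v (symbol Dh \<xi> *v x) = m \<xi> *s (P *v (m \<xi> *s y))"
          unfolding Q using adjugate_mult(2)[of "M \<xi>" y] False unfolding m_def by simp
        then show ?thesis using P0[OF y(1)] by (simp add: vec.scale)
      qed (simp add: Q)
      then show ?thesis unfolding matrix_eq matrix_vector_mul_assoc by simp
    qed
    show "v \<in> ?R \<xi>" if "m \<xi> \<noteq> 0" "Q \<xi> *v v = 0" for \<xi> v
    proof -
      let ?x = "adjugate (M \<xi>) *v v"
      have "P *v ?x = 0" using that by (simp add: Q)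
      moreover have "M \<xi> *v ?x = m \<xi> *s v" using adjugate_mult(1) that(1) unfolding m_def by blast
      ultimately have "symbol Dh \<xi> *v ?x = m \<xi> *s v" by (simp add: M)
      then have "symbol Dh \<xi> *v (inverse (m \<xi>) *s ?x) = v" using that(1) by (simp add: vec.scale)
      then show ?thesis by (metis rangeI)
    qed
  qed
qed

lemma symbol_tendsto:
  "s \<longlonglongrightarrow> \<xi> \<Longrightarrow> (\<lambda>k. symbol Dh (s k) *v e) \<longlonglongrightarrow> symbol Dh \<xi> *v e"
  by (intro vec_tendstoI) (auto simp: matrix_vector_mult_def symbol_nth intro!: tendsto_intros)

text \<open>At generic frequencies V lies in the range, so the lower bound holds on V; both of its
  sides are continuous in \<xi>, so it persists at every frequency. For \<xi> \<noteq> 0 the symbol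
  is therefore injective on V, maps V into V, and is onto V by dimension.\<close>

lemma constant_range_if_generic:
  fixes Dh :: "'n::finite \<Rightarrow> complex^'N::finite^'N"
  assumes \<kappa>: "\<kappa> > 0"
    and bound: "\<And>\<xi> e. e \<in> range (\<lambda>x. symbol Dh \<xi> *v x) \<Longrightarrow> \<kappa> * norm \<xi> * norm e \<le> norm (symbol Dh \<xi> *v e)"
    and m: "cpoly m" "m \<xi>0 \<noteq> 0"
    and gen: "\<And>\<xi>. m \<xi> \<noteq> 0 \<Longrightarrow> range_span Dh \<subseteq> range ((*v) (symbol Dh \<xi>))"
  shows "constant_range Dh"
  unfolding constant_range_def
proof (intro allI impI)
  let ?V = "range_span Dh"
  fix \<xi> :: "real^'n" assume \<xi>: "\<xi> \<noteq> 0"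
  obtain s where s: "s \<longlonglongrightarrow> \<xi>" "\<And>k::nat. m (s k) \<noteq> 0" using cpoly_nonzero_dense[OF m] by blast
  have le: "\<kappa> * norm \<xi> * norm e \<le> norm (symbol Dh \<xi> *v e)" if "e \<in> ?V" for e
  proof (rule LIMSEQ_le)
    show "(\<lambda>k. \<kappa> * norm (s k) * norm e) \<longlonglongrightarrow> \<kappa> * norm \<xi> * norm e" by (intro tendsto_intros s)
    show "(\<lambda>k. norm (symbol Dh (s k) *v e)) \<longlonglongrightarrow> norm (symbol Dh \<xi> *v e)"
      by (intro tendsto_norm symbol_tendsto s)
    show "\<exists>N. \<forall>k\<ge>N. \<kappa> * norm (s k) * norm e \<le> norm (symbol Dh (s k) *v e)"
      using bound gen[OF s(2)] that by blast
  qed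
  have sp: "vec.span ?V = ?V" using subspace_range_span by (simp add: vec.span_eq_iff)
  have inj: "inj_on ((*v) (symbol Dh \<xi>)) (vec.span ?V)"
    unfolding sp
  proof (rule inj_onI)
    fix x y assume xy: "x \<in> ?V" "y \<in> ?V" "symbol Dh \<xi> *v x = symbol Dh \<xi> *v y"
    have "\<kappa> * norm \<xi> * norm (x - y) \<le> 0"
      using le[OF vec.subspace_diff[OF subspace_range_span xy(1,2)]]
      unfolding matrix_vector_mult_diff_distrib xy(3) by simp
    moreover have "0 < \<kappa> * norm \<xi>" using \<kappa> \<xi> by simp
    ultimately show "x = y" by (metis eq_iff_diff_eq_0 mult_le_0_iff norm_le_zero_iff not_le)
  qed
  have "(*v) (symbol Dh \<xi>) ` ?V = ?V"
  proof (rule vec.subspace_dim_equal)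
    show "vec.subspace ((*v) (symbol Dh \<xi>) ` ?V)" by (intro vec.subspace_image subspace_range_span)
    show "vec.dim ?V \<le> vec.dim ((*v) (symbol Dh \<xi>) ` ?V)"
      using vec.dim_image_eq[OF matrix_vector_mul_linear_gen inj] by simp
  qed (use subspace_range_span symbol_in_range_span in auto)
  then show "range ((*v) (symbol Dh \<xi>)) = ?V" using symbol_in_range_span by blast
qed

text \<open>\<open>\<chi> l. cnj (ift (h l) x)\<close> runs through enough of the null space of the adjoint.\<close>

lemma constant_range_if_perp:
  fixes Dh :: "'n::finite \<Rightarrow> complex^'N::finite^'N"
  assumes \<kappa>: "\<kappa> > 0"
    and bound: "\<And>\<xi> e. e \<in> range (\<lambda>x. symbol Dh \<xi> *v x) \<Longrightarrow> \<kappa> * norm \<xi> * norm e \<le> norm (symbol Dh \<xi> *v e)"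
    and perp: "\<And>h v x. (\<And>l. schwartz (h l)) \<Longrightarrow> (\<And>\<xi> m. (\<Sum>l\<in>UNIV. h l \<xi> * symbol Dh \<xi> $ l $ m) = 0)
      \<Longrightarrow> v \<in> range_span Dh \<Longrightarrow> cinner v (\<chi> l. cnj (ift (h l) x)) = 0"
  shows "constant_range Dh"
proof -
  obtain Q :: "real^'n \<Rightarrow> complex^'N^'N" and m where Q: "\<And>i j. cpoly (\<lambda>\<xi>. Q \<xi> $ i $ j)" "cpoly m" "\<exists>\<xi>. m \<xi> \<noteq> 0"
    "\<And>\<xi>. Q \<xi> ** symbol Dh \<xi> = 0"
    "\<And>\<xi> v. m \<xi> \<noteq> 0 \<Longrightarrow> Q \<xi> *v v = 0 \<Longrightarrow> v \<in> range ((*v) (symbol Dh \<xi>))"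
    by (rule polynomial_annihilator[OF \<kappa> bound]) (assumption, rule that)
  have "Q \<xi> *v v = 0" if v: "v \<in> range_span Dh" for v \<xi>
  proof -
    have "(Q \<xi> *v v) $ k = 0" for k
    proof -
      let ?h = "\<lambda>l \<xi>. Q \<xi> $ k $ l * complex_of_real (gauss \<xi>)"
      have h: "schwartz (?h l)" for l by (rule schwartz_cpoly_gauss[OF Q(1)])
      have "(\<Sum>l\<in>UNIV. ?h l \<xi> * symbol Dh \<xi> $ l $ m) = 0" for \<xi> m
      proof -
        have "(\<Sum>l\<in>UNIV. ?h l \<xi> * symbol Dh \<xi> $ l $ m) = complex_of_real (gauss \<xi>) * (Q \<xi> ** symbol Dh \<xi>) $ k $ m"
          by (simp add: matrix_matrix_mult_def sum_distrib_left mult_ac)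
        then show ?thesis by (simp add: Q(4))
      qed
      from perp[OF h this v] have z: "(\<Sum>l\<in>UNIV. v $ l * ift (?h l) x) = 0" for x
        by (simp add: cinner_def)
      let ?H = "\<lambda>\<xi>. \<Sum>l\<in>UNIV. v $ l * ?h l \<xi>"
      have vh: "schwartz (\<lambda>\<xi>. v $ l * ?h l \<xi>)" for l by (rule schwartz_cmult[OF h])
      have "ift ?H x = 0" for x
        using z[of x] by (subst ift_sum[OF schwartzD(3)[OF vh]]) (simp add: ift_cmult)
      from ift_zero_imp_zero[OF schwartz_sum[OF finite UNIV_not_empty vh] this, of \<xi>]
      have "complex_of_real (gauss \<xi>) * (Q \<xi> *v v) $ k = 0"
        by (simp add: matrix_vector_mult_def sum_distrib_left mult_ac)
      then show ?thesis using gauss_bounds(1)[of \<xi>] by simp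
    qed
    then show ?thesis by (simp add: vec_eq_iff)
  qed
  then show ?thesis using Q(3,5) by (blast intro: constant_range_if_generic[OF \<kappa> bound Q(2)])
qed

section \<open>Density of the range in the constant range case\<close>

lemma det_scale: "det (\<chi> i j. c * A $ i $ j) = c ^ CARD('N) * det A" for A :: "complex^'N::finite^'N"
  by (simp add: det_def prod.distrib sum_distrib_left mult_ac)

text \<open>Expresses membership in a subspace by the linear equation E x = x, which can be passed
  through integrals.\<close>

lemma projection_exists:
  assumes "vec.subspace (V :: (complex^'N::finite) set)"
  obtains E where "\<And>x. E *v x \<in> V" "\<And>x. x \<in> V \<Longrightarrow> E *v x = x"
proof -
  obtain g where g: "range g \<subseteq> V" "Vector_Spaces.linear (*s) (*s) g" "\<And>x. x \<in> V \<Longrightarrow> g x = x"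
    using vec.linear_exists_left_inverse_on[OF vec.linear_id assms] by auto
  show ?thesis
    by (rule that[of "matrix g"]) (use g in \<open>auto simp: matrix_works\<close>)
qed

text \<open>If \<open>D(\<xi>)\<close> is invertible on its constant range for \<open>\<xi> \<noteq> 0\<close>, Cramer's rule for
  \<open>D(\<xi>)\<^sup>2 E + |\<xi>|\<^sup>2 (1 - E)\<close>, \<open>E\<close> a projection onto that range, gives a polynomial right inverse
  up to the scalar factor \<open>b \<xi>\<close>.\<close>

lemma elliptic_factor:
  fixes Dh :: "'n::finite \<Rightarrow> complex^'N::finite^'N"
  assumes K: "constant_range Dh" and \<kappa>: "\<kappa> > 0"
    and bound: "\<And>\<xi> e. e \<in> range (\<lambda>x. symbol Dh \<xi> *v x) \<Longrightarrow> \<kappa> * norm \<xi> * norm e \<le> norm (symbol Dh \<xi> *v e)"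
  obtains C :: "real^'n \<Rightarrow> complex^'N^'N" and b A d where
    "\<And>i j. cpoly (\<lambda>\<xi>. C \<xi> $ i $ j)" "cpoly (\<lambda>\<xi>. complex_of_real (b \<xi>))" "\<And>\<xi>. b \<xi> \<ge> 0"
    "A > 0" "\<And>\<xi>. norm \<xi> \<le> A * (1 + b \<xi>)" "\<And>t \<xi>. b (t *\<^sub>R \<xi>) = t ^ d * b \<xi>" "d > 0"
    "\<And>\<xi> v. v \<in> range_span Dh \<Longrightarrow> symbol Dh \<xi> *v (C \<xi> *v v) = complex_of_real (b \<xi>) *s v"
proof -
  let ?V = "range_span Dh"
  obtain E where E: "\<And>x. E *v x \<in> ?V" "\<And>x. x \<in> ?V \<Longrightarrow> E *v x = x"
    by (rule projection_exists[OF subspace_range_span]) (rule that)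
  let ?D = "symbol Dh"
  let ?n = "\<lambda>\<xi>::real^'n. complex_of_real ((norm \<xi>)\<^sup>2)"
  define M where "M \<xi> = (?D \<xi> ** (?D \<xi> ** E)) + mat (?n \<xi>) ** (mat 1 - E)" for \<xi>
  have mat_mult: "mat c *v x = c *s x" for c :: complex and x :: "complex^'N"
    by (simp add: vec_eq_iff matrix_vector_mult_def mat_def if_distrib[of "\<lambda>z. z * _"] cong: if_cong)
  have M: "M \<xi> *v x = ?D \<xi> *v (?D \<xi> *v (E *v x)) + ?n \<xi> *s (x - E *v x)" for \<xi> x
    by (simp only: M_def matrix_vector_mult_add_rdistrib matrix_vector_mul_assoc[symmetric] mat_mult
        matrix_vector_mult_diff_rdistrib vec.scale_one)
  define m where "m \<xi> = det (M \<xi>)" for \<xi>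
  have mat_poly: "cpoly (\<lambda>\<xi>. mat (?n \<xi>) $ i $ j)" for i j :: 'N
    by (cases "i = j") (simp_all add: mat_def cpoly_norm2[simplified] cpoly.const)
  have Mpoly: "cpoly (\<lambda>\<xi>. M \<xi> $ i $ j)" for i j
    unfolding M_def vector_add_component
    by (intro cpoly.add cpoly_matrix_mult cpoly_symbol cpoly.const mat_poly)
  have mpoly: "cpoly m" unfolding m_def by (intro cpoly_det Mpoly)
  have E_proj: "E *v (x - E *v x) = 0" for x
    unfolding matrix_vector_mult_diff_distrib E(2)[OF E(1)] by simp
  \<comment> \<open>For a right-hand side in V, the component \<open>x - E *v x\<close> is a
    multiple of a vector in V, on which \<open>E\<close> is the identity; but \<open>E\<close> kills
    it. Hence x lies in V and \<open>M\<close> acts on it as D(\<xi>)^2.\<close>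
  have key: "?D \<xi> *v (?D \<xi> *v x) = y" "E *v x = x" if Mx: "M \<xi> *v x = y" and y: "y \<in> ?V" and \<xi>: "\<xi> \<noteq> 0" for \<xi> x y
  proof -
    let ?z = "?D \<xi> *v (?D \<xi> *v (E *v x))"
    have "?n \<xi> *s (x - E *v x) = y - ?z" using Mx unfolding M by (simp add: algebra_simps)
    moreover have "y - ?z \<in> ?V"
      by (intro vec.subspace_diff[OF subspace_range_span] y symbol_in_range_span)
    ultimately have "E *v (?n \<xi> *s (x - E *v x)) = ?n \<xi> *s (x - E *v x)" using E(2) by simp
    then have "?n \<xi> *s (x - E *v x) = 0" unfolding vec.scale E_proj by simp
    then show Ex: "E *v x = x" using \<xi> by simp
    with Mx show "?D \<xi> *v (?D \<xi> *v x) = y" unfolding M by simp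
  qed
  have Dinj: "x = 0" if "x \<in> ?V" "?D \<xi> *v x = 0" "\<xi> \<noteq> 0" for \<xi> x
  proof -
    have "x \<in> range (\<lambda>x. ?D \<xi> *v x)" using K that(1,3) by (simp add: constant_range_def)
    from bound[OF this] have "\<kappa> * norm \<xi> * norm x \<le> 0" using that(2) by simp
    moreover have "0 < \<kappa> * norm \<xi>" using \<kappa> that(3) by simp
    ultimately show ?thesis by (metis mult_le_0_iff norm_le_zero_iff not_le)
  qed
  have m_nz: "m \<xi> \<noteq> 0" if \<xi>: "\<xi> \<noteq> 0" for \<xi>
    unfolding m_def
  proof (rule det_nonzero_if_kernel_trivial)
    fix x assume Mx: "M \<xi> *v x = 0"
    note k = key[OF Mx vec.subspace_0[OF subspace_range_span] \<xi>]
    have "?D \<xi> *v x = 0" by (rule Dinj[OF symbol_in_range_span k(1) \<xi>])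
    moreover have "x \<in> ?V" using E(1)[of x] k(2) by simp
    ultimately show "x = 0" using Dinj \<xi> by blast
  qed
  \<comment> \<open>The squared modulus is used because the determinant may be complex while the
    exponentials need a real nonnegative exponent. It is still polynomial, since \<xi> is
    real.\<close>
  define b where "b \<xi> = (norm (m \<xi>))\<^sup>2" for \<xi>
  have b: "complex_of_real (b \<xi>) = m \<xi> * cnj (m \<xi>)" for \<xi>
    unfolding b_def by (rule complex_norm_square)
  \<comment> \<open>One factor D(\<xi>) and the conjugate determinant are put into \<open>C\<close>.
    Applying D(\<xi>) once more completes D(\<xi>)^2 adj M(\<xi>), which is multiplication by
    \<open>m \<xi>\<close> on V.\<close>
  define C where "C \<xi> = mat (cnj (m \<xi>)) ** (?D \<xi> ** adjugate (M \<xi>))" for \<xi>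
  have C: "C \<xi> *v v = cnj (m \<xi>) *s (?D \<xi> *v (adjugate (M \<xi>) *v v))" for \<xi> v
    by (simp only: C_def matrix_vector_mul_assoc[symmetric] mat_mult)
  have D_scale: "?D (t *\<^sub>R \<xi>) *v x = complex_of_real t *s (?D \<xi> *v x)" for t \<xi> x
    by (simp add: vec_eq_iff matrix_vector_mult_def symbol_nth sum_distrib_left sum_distrib_right mult_ac)
  have M_scale: "M (t *\<^sub>R \<xi>) = (\<chi> i j. complex_of_real (t\<^sup>2) * M \<xi> $ i $ j)" for t \<xi>
  proof -
    have "M (t *\<^sub>R \<xi>) *v x = complex_of_real (t\<^sup>2) *s (M \<xi> *v x)" for x
    proof -
      have nn: "?n (t *\<^sub>R \<xi>) = complex_of_real (t\<^sup>2) * ?n \<xi>" by (simp add: power_mult_distrib)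
      show ?thesis unfolding M D_scale vec.scale nn
        by (simp add: vec_eq_iff power2_eq_square algebra_simps)
    qed
    moreover have "(\<chi> i j. complex_of_real (t\<^sup>2) * M \<xi> $ i $ j) *v x = complex_of_real (t\<^sup>2) *s (M \<xi> *v x)" for x
      by (simp add: vec_eq_iff matrix_vector_mult_def sum_distrib_left mult.assoc)
    ultimately show ?thesis by (simp add: matrix_eq)
  qed
  \<comment> \<open>\<open>M\<close> is homogeneous of degree 2, its determinant of degree 2 N, and
    \<open>b\<close> is the square of the modulus of that.\<close>
  have b_scale: "b (t *\<^sub>R \<xi>) = t ^ (4 * CARD('N)) * b \<xi>" for t \<xi>
  proof -
    have "b (t *\<^sub>R \<xi>) = ((t\<^sup>2) ^ CARD('N))\<^sup>2 * b \<xi>"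
      unfolding b_def m_def M_scale det_scale by (simp add: norm_mult norm_power power_mult_distrib)
    also have "((t\<^sup>2) ^ CARD('N))\<^sup>2 = t ^ (4 * CARD('N))"
      by (simp add: power_mult[symmetric] mult.commute)
    finally show ?thesis .
  qed
  \<comment> \<open>The minimum of \<open>b\<close> on the unit sphere is positive, and homogeneity
    spreads this to the growth bound outside the unit ball.\<close>
  have "continuous_on (sphere 0 1) (\<lambda>\<xi>. b \<xi>)"
    unfolding b_def by (intro continuous_intros cpoly_continuous[OF mpoly])
  moreover have "axis undefined 1 \<in> sphere (0 :: real^'n) 1" by simp
  ultimately obtain \<xi>1 where \<xi>1: "\<xi>1 \<in> sphere 0 1" "\<And>\<xi>. \<xi> \<in> sphere 0 1 \<Longrightarrow> b \<xi>1 \<le> b \<xi>"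
    using continuous_attains_inf[OF compact_sphere, of 0 1 b] by blast
  let ?c = "b \<xi>1"
  have "\<xi>1 \<noteq> 0" using \<xi>1(1) by auto
  then have c: "?c > 0" using m_nz[of \<xi>1] by (simp add: b_def)
  have b0: "b \<xi> \<ge> 0" for \<xi> by (simp add: b_def)
  have growth: "norm \<xi> \<le> max 1 (inverse ?c) * (1 + b \<xi>)" for \<xi>
  proof (cases "norm \<xi> \<le> 1")
    case True
    also have "1 \<le> 1 * (1 + b \<xi>)" using b0 by simp
    also have "\<dots> \<le> max 1 (inverse ?c) * (1 + b \<xi>)" using b0 by (intro mult_right_mono) auto
    finally show ?thesis .
  next
    case False
    have nz: "norm \<xi> \<noteq> 0" using False by auto
    have le: "norm \<xi> \<le> norm \<xi> ^ (4 * CARD('N))" using False by (intro self_le_power) auto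
    have "norm \<xi> ^ (4 * CARD('N)) * ?c \<le> norm \<xi> ^ (4 * CARD('N)) * b (\<xi> /\<^sub>R norm \<xi>)"
      using nz by (intro mult_left_mono \<xi>1) simp_all
    also have "norm \<xi> ^ (4 * CARD('N)) * b (\<xi> /\<^sub>R norm \<xi>) = b (norm \<xi> *\<^sub>R (\<xi> /\<^sub>R norm \<xi>))"
      by (rule b_scale[symmetric])
    also have "norm \<xi> *\<^sub>R (\<xi> /\<^sub>R norm \<xi>) = \<xi>" using nz by simp
    finally have "norm \<xi> ^ (4 * CARD('N)) * ?c \<le> b \<xi>" .
    then have "norm \<xi> ^ (4 * CARD('N)) \<le> inverse ?c * b \<xi>"
      using c by (simp add: field_simps)
    also have "\<dots> \<le> max 1 (inverse ?c) * (1 + b \<xi>)"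
      using b0 c by (intro mult_mono) auto
    finally show ?thesis using le by simp
  qed
  show ?thesis
  proof (rule that[of C b "max 1 (inverse ?c)" "4 * CARD('N)"])
    have "cpoly (\<lambda>\<xi>. mat (cnj (m \<xi>)) $ i $ j)" for i j :: 'N
      by (cases "i = j") (simp_all add: mat_def cpoly_cnj mpoly cpoly.const)
    then show "cpoly (\<lambda>\<xi>. C \<xi> $ i $ j)" for i j
      unfolding C_def by (intro cpoly_matrix_mult cpoly_symbol cpoly_adjugate Mpoly)
    show "cpoly (\<lambda>\<xi>. complex_of_real (b \<xi>))" unfolding b by (intro cpoly.mult cpoly_cnj mpoly)
    show "symbol Dh \<xi> *v (C \<xi> *v v) = complex_of_real (b \<xi>) *s v" if v: "v \<in> ?V" for \<xi> v
    proof (cases "\<xi> = 0")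
      case True
      then show ?thesis using b_scale[of 0 0] by (simp add: symbol_mult_vec power_0_left)
    next
      case False
      have "M \<xi> *v (adjugate (M \<xi>) *v v) = m \<xi> *s v"
        unfolding m_def by (rule adjugate_mult(1)) (use m_nz[OF False] in \<open>simp add: m_def\<close>)
      from key(1)[OF this vec.subspace_scale[OF subspace_range_span v] False]
      show ?thesis unfolding C vec.scale b by (simp add: mult.commute)
    qed
  qed (use b0 b_scale growth in auto)
qed

text \<open>The k-th derivative in y of the integral of exp(-\<tau> y) over s \<le> \<tau> \<le> t.
  Indexing by \<open>k\<close> makes the family closed under differentiation, and \<tau> \<ge> s
  gives every member the decay rate s.\<close>

definition exp_average :: "real \<Rightarrow> real \<Rightarrow> nat \<Rightarrow> real \<Rightarrow> real" where
  "exp_average s t k y = integral (cbox s t) (\<lambda>\<tau>. (- \<tau>) ^ k * exp (- \<tau> * y))"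

lemma exp_average_decay:
  assumes s: "0 < s"
  shows "exp_decay (range (exp_average s t))"
proof -
  have cont: "continuous_on A (\<lambda>\<tau>. (- \<tau>) ^ k * exp (- \<tau> * y))" for A k and y :: real
    by (intro continuous_intros)
  have "(exp_average s t k has_real_derivative exp_average s t (Suc k) y) (at y)" for k y
  proof -
    have "((\<lambda>y. integral (cbox s t) (\<lambda>\<tau>. (- \<tau>) ^ k * exp (- \<tau> * y)))
        has_field_derivative integral (cbox s t) (\<lambda>\<tau>. (- \<tau>) ^ Suc k * exp (- \<tau> * y))) (at y within UNIV)"
    proof (rule leibniz_rule_field_derivative)
      show "((\<lambda>y. (- \<tau>) ^ k * exp (- \<tau> * y)) has_field_derivative (- \<tau>) ^ Suc k * exp (- \<tau> * y)) (at y within UNIV)" for y \<tau>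
        by (auto intro!: derivative_eq_intros)
      show "(\<lambda>\<tau>. (- \<tau>) ^ k * exp (- \<tau> * y)) integrable_on cbox s t" for y
        by (intro integrable_continuous cont)
      show "continuous_on (UNIV \<times> cbox s t) (\<lambda>(y, \<tau>). (- \<tau>) ^ Suc k * exp (- \<tau> * y))"
        by (auto simp: case_prod_unfold intro!: continuous_intros)
    qed auto
    then show ?thesis by (simp add: exp_average_def[abs_def])
  qed
  then have "deriv_closed (range (exp_average s t))" unfolding deriv_closed_def by blast
  moreover have "\<exists>C r. r > 0 \<and> (\<forall>y\<ge>0. \<bar>exp_average s t k y\<bar> \<le> C * exp (- r * y))" for k
  proof (rule exI[of _ "\<bar>t\<bar> ^ k * measure lborel (cbox s t)"], rule exI[of _ s], intro conjI allI impI s)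
    fix y :: real assume y: "y \<ge> 0"
    have "norm (exp_average s t k y) \<le> (\<bar>t\<bar> ^ k * exp (- s * y)) * measure lborel (cbox s t)"
    proof (rule has_integral_bound)
      show "((\<lambda>\<tau>. (- \<tau>) ^ k * exp (- \<tau> * y)) has_integral exp_average s t k y) (cbox s t)"
        unfolding exp_average_def by (intro integrable_integral integrable_continuous cont)
      fix \<tau> assume "\<tau> \<in> cbox s t"
      then have \<tau>: "s \<le> \<tau>" "\<tau> \<le> t" by auto
      then have "\<bar>\<tau>\<bar> ^ k \<le> \<bar>t\<bar> ^ k" using s by (intro power_mono) auto
      moreover have "exp (- \<tau> * y) \<le> exp (- s * y)" using \<tau> y by (simp add: mult_right_mono)
      ultimately have "\<bar>\<tau>\<bar> ^ k * exp (- \<tau> * y) \<le> \<bar>t\<bar> ^ k * exp (- s * y)" by (intro mult_mono) auto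
      then show "norm ((- \<tau>) ^ k * exp (- \<tau> * y)) \<le> \<bar>t\<bar> ^ k * exp (- s * y)"
        by (simp add: abs_mult power_abs)
    qed simp
    then show "\<bar>exp_average s t k y\<bar> \<le> \<bar>t\<bar> ^ k * measure lborel (cbox s t) * exp (- s * y)"
      by (simp only: real_norm_def mult_ac)
  qed
  ultimately show ?thesis unfolding exp_decay_def by blast
qed

lemma mult_exp_average:
  assumes "s \<le> t"
  shows "y * exp_average s t 0 y = exp (- s * y) - exp (- t * y)"
proof -
  have "((\<lambda>\<tau>. y * exp (- \<tau> * y)) has_integral (- exp (- t * y)) - (- exp (- s * y))) {s..t}"
    by (rule fundamental_theorem_of_calculus[OF assms])
       (auto intro!: derivative_eq_intros simp flip: has_real_derivative_iff_has_vector_derivative)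
  from integral_unique[OF this] show ?thesis by (simp add: exp_average_def)
qed

lemma ift_dilate:
  fixes h :: "real^'n::finite \<Rightarrow> complex"
  assumes h: "integrable lborel h" and t: "t > 0"
  shows "ift (\<lambda>\<xi>. h (t *\<^sub>R \<xi>)) x = complex_of_real (inverse (t ^ CARD('n))) * ift h (x /\<^sub>R t)"
proof -
  have "ift h (x /\<^sub>R t) = t ^ CARD('n) *\<^sub>R ift (\<lambda>\<xi>. h (t *\<^sub>R \<xi>)) x"
  proof -
    have "(x /\<^sub>R t) \<bullet> (t *\<^sub>R \<xi>) = x \<bullet> \<xi>" for \<xi> using t by simp
    with lborel_affine_integral(2)[OF integrable_mult_cis[OF h, of "x /\<^sub>R t"], of t 0] t show ?thesis
      unfolding ift_def by (simp del: inner_scaleR_left inner_scaleR_right)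
  qed
  then show ?thesis using t by (simp add: scaleR_conv_of_real)
qed

text \<open>Dilating \<open>h\<close> dilates its transform by the inverse factor; the substitution
  y = x - t z removes the resulting power of \<open>t\<close>.\<close>

lemma conv_dilate:
  fixes h :: "real^'n::finite \<Rightarrow> complex"
  assumes h: "schwartz h" and ht: "schwartz (\<lambda>\<xi>. h (t *\<^sub>R \<xi>))" and g: "integrable lborel g" and t: "t > 0"
  shows "conv (ift (\<lambda>\<xi>. h (t *\<^sub>R \<xi>))) g x = dilate_conv (ift h) t g x"
proof -
  have "integrable lborel (\<lambda>y. ift (\<lambda>\<xi>. h (t *\<^sub>R \<xi>)) (x - y) * g y)"
    by (rule conv_integrable(3)[OF ift_integrable[OF ht] ift_norm_le g])
  from lborel_affine_integral(2)[OF this, of "- t" x] t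
  have "conv (ift (\<lambda>\<xi>. h (t *\<^sub>R \<xi>))) g x
      = t ^ CARD('n) *\<^sub>R (LINT z|lborel. ift (\<lambda>\<xi>. h (t *\<^sub>R \<xi>)) (t *\<^sub>R z) * g (x - t *\<^sub>R z))"
    by (simp add: conv_def)
  also have "(LINT z|lborel. ift (\<lambda>\<xi>. h (t *\<^sub>R \<xi>)) (t *\<^sub>R z) * g (x - t *\<^sub>R z))
      = complex_of_real (inverse (t ^ CARD('n))) * dilate_conv (ift h) t g x"
    unfolding ift_dilate[OF schwartzD(3)[OF h] t] dilate_conv_def using t by (simp add: mult.assoc)
  finally show ?thesis using t by (simp add: scaleR_conv_of_real)
qed

text \<open>This is where \<open>p > 1\<close> is used quantitatively: \<open>d powr (p - 1)\<close>
  tends to 0 with \<open>d\<close>. The witness is the solution of d^(p-1) = e / (L + 1).\<close>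

lemma integral_powr_small:
  fixes p L e :: real
  assumes "p > 1" "e > 0" "L \<ge> 0"
  obtains d where "d > 0" "d powr (p - 1) * L < e"
proof -
  let ?a = "e / (L + 1)"
  have a: "?a > 0" using assms by simp
  have eq: "(?a powr (1 / (p - 1))) powr (p - 1) = ?a" using assms a by (simp add: powr_powr)
  have "?a * L < e" using assms by (simp add: field_simps)
  then have "(?a powr (1 / (p - 1))) powr (p - 1) * L < e" unfolding eq .
  moreover have "?a powr (1 / (p - 1)) > 0" by (metis a less_irrefl powr_gt_zero)
  ultimately show ?thesis by (rule that[rotated])
qed

text \<open>As \<open>b\<close> is homogeneous of degree \<open>d\<close>, exp(-t^d b) is the dilate
  by t of exp(-b), so both kernels are rescalings of a single one. The scale \<open>t1\<close>
  recovers \<open>g\<close> uniformly and the scale \<open>t2\<close> contributes a uniformly small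
  term.\<close>

lemma range_dense_scalar:
  fixes Dh :: "'n::finite \<Rightarrow> complex^'N::finite^'N" and g :: "real^'n \<Rightarrow> complex"
  assumes K: "constant_range Dh" and \<kappa>: "\<kappa> > 0"
    and bound: "\<And>\<xi> e. e \<in> range (\<lambda>x. symbol Dh \<xi> *v x) \<Longrightarrow> \<kappa> * norm \<xi> * norm e \<le> norm (symbol Dh \<xi> *v e)"
    and v: "v \<in> range_span Dh" and g: "continuous_on UNIV g" "\<And>x. norm x > R \<Longrightarrow> g x = 0"
    and p: "p > 1" and e: "e > 0"
  shows "\<exists>u f. (u, f) \<in> D_graph Dh p \<and> (LINT x|lborel. norm (g x *s v - f x) powr p) < e"
proof -
  obtain C :: "real^'n \<Rightarrow> complex^'N^'N" and b A d where
    C: "\<And>i j. cpoly (\<lambda>\<xi>. C \<xi> $ i $ j)" and b: "cpoly (\<lambda>\<xi>. complex_of_real (b \<xi>))" "\<And>\<xi>. b \<xi> \<ge> 0"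
    "\<And>\<xi>. norm \<xi> \<le> A * (1 + b \<xi>)" "A > 0" and bs: "\<And>t \<xi>. b (t *\<^sub>R \<xi>) = t ^ d * b \<xi>" "d > 0"
    and Cv: "\<And>\<xi> v. v \<in> range_span Dh \<Longrightarrow> symbol Dh \<xi> *v (C \<xi> *v v) = complex_of_real (b \<xi>) *s v"
    by (rule elliptic_factor[OF K \<kappa> bound]) (assumption, rule that)
  let ?E = "\<lambda>s \<xi>. complex_of_real (1 * exp (- s * b \<xi>))"
  have E: "schwartz (?E s)" if "s > 0" for s
  proof -
    have "(\<lambda>y. 1 * exp (- s * y)) \<in> exp_family" using that unfolding exp_family_def by blast
    from schwartz_exp_decay[OF exp_family_decay b this cpoly.const[of 1]] show ?thesis by simp
  qed
  define k where "k = ift (?E 1)"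
  have k: "integrable lborel k" "k \<in> borel_measurable borel"
    unfolding k_def by (intro ift_integrable ift_measurable E; simp)+
  obtain B where B: "\<And>x. norm (k x) \<le> B" unfolding k_def using ift_norm_le by blast
  \<comment> \<open>By Fourier inversion at frequency 0, where \<open>b\<close> vanishes, this is a
    nonzero constant. Dividing \<open>g\<close> by it normalizes the approximate identity.\<close>
  define c0 where "c0 = (LINT z|lborel. k z)"
  have "b 0 = 0" using bs(1)[of 0 0] zero_power[OF bs(2), where 'a = real] by simp
  then have c0: "c0 \<noteq> 0"
    using fourier_inversion[OF E[of 1], of 0] fourier_const_nz[where 'n = 'n] by (simp add: c0_def k_def)
  define g1 where "g1 x = g x / c0" for x
  have g1: "continuous_on UNIV g1" "\<And>x. norm x > R \<Longrightarrow> g1 x = 0"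
    unfolding g1_def using g c0 by (auto intro!: continuous_intros)
  have gi: "integrable lborel g" "integrable lborel g1"
    by (rule integrable_compact_support[OF g] integrable_compact_support[OF g1], assumption)+
  let ?N = "\<lambda>h. LINT x|lborel. norm (h x)"
  \<comment> \<open>Bounds the L^1 norm of the error at any two scales, so that
    \<open>\<delta>\<close> can be fixed before the scales are chosen.\<close>
  let ?L = "?N g + ?N k * ?N g1 + ?N k * ?N g1"
  have L: "?L * norm v powr p \<ge> 0" by simp
  obtain \<delta> where \<delta>: "\<delta> > 0" "\<delta> powr (p - 1) * (?L * norm v powr p) < e"
    by (rule integral_powr_small[OF p e L]) (rule that)
  have \<delta>2: "\<delta> / 2 > 0" using \<delta> by simp
  obtain t1 where t1: "t1 > 0" "\<And>x. norm (dilate_conv k t1 g1 x - c0 * g1 x) \<le> \<delta> / 2"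
    using dilate_conv_tendsto[OF k(1) g1 \<delta>2] unfolding c0_def by blast
  \<comment> \<open>At least \<open>t1\<close> to orient the interval of averaging, at least 1 so
    that \<open>t2\<close> is at most its n-th power, and large enough for the uniform bound
    \<delta>/2.\<close>
  define t2 where "t2 = max t1 (max 1 (B * ?N g1 / (\<delta> / 2)))"
  have t2: "t2 > 0" "t2 \<ge> t1" "t2 \<ge> 1" "B * ?N g1 / (\<delta> / 2) \<le> t2" by (auto simp: t2_def)
  have small: "norm (dilate_conv k t2 g1 x) \<le> \<delta> / 2" for x
  proof -
    have "norm (dilate_conv k t2 g1 x) \<le> B * ?N g1 / t2 ^ CARD('n)"
      by (rule dilate_conv_small[OF k(2) B gi(2) t2(1)])
    also have "B * ?N g1 \<le> \<delta> / 2 * t2" using t2(4) \<delta> by (simp add: field_simps)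
    then have "B * ?N g1 / t2 ^ CARD('n) \<le> \<delta> / 2 * t2 / t2 ^ CARD('n)"
      using t2(1) by (intro divide_right_mono) auto
    also have "\<dots> \<le> \<delta> / 2"
      using self_le_power[OF t2(3), of "CARD('n)"] t2(1) \<delta>(1) by (simp add: field_simps)
    finally show ?thesis .
  qed
  define err where "err x = g x - (dilate_conv k t1 g1 x - dilate_conv k t2 g1 x)" for x
  have err_le: "norm (err x) \<le> \<delta>" for x
  proof -
    have "err x = dilate_conv k t2 g1 x - (dilate_conv k t1 g1 x - c0 * g1 x)"
      using c0 by (simp add: err_def g1_def)
    then show ?thesis
      using norm_triangle_ineq4[of "dilate_conv k t2 g1 x" "dilate_conv k t1 g1 x - c0 * g1 x"] t1(2)[of x] small[of x] by simp
  qed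
  note di = dilate_conv_integrable[OF k(1) gi(2)]
  have erri: "integrable lborel err" unfolding err_def using gi(1) di(1) by simp
  have "?N err \<le> (LINT x|lborel. norm (g x) + norm (dilate_conv k t1 g1 x) + norm (dilate_conv k t2 g1 x))"
  proof (rule integral_mono)
    fix x show "norm (err x) \<le> norm (g x) + norm (dilate_conv k t1 g1 x) + norm (dilate_conv k t2 g1 x)"
      unfolding err_def using norm_triangle_ineq4[of "g x" "dilate_conv k t1 g1 x - dilate_conv k t2 g1 x"]
        norm_triangle_ineq4[of "dilate_conv k t1 g1 x" "dilate_conv k t2 g1 x"] by linarith
  qed (use erri gi(1) di(1) in auto)
  also have "\<dots> = ?N g + ?N (dilate_conv k t1 g1) + ?N (dilate_conv k t2 g1)" using gi(1) di(1) by simp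
  also have "\<dots> \<le> ?L" by (intro add_mono di(2) order_refl)
  finally have errL: "?N err \<le> ?L" .
  have int_err: "(LINT x|lborel. norm (err x) powr p) \<le> \<delta> powr (p - 1) * ?L"
    using integrable_powr_bounded(2)[OF erri err_le] p errL \<delta>
    by (meson less_imp_le mult_left_mono order_trans powr_ge_zero)
  \<comment> \<open>Frequency side of the potential u: the symbol turns C(\<xi>) v into b(\<xi>) v,
    and b times the average is the difference of the two exponentials.\<close>
  let ?h = "\<lambda>l \<xi>. (C \<xi> *v v) $ l * complex_of_real (exp_average (t1 ^ d) (t2 ^ d) 0 (b \<xi>))"
  have h: "schwartz (?h l)" for l
  proof (rule schwartz_exp_decay[OF exp_average_decay[of "t1 ^ d" "t2 ^ d"] b])
    show "cpoly (\<lambda>\<xi>. (C \<xi> *v v) $ l)"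
      unfolding matrix_vector_mult_def vec_lambda_beta by (intro cpoly_sum cpoly.mult C cpoly.const)
  qed (use t1 in auto)
  have E_t: "?E (t ^ d) = (\<lambda>\<xi>. ?E 1 (t *\<^sub>R \<xi>))" for t by (simp add: bs)
  have conv_t: "conv (ift (?E (t ^ d))) g1 x = dilate_conv k t g1 x" if "t > 0" for t x
    unfolding E_t k_def by (rule conv_dilate[OF E _ gi(2) that]) (rule zero_less_one, use E[OF zero_less_power[OF that], of d] in \<open>simp add: bs\<close>)
  have sym_h: "(\<Sum>m\<in>UNIV. symbol Dh \<xi> $ l $ m * ?h m \<xi>) = v $ l * (?E (t1 ^ d) \<xi> + - 1 * ?E (t2 ^ d) \<xi>)" for l \<xi>
  proof -
    let ?\<Phi> = "exp_average (t1 ^ d) (t2 ^ d) 0 (b \<xi>)"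
    have le: "t1 ^ d \<le> t2 ^ d" using t1 t2 by (intro power_mono) auto
    have "(\<Sum>m\<in>UNIV. symbol Dh \<xi> $ l $ m * ?h m \<xi>) = (symbol Dh \<xi> *v (C \<xi> *v v)) $ l * complex_of_real ?\<Phi>"
      by (simp only: matrix_vector_mult_def[of "symbol Dh \<xi>"] vec_lambda_beta sum_distrib_right mult.assoc)
    also have "\<dots> = v $ l * complex_of_real (b \<xi> * ?\<Phi>)" unfolding Cv[OF v] by simp
    also have "b \<xi> * ?\<Phi> = exp (- (t1 ^ d) * b \<xi>) - exp (- (t2 ^ d) * b \<xi>)" by (rule mult_exp_average[OF le])
    finally show ?thesis by simp
  qed
  have sE: "schwartz (?E (t1 ^ d))" "schwartz (?E (t2 ^ d))" 
    by (rule E[OF zero_less_power[OF t1(1)]], rule E[OF zero_less_power[OF t2(1)]])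
  have "conv (ift (\<lambda>\<xi>. \<Sum>m\<in>UNIV. symbol Dh \<xi> $ l $ m * ?h m \<xi>)) g1 x = v $ l * (g x - err x)" for l x
  proof -
    have "conv (ift (\<lambda>\<xi>. \<Sum>m\<in>UNIV. symbol Dh \<xi> $ l $ m * ?h m \<xi>)) g1 x
        = v $ l * (conv (ift (?E (t1 ^ d))) g1 x + - 1 * conv (ift (?E (t2 ^ d))) g1 x)"
      unfolding sym_h
      by (simp only: conv_linear[OF schwartz_add[OF sE(1) schwartz_cmult[OF sE(2)]] sE(1) gi(2)]
          conv_linear(1)[OF sE(1) schwartz_cmult[OF sE(2)] gi(2)] conv_linear(2)[OF sE(2) sE(2) gi(2)])
    then show ?thesis unfolding conv_t[OF t1(1)] conv_t[OF t2(1)] by (simp add: err_def)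
  qed
  then have mem: "(\<lambda>x. \<chi> l. conv (ift (?h l)) g1 x, \<lambda>x. \<chi> l. v $ l * (g x - err x)) \<in> D_graph Dh p"
    using D_graph_conv[where h = ?h and Dh = Dh and p = p, OF h gi(2)] p by simp
  have "g x *s v - (\<chi> l. v $ l * (g x - err x)) = err x *s v" for x
    by (simp add: vec_eq_iff algebra_simps)
  then have "(LINT x|lborel. norm (g x *s v - (\<chi> l. v $ l * (g x - err x))) powr p) = norm v powr p * (LINT x|lborel. norm (err x) powr p)"
    by (simp add: norm_smult_vec powr_mult mult.commute)
  also have "\<dots> \<le> norm v powr p * (\<delta> powr (p - 1) * ?L)" by (intro mult_left_mono int_err) simp
  also have "\<dots> < e" using \<delta>(2) by (simp only: mult_ac)
  finally show ?thesis using mem by blast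
qed

section \<open>From scalar approximations to all V-valued functions\<close>

lemma Range_D_graph: "Range (D_graph Dh p) \<subseteq> Lp p"
  by (auto simp: D_graph_def)

lemma D_graph_add:
  assumes "(u, f) \<in> D_graph Dh p" "(u', f') \<in> D_graph Dh p" and p: "p \<ge> 1"
  shows "(\<lambda>x. u x + u' x, \<lambda>x. f x + f' x) \<in> D_graph Dh p"
proof -
  have Lp: "u \<in> Lp p" "f \<in> Lp p" "u' \<in> Lp p" "f' \<in> Lp p" using assms by (auto simp: D_graph_def)
  have sum: "(\<lambda>x. u x + u' x) \<in> Lp p" "(\<lambda>x. f x + f' x) \<in> Lp p" using Lp p by (auto intro!: Lp_add)
  have "weak_D Dh (\<lambda>x. u x + u' x) (\<lambda>x. f x + f' x)"
    unfolding weak_D_components[OF sum p]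
    using Lp_test_integrable(1)[OF Lp(1) p test_function_partial_deriv] Lp_test_integrable(1)[OF Lp(2) p]
      Lp_test_integrable(1)[OF Lp(3) p test_function_partial_deriv] Lp_test_integrable(1)[OF Lp(4) p]
      D_graph_components[OF assms(1) p] D_graph_components[OF assms(2) p]
    by (simp add: distrib_left sum.distrib)
  then show ?thesis using sum by (simp add: D_graph_def)
qed

lemma D_graph_zero: "p \<ge> 1 \<Longrightarrow> (\<lambda>x. 0, \<lambda>x. 0) \<in> D_graph Dh p"
  by (simp add: D_graph_def Lp_def weak_D_def)

lemma closed_range_sum:
  assumes "finite I" "\<And>i. i \<in> I \<Longrightarrow> f i \<in> closed_range Dh p" "p > 1"
  shows "(\<lambda>x. \<Sum>i\<in>I. f i x) \<in> closed_range Dh p"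
  using assms
proof (induction I rule: finite_induct)
  case empty
  have "(\<lambda>x. 0) \<in> Range (D_graph Dh p)" using D_graph_zero[of p Dh] empty by auto
  then show ?case using empty
    unfolding closed_range_def Lp_closure_iff[OF order.strict_trans[OF zero_less_one \<open>p > 1\<close>]]
    by (auto intro!: bexI[of _ "\<lambda>x. 0"] simp: Lp_def)
next
  case (insert i I)
  have add: "(\<lambda>x. f x + g x) \<in> Range (D_graph Dh p)"
    if f: "f \<in> Range (D_graph Dh p)" and g: "g \<in> Range (D_graph Dh p)" for f g
  proof -
    from f g obtain u u' where "(u, f) \<in> D_graph Dh p" "(u', g) \<in> D_graph Dh p" by (elim RangeE)
    from RangeI[OF D_graph_add[OF this]] \<open>p > 1\<close> show ?thesis by simp
  qed
  have "f i \<in> closed_range Dh p" "(\<lambda>x. \<Sum>i\<in>I. f i x) \<in> closed_range Dh p" "p > 0"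
    using insert.prems insert.IH by auto
  then have "(\<lambda>x. f i x + (\<Sum>i\<in>I. f i x)) \<in> closed_range Dh p"
    unfolding closed_range_def by (intro Lp_closure_add add Range_D_graph)
  then show ?case unfolding sum.insert[OF insert.hyps] .
qed

text \<open>Density of the compactly supported continuous functions removes the regularity of the
  scalar factor.\<close>

lemma closed_range_smult:
  fixes Dh :: "'n::finite \<Rightarrow> complex^'N::finite^'N" and g :: "real^'n \<Rightarrow> complex"
  assumes K: "constant_range Dh" and \<kappa>: "\<kappa> > 0"
    and bound: "\<And>\<xi> e. e \<in> range (\<lambda>x. symbol Dh \<xi> *v x) \<Longrightarrow> \<kappa> * norm \<xi> * norm e \<le> norm (symbol Dh \<xi> *v e)"
    and v: "v \<in> range_span Dh" and p: "p > 1"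
    and g: "g \<in> borel_measurable borel" "integrable lborel (\<lambda>x. norm (g x) powr p)"
  shows "(\<lambda>x. g x *s v) \<in> closed_range Dh p"
proof -
  have p0: "p > 0" using p by simp
  note [measurable] = g(1)
  have m: "(\<lambda>x. h x *s v) \<in> borel_measurable borel" if "h \<in> borel_measurable borel" for h :: "real^'n \<Rightarrow> complex"
    by (rule vec_measurableI) (use that in simp)
  have gv: "(\<lambda>x. g x *s v) \<in> Lp p"
    using g m[OF g(1)] by (simp add: Lp_def norm_smult_vec powr_mult)
  show ?thesis
    unfolding closed_range_def Lp_closure_iff[OF p0]
  proof (intro conjI gv allI impI)
    fix e :: real assume e: "e > 0"
    define d where "d = e / (2 powr p * 2)"
    have d: "d > 0" "2 powr p * (d + d) = e" using e by (auto simp: d_def)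
    let ?d = "d / (norm v powr p + 1)"
    have np: "norm v powr p + 1 > 0" by (rule add_nonneg_pos) auto
    have "?d > 0" using d np by simp
    then obtain h R where h: "continuous_on UNIV h" "\<And>x. norm x > R \<Longrightarrow> h x = 0"
      "integrable lborel (\<lambda>x. norm (g x - h x) powr p)" "(LINT x|lborel. norm (g x - h x) powr p) < ?d"
      by (rule continuous_dense_Lp[OF g p0]) (rule that)
    obtain u f where uf: "(u, f) \<in> D_graph Dh p" "(LINT x|lborel. norm (h x *s v - f x) powr p) < d"
      using range_dense_scalar[OF K \<kappa> bound v h(1,2) p d(1)] by blast
    have [measurable]: "h \<in> borel_measurable borel" by (rule borel_measurable_continuous_onI[OF h(1)])
    have eqn: "norm ((g x - h x) *s v) powr p = norm (g x - h x) powr p * norm v powr p" for x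
      unfolding norm_smult_vec by (simp add: powr_mult)
    have i1: "integrable lborel (\<lambda>x. norm ((g x - h x) *s v) powr p)"
      and l1: "(LINT x|lborel. norm ((g x - h x) *s v) powr p) < d"
    proof -
      show "integrable lborel (\<lambda>x. norm ((g x - h x) *s v) powr p)"
        unfolding eqn using h(3) by simp
      have "(LINT x|lborel. norm ((g x - h x) *s v) powr p) = (LINT x|lborel. norm (g x - h x) powr p) * norm v powr p"
        unfolding eqn by simp
      also have "\<dots> \<le> ?d * norm v powr p" using h(4) by (intro mult_right_mono) auto
      also have "\<dots> < d" using d np by (simp add: field_simps)
      finally show "(LINT x|lborel. norm ((g x - h x) *s v) powr p) < d" .
    qed
    have fL: "f \<in> Lp p" using uf by (simp add: D_graph_def)
    have hL: "(\<lambda>x. h x *s v) \<in> Lp p"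
    proof -
      have "(\<lambda>x. g x *s v - (g x - h x) *s v) \<in> Lp p"
        by (rule Lp_diff[OF gv _ p0]) (use i1 m[of "\<lambda>x. g x - h x"] in \<open>simp add: Lp_def\<close>)
      then show ?thesis by (simp add: vec.scale_left_diff_distrib)
    qed
    note hf = LpD[OF Lp_diff[OF hL fL p0]]
    have eq: "g x *s v - f x = (g x - h x) *s v + (h x *s v - f x)" for x
      by (simp add: vec.scale_left_diff_distrib)
    have "(LINT x|lborel. norm (g x *s v - f x) powr p) \<le> 2 powr p *
        ((LINT x|lborel. norm ((g x - h x) *s v) powr p) + (LINT x|lborel. norm (h x *s v - f x) powr p))"
      unfolding eq by (rule integrable_powr_add(2)[OF _ _ i1 hf(2) p0]) (use hf m[of "\<lambda>x. g x - h x"] in auto)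
    also have "\<dots> < 2 powr p * (d + d)" using l1 uf(2) by (intro mult_strict_left_mono add_strict_mono) auto
    finally have "(LINT x|lborel. norm (g x *s v - f x) powr p) < e" unfolding d(2) .
    then show "\<exists>f\<in>Range (D_graph Dh p). (LINT x|lborel. norm (g x *s v - f x) powr p) < e"
      using uf(1) by (intro bexI[of _ f]) auto
  qed
qed

text \<open>Almost everywhere f = E f, the sum of the components f_k times the fixed vectors E e_k
  of V, so scalar factors suffice. Changing a function on a null set does not affect its distance to
  the range.\<close>

lemma closed_range_if_in_range_span:
  fixes Dh :: "'n::finite \<Rightarrow> complex^'N::finite^'N"
  assumes K: "constant_range Dh" and \<kappa>: "\<kappa> > 0"
    and bound: "\<And>\<xi> e. e \<in> range (\<lambda>x. symbol Dh \<xi> *v x) \<Longrightarrow> \<kappa> * norm \<xi> * norm e \<le> norm (symbol Dh \<xi> *v e)"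
    and p: "p > 1" and f: "f \<in> Lp p" "AE x in lborel. f x \<in> range_span Dh"
  shows "f \<in> closed_range Dh p"
proof -
  have p0: "p > 0" using p by simp
  obtain E where E: "\<And>x. E *v x \<in> range_span Dh" "\<And>x. x \<in> range_span Dh \<Longrightarrow> E *v x = x"
    by (rule projection_exists[OF subspace_range_span]) (rule that)
  let ?g = "\<lambda>x. \<Sum>k\<in>UNIV. f x $ k *s (E *v axis k 1)"
  have g: "?g \<in> closed_range Dh p"
    by (rule closed_range_sum[OF finite closed_range_smult[OF K \<kappa> bound E(1) p Lp_nth[OF f(1) p0]] p])
  have gE: "?g x = E *v f x" for x
    by (simp add: vec_eq_iff matrix_vector_mult_def axis_def sum_component if_distrib mult.commute cong: if_cong)
  have ae: "AE x in lborel. f x = ?g x"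
    using f(2) by eventually_elim (simp add: gE E(2))
  show ?thesis
    unfolding closed_range_def Lp_closure_iff[OF p0]
  proof (intro conjI f(1) allI impI)
    fix e :: real assume "e > 0"
    then obtain u where u: "u \<in> Range (D_graph Dh p)" "(LINT x|lborel. norm (?g x - u x) powr p) < e"
      using g unfolding closed_range_def Lp_closure_iff[OF p0] by blast
    have "u \<in> Lp p" using u(1) Range_D_graph by blast
    have "?g \<in> Lp p" using g by (simp add: closed_range_def Lp_closure_def)
    have "(LINT x|lborel. norm (f x - u x) powr p) = (LINT x|lborel. norm (?g x - u x) powr p)"
    proof (rule integral_cong_AE)
      show "(\<lambda>x. norm (f x - u x) powr p) \<in> borel_measurable lborel"
        using LpD(2)[OF Lp_diff[OF f(1) \<open>u \<in> Lp p\<close> p0]] by auto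
      show "(\<lambda>x. norm (?g x - u x) powr p) \<in> borel_measurable lborel"
        using LpD(2)[OF Lp_diff[OF \<open>?g \<in> Lp p\<close> \<open>u \<in> Lp p\<close> p0]] by auto
      show "AE x in lborel. norm (f x - u x) powr p = norm (?g x - u x) powr p"
        using ae by eventually_elim simp
    qed
    then show "\<exists>u\<in>Range (D_graph Dh p). (LINT x|lborel. norm (f x - u x) powr p) < e"
      using u by (intro bexI[of _ u]) (simp_all only:)
  qed
qed

section \<open>The closed range and the null space of the adjoint\<close>

lemma bounded_linear_matrix: "bounded_linear ((*v) (E :: complex^'N::finite^'M::finite))"
  unfolding linear_conv_bounded_linear[symmetric]
  by (rule linearI) (simp_all add: vec_eq_iff matrix_vector_mult_def distrib_left sum.distrib scaleR_sum_right)

lemma bounded_linear_cinner: "bounded_linear (cinner v)"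
  unfolding linear_conv_bounded_linear[symmetric]
  by (rule linearI) (simp_all add: cinner_def distrib_left sum.distrib scaleR_sum_right)

lemma Lp_matrix:
  assumes "f \<in> Lp p" "p > 0"
  shows "(\<lambda>x. E *v f x) \<in> Lp p"
proof -
  obtain C where C: "\<And>x. norm (E *v x) \<le> norm x * C"
    using bounded_linear.bounded[OF bounded_linear_matrix] by blast
  have "(\<lambda>x. E *v f x) \<in> borel_measurable borel"
    by (rule vec_measurableI, unfold matrix_vector_mult_def vec_lambda_beta)
       (intro borel_measurable_sum borel_measurable_times borel_measurable_const nth_measurable[OF LpD(1)[OF assms(1)]])
  from Lp_bound(1)[OF assms(1) this assms(2), of C] C show ?thesis by (simp add: mult.commute)
qed

lemma Lp_cutoff:
  assumes u: "u \<in> Lp p" and p: "p > 0" and \<zeta>: "\<zeta> \<in> borel_measurable borel" "\<And>x. norm (\<zeta> x) \<le> B"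
  shows "(\<lambda>x. \<zeta> x *s u x) \<in> Lp p"
proof (rule Lp_bound(1)[OF u _ p])
  show "(\<lambda>x. \<zeta> x *s u x) \<in> borel_measurable borel"
    by (rule vec_measurableI, unfold vector_smult_component)
       (intro borel_measurable_times \<zeta>(1) nth_measurable[OF LpD(1)[OF u]])
  show "norm (\<zeta> x *s u x) \<le> B * norm (u x)" for x
    using \<zeta>(2)[of x] by (simp add: norm_smult_vec mult_right_mono)
qed

lemma Lp_ball:
  "(\<lambda>x. indicator (ball c r) x *s (v :: complex^'N::finite)) \<in> Lp p" if "p \<ge> 1" for c :: "real^'n::finite"
proof (rule Lp_vecI[OF _ _ that])
  fix k
  have "integrable lborel (\<lambda>x. complex_of_real (indicator (ball c r) x))"
    using emeasure_bounded_finite[of "ball c r"]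
    unfolding complex_of_real_integrable_eq by (simp add: integrable_indicator_iff)
  moreover have "complex_of_real (indicator (ball c r) x) = indicator (ball c r) x" for x
    by (simp add: indicator_def)
  ultimately show "integrable lborel (\<lambda>x. (indicator (ball c r) x *s v) $ k)" by simp
  show "norm ((indicator (ball c r) x *s v) $ k) \<le> norm v" for x
    using Finite_Cartesian_Product.norm_nth_le[of v k] by (auto simp: indicator_def)
qed

lemma ball_integrable:
  assumes f: "f \<in> Lp p" and p: "p \<ge> 1"
  shows "integrable lborel (\<lambda>x. indicator (ball c r) x *\<^sub>R f x)"
  by (rule locally_integrable[OF LpD[OF f] p]) auto

lemma in_closed_range: "f \<in> Range (D_graph Dh p) \<Longrightarrow> p > 0 \<Longrightarrow> f \<in> closed_range Dh p"
  unfolding closed_range_def Lp_closure_iff using Range_D_graph by (auto intro!: bexI[of _ f])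

lemma integral_in_range_span:
  assumes uf: "(u, f) \<in> D_graph Dh p" and p: "p \<ge> 1" and \<phi>: "test_function \<phi>"
  shows "(LINT x|lborel. \<phi> x *s f x) \<in> range_span Dh"
proof -
  have "weak_D Dh u f" using uf by (simp add: D_graph_def)
  then show ?thesis unfolding weak_D_def using \<phi>
    by (auto intro!: vec.subspace_scale[OF subspace_range_span] vec.subspace_sum[OF subspace_range_span] range_span_base)
qed

text \<open>The kernel of P = 1 - E is V. For g = Du the weak equation puts every test integral of g
  into V, so P g has vanishing test integrals and is zero; boundedness of P carries this to limits
  in L^p.\<close>

lemma closed_range_AE_range_span:
  fixes Dh :: "'n::finite \<Rightarrow> complex^'N::finite^'N"
  assumes f: "f \<in> closed_range Dh p" and p: "p > 1"
  shows "AE x in lborel. f x \<in> range_span Dh"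
proof -
  have p0: "p > 0" and p1: "p \<ge> 1" using p by auto
  obtain E where E: "\<And>x. E *v x \<in> range_span Dh" "\<And>x. x \<in> range_span Dh \<Longrightarrow> E *v x = x"
    by (rule projection_exists[OF subspace_range_span]) (rule that)
  define P where "P = mat 1 - E"
  have P: "P *v x = x - E *v x" for x by (simp add: P_def matrix_vector_mult_diff_rdistrib)
  have range: "AE x in lborel. P *v g x = 0" if ug: "(u, g) \<in> D_graph Dh p" for u g
  proof -
    have g: "g \<in> Lp p" using ug by (simp add: D_graph_def)
    note Pg = Lp_matrix[OF g p0, of P]
    have "AE x in lborel. (P *v g x) $ k = 0" for k
    proof (rule fundamental_lemma)
      show "(\<lambda>x. (P *v g x) $ k) \<in> borel_measurable borel" by (rule Lp_nth(1)[OF Pg p0])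
      show "integrable lborel (\<lambda>x. indicator (box a b) x *\<^sub>R (P *v g x) $ k)" for a b
        by (rule locally_integrable[OF Lp_nth[OF Pg p0] p1]) auto
      fix \<phi> :: "real^'n \<Rightarrow> complex" assume \<phi>: "test_function \<phi>"
      note int = Lp_test_integrable(2)[OF g p1 \<phi>]
      have "(LINT x|lborel. \<phi> x * (P *v g x) $ k) = (LINT x|lborel. P *v (\<phi> x *s g x)) $ k"
        by (subst integral_nth[OF integrable_bounded_linear[OF bounded_linear_matrix int]]) (simp add: vec.scale)
      also have "(LINT x|lborel. P *v (\<phi> x *s g x)) = P *v (LINT x|lborel. \<phi> x *s g x)"
        by (rule integral_bounded_linear[OF bounded_linear_matrix int])
      also have "\<dots> = 0" using E(2)[OF integral_in_range_span[OF ug p1 \<phi>]] by (simp add: P)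
      finally show "(LINT x|lborel. \<phi> x * (P *v g x) $ k) = 0" by simp
    qed
    then have "AE x in lborel. \<forall>k. (P *v g x) $ k = 0" by (simp add: AE_all_countable)
    then show ?thesis by eventually_elim (simp add: vec_eq_iff)
  qed
  have fL: "f \<in> Lp p" using f by (simp add: closed_range_def Lp_closure_def)
  note Pf = Lp_matrix[OF fL p0, of P]
  obtain C where C: "\<And>x. norm (P *v x) \<le> norm x * C"
    using bounded_linear.bounded[OF bounded_linear_matrix] by blast
  let ?I = "LINT x|lborel. norm (P *v f x) powr p"
  have "?I \<le> 0"
  proof (rule field_le_epsilon)
    fix e :: real assume e: "e > 0"
    let ?K = "\<bar>C\<bar> powr p + 1"
    have K: "?K > 0" by (rule add_nonneg_pos) auto
    then have "e / ?K > 0" using e by simp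
    then obtain u g where ug: "(u, g) \<in> D_graph Dh p" "(LINT x|lborel. norm (f x - g x) powr p) < e / ?K"
      using f unfolding closed_range_def Lp_closure_iff[OF p0] by blast
    have gL: "g \<in> Lp p" using ug by (simp add: D_graph_def)
    note d = Lp_diff[OF fL gL p0]
    have "?I = (LINT x|lborel. norm (P *v (f x - g x)) powr p)"
    proof (rule integral_cong_AE)
      show "(\<lambda>x. norm (P *v f x) powr p) \<in> borel_measurable lborel"
        "(\<lambda>x. norm (P *v (f x - g x)) powr p) \<in> borel_measurable lborel"
        using LpD(2)[OF Pf] LpD(2)[OF Lp_matrix[OF d p0, of P]] by auto
      show "AE x in lborel. norm (P *v f x) powr p = norm (P *v (f x - g x)) powr p"
        using range[OF ug(1)] by eventually_elim (simp add: matrix_vector_mult_diff_distrib)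
    qed
    also have "\<dots> \<le> \<bar>C\<bar> powr p * (LINT x|lborel. norm (f x - g x) powr p)"
      by (rule Lp_bound(2)[OF d LpD(1)[OF Lp_matrix[OF d p0]] p0]) (use C in \<open>simp add: mult.commute\<close>)
    also have "\<dots> \<le> ?K * (e / ?K)" using ug(2) by (intro mult_mono) auto
    also have "\<dots> = e" using K by simp
    finally show "?I \<le> 0 + e" by simp
  qed
  then have "?I = 0" by (intro antisym) auto
  then have "AE x in lborel. norm (P *v f x) powr p = 0"
    using integral_nonneg_eq_0_iff_AE[OF LpD(2)[OF Pf]] by simp
  then show ?thesis
  proof eventually_elim
    fix x assume "norm (P *v f x) powr p = 0"
    then have "f x = E *v f x" by (simp add: P)
    then show "f x \<in> range_span Dh" using E(1)[of "f x"] by simp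
  qed
qed

text \<open>By definition the pairing vanishes on the range itself. For a limit of the range, the
  approximation error goes to 0 with \<open>d\<close> fixed, and then \<open>d\<close> goes to
  0.\<close>

lemma null_adjoint_pairing:
  assumes w: "w \<in> null_adjoint Dh p" and f: "f \<in> closed_range Dh p" and p: "p > 1"
  shows "(LINT x|lborel. cinner (f x) (w x)) = 0"
proof -
  have p0: "p > 0" using p by simp
  have wL: "w \<in> Lp (conj_exp p)" using w by (simp add: null_adjoint_def adjoint_graph_def)
  have fL: "f \<in> Lp p" using f by (simp add: closed_range_def Lp_closure_def)
  have range: "(LINT x|lborel. cinner (g x) (w x)) = 0" if "(u, g) \<in> D_graph Dh p" for u g
    using w that by (auto simp: null_adjoint_def adjoint_graph_def cinner_def)
  let ?X = "norm (LINT x|lborel. cinner (f x) (w x))" and ?N = "real CARD('b)"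
  let ?W = "LINT x|lborel. norm (w x) powr conj_exp p"
  have "?X \<le> ?N * (d powr conj_exp p * ?W)" if d: "d > 0" for d
  proof (rule field_le_epsilon)
    fix e :: real assume e: "e > 0"
    let ?e = "e / (?N * d powr (- p))"
    have N: "?N * d powr (- p) > 0" using d by simp
    then have "?e > 0" using e by simp
    then obtain u g where ug: "(u, g) \<in> D_graph Dh p" "(LINT x|lborel. norm (f x - g x) powr p) < ?e"
      using f unfolding closed_range_def Lp_closure_iff[OF p0] by blast
    have gL: "g \<in> Lp p" using ug by (simp add: D_graph_def)
    note dL = Lp_diff[OF fL gL p0]
    note i = cinner_Lp_integrable[OF dL wL p] cinner_Lp_integrable[OF fL wL p] cinner_Lp_integrable[OF gL wL p]
    have "(LINT x|lborel. cinner (f x - g x) (w x)) = (LINT x|lborel. cinner (f x) (w x)) - (LINT x|lborel. cinner (g x) (w x))"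
      using i(4,6) by (simp add: cinner_def left_diff_distrib sum_subtractf)
    then have "?X = norm (LINT x|lborel. cinner (f x - g x) (w x))" using range[OF ug(1)] by simp
    also have "\<dots> \<le> (LINT x|lborel. ?N * (norm (f x - g x) * norm (w x)))"
      by (rule Bochner_Integration.integral_norm_bound_integral[OF i(2) integrable_mult_right[OF i(1)] cinner_norm_le])
    also have "\<dots> = ?N * (LINT x|lborel. norm (f x - g x) * norm (w x))" by simp
    also have "\<dots> \<le> ?N * (d powr (- p) * (LINT x|lborel. norm (f x - g x) powr p) + d powr conj_exp p * ?W)"
      using LpD[OF dL] LpD[OF wL] p d by (intro mult_left_mono integrable_mult_Lp(2)) auto
    also have "\<dots> \<le> ?N * (d powr (- p) * ?e + d powr conj_exp p * ?W)"
      using ug(2) by (intro mult_left_mono add_right_mono) auto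
    also have "\<dots> = ?N * (d powr conj_exp p * ?W) + e" using d by (simp add: field_simps)
    finally show "?X \<le> ?N * (d powr conj_exp p * ?W) + e" .
  qed note le = this
  have "?X \<le> 0"
  proof (rule field_le_epsilon)
    fix e :: real assume e: "e > 0"
    \<comment> \<open>The exponent is shifted by 1 because \<open>integral_powr_small\<close>
      delivers smallness of the power with exponent one less.\<close>
    have "1 < conj_exp p + 1" "0 \<le> ?N * ?W" using conj_exp_gt_1[OF p] by auto
    then obtain d where d: "d > 0" "d powr (conj_exp p + 1 - 1) * (?N * ?W) < e"
      by (rule integral_powr_small[OF _ e]) (rule that)
    then show "?X \<le> 0 + e" using le[OF d(1)] by (simp add: mult_ac)
  qed
  then show ?thesis by simp
qed

section \<open>Spaces of averages\<close>

text \<open>A projection \<open>P\<close> with kernel \<open>S\<close> commutes with the integral,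
  so P f is continuous with vanishing ball integrals.\<close>

lemma average_in_subspace:
  fixes S :: "(complex^'N::finite) set" and f :: "real^'n::finite \<Rightarrow> complex^'N"
  assumes S: "vec.subspace S" and c: "\<And>k. continuous_on UNIV (\<lambda>x. f x $ k)" and i: "\<And>c r. integrable lborel (\<lambda>x. indicator (ball c r) x *\<^sub>R f x)"
    and avg: "\<And>c r. r > 0 \<Longrightarrow> (1 / measure lborel (ball c r)) *\<^sub>R (LINT x:ball c r|lborel. f x) \<in> S"
  shows "f x \<in> S"
proof -
  obtain E where E: "\<And>x. E *v x \<in> S" "\<And>x. x \<in> S \<Longrightarrow> E *v x = x"
    by (rule projection_exists[OF S]) (rule that)
  define P where "P = mat 1 - E"
  have P: "P *v x = x - E *v x" for x by (simp add: P_def matrix_vector_mult_diff_rdistrib)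
  have "(P *v f x) $ k = 0" for k
  proof (rule continuous_zero_if_ball_integrals_zero)
    show "continuous_on UNIV (\<lambda>x. (P *v f x) $ k)"
      unfolding matrix_vector_mult_def vec_lambda_beta by (intro continuous_intros c)
    fix c :: "real^'n" and r :: real assume r: "r > 0"
    let ?I = "LINT x|lborel. indicator (ball c r) x *\<^sub>R f x"
    have m: "measure lborel (ball c r) \<noteq> 0" using content_ball_pos[OF r, of c] by simp
    have "P *v ((1 / measure lborel (ball c r)) *\<^sub>R ?I) = 0"
      using E(2)[OF avg[OF r]] by (simp add: P set_lebesgue_integral_def)
    then have "(1 / measure lborel (ball c r)) *\<^sub>R (P *v ?I) = 0"
      by (simp only: linear_scale[OF bounded_linear.linear[OF bounded_linear_matrix]])
    then have "P *v ?I = 0" using m by simp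
    moreover have "P *v ?I = (LINT x|lborel. P *v (indicator (ball c r) x *\<^sub>R f x))"
      by (rule integral_bounded_linear[OF bounded_linear_matrix i, symmetric])
    ultimately have "(LINT x|lborel. P *v (indicator (ball c r) x *\<^sub>R f x)) $ k = 0" by simp
    then show "(LINT x:ball c r|lborel. (P *v f x) $ k) = 0"
      unfolding integral_nth[OF integrable_bounded_linear[OF bounded_linear_matrix i]]
      by (simp add: set_lebesgue_integral_def linear_scale[OF bounded_linear.linear[OF bounded_linear_matrix]])
  qed
  then have "P *v f x = 0" by (simp add: vec_eq_iff)
  then have "f x = E *v f x" by (simp add: P)
  then show ?thesis using E(1)[of "f x"] by simp
qed

text \<open>Up to a constant factor, \<open>D\<close> applied to a Gaussian times \<open>e\<close>.\<close>

definition D_gauss :: "('n::finite \<Rightarrow> complex^'N::finite^'N) \<Rightarrow> complex^'N \<Rightarrow> real^'n \<Rightarrow> complex^'N" where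
  "D_gauss Dh e x = (\<chi> l. ift (\<lambda>\<xi>. (symbol Dh \<xi> *v e) $ l * complex_of_real (gauss \<xi>)) x)"

lemma schwartz_D_gauss: "schwartz (\<lambda>\<xi>. (symbol Dh \<xi> *v e) $ l * complex_of_real (gauss \<xi>))"
  unfolding matrix_vector_mult_def vec_lambda_beta
  by (intro schwartz_cpoly_gauss cpoly_sum cpoly.mult cpoly_symbol cpoly.const)

lemma D_gauss_closed_range:
  assumes p: "p > 1"
  shows "(\<lambda>x. D_gauss Dh e (x - y)) \<in> closed_range Dh p"
proof -
  have s: "schwartz (\<lambda>\<xi>. e $ l * complex_of_real (gauss \<xi>))" for l
    by (intro schwartz_cpoly_gauss cpoly.const)
  have p1: "p \<ge> 1" "p > 0" using p by auto
  from RangeI[OF D_graph_ift[where y = y and Dh = Dh, OF s p1(1)]]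
  have "(\<lambda>x. D_gauss Dh e (x - y)) \<in> Range (D_graph Dh p)"
    by (simp add: D_gauss_def matrix_vector_mult_def sum_distrib_right mult.assoc)
  then show ?thesis by (rule in_closed_range[OF _ p1(2)])
qed

lemma D_gauss_continuous: "continuous_on UNIV (\<lambda>x. D_gauss Dh e (x - y) $ l)"
  unfolding D_gauss_def vec_lambda_beta
  by (rule continuous_on_compose2[OF ift_continuous[OF schwartz_D_gauss]]) (auto intro!: continuous_intros)

text \<open>Injectivity of the transform gives the relation for the symbol at every frequency; at
  the j-th unit vector the symbol is the j-th coefficient, and the Gaussian factor is not
  zero.\<close>

lemma D_gauss_separates:
  assumes "\<And>x. (\<Sum>l\<in>UNIV. c l * D_gauss Dh e x $ l) = 0"
  shows "(\<Sum>l\<in>UNIV. c l * (Dh j *v e) $ l) = 0"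
proof -
  let ?h = "\<lambda>l \<xi>. c l * ((symbol Dh \<xi> *v e) $ l * complex_of_real (gauss \<xi>))"
  have s: "schwartz (?h l)" for l by (rule schwartz_cmult[OF schwartz_D_gauss])
  have "ift (\<lambda>\<xi>. \<Sum>l\<in>UNIV. ?h l \<xi>) x = 0" for x
    using assms[of x] by (subst ift_sum[OF schwartzD(3)[OF s]]) (simp add: ift_cmult D_gauss_def)
  from ift_zero_imp_zero[OF schwartz_sum[OF finite UNIV_not_empty s] this, of "axis j 1"]
  have "(\<Sum>l\<in>UNIV. c l * (symbol Dh (axis j 1) *v e) $ l) * complex_of_real (gauss (axis j (1::real))) = 0"
    by (simp add: sum_distrib_right mult.assoc)
  moreover have "symbol Dh (axis j 1) = Dh j"
    by (simp add: vec_eq_iff symbol_nth axis_def if_distrib[of complex_of_real] if_distrib[of "\<lambda>x. x * _"] cong: if_cong)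
  moreover have "gauss (axis j (1::real)) \<noteq> 0" using gauss_bounds(1)[of "axis j 1"] by simp
  ultimately show ?thesis by simp
qed

lemma range_span_induct:
  assumes v: "v \<in> range_span Dh" and S: "vec.subspace S" "\<And>j e. Dh j *v e \<in> S"
  shows "v \<in> S"
proof -
  have "range_span Dh \<subseteq> S" unfolding range_span_def by (rule vec.span_minimal) (use S in auto)
  then show ?thesis using v by blast
qed

text \<open>Averages stay in the span because the closed range consists of functions with values
  there almost everywhere. Conversely, the continuous functions \<open>D_gauss\<close> lie in every
  closed range, so their values lie in the space of averages, and these values already generate the
  ranges of the coefficients.\<close>

lemma V_space_eq:
  fixes Dh :: "'n::finite \<Rightarrow> complex^'N::finite^'N"
  assumes p: "p > 1"
  shows "V_space Dh p = range_span Dh"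
proof
  have p1: "p \<ge> 1" using p by simp
  let ?A = "{(1 / measure lborel (ball c r)) *\<^sub>R (LINT x:ball c r|lborel. v x) | c r v. r > 0 \<and> v \<in> closed_range Dh p}"
  have V: "V_space Dh p = vec.span ?A" by (simp add: V_space_def average_span_def)
  obtain E where E: "\<And>x. E *v x \<in> range_span Dh" "\<And>x. x \<in> range_span Dh \<Longrightarrow> E *v x = x"
    by (rule projection_exists[OF subspace_range_span]) (rule that)
  show "V_space Dh p \<subseteq> range_span Dh"
    unfolding V
  proof (rule vec.span_minimal[OF _ subspace_range_span], clarify)
    fix c :: "real^'n" and r :: real and v assume v: "v \<in> closed_range Dh p"
    then have vL: "v \<in> Lp p" by (simp add: closed_range_def Lp_closure_def)
    note i = ball_integrable[OF vL p1, of c r]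
    have "E *v (LINT x|lborel. indicator (ball c r) x *\<^sub>R v x) = (LINT x|lborel. E *v (indicator (ball c r) x *\<^sub>R v x))"
      by (rule integral_bounded_linear[OF bounded_linear_matrix i, symmetric])
    also have "\<dots> = (LINT x|lborel. indicator (ball c r) x *\<^sub>R v x)"
    proof (rule integral_cong_AE)
      show "AE x in lborel. E *v (indicator (ball c r) x *\<^sub>R v x) = indicator (ball c r) x *\<^sub>R v x"
        using closed_range_AE_range_span[OF v p]
        by eventually_elim (simp add: linear_scale[OF bounded_linear.linear[OF bounded_linear_matrix]] E(2))
    qed (rule borel_measurable_integrable[OF integrable_bounded_linear[OF bounded_linear_matrix i]],
        rule borel_measurable_integrable[OF i])
    finally have "(LINT x|lborel. indicator (ball c r) x *\<^sub>R v x) \<in> range_span Dh" using E(1) by metis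
    from vec.subspace_scale[OF subspace_range_span this, of "complex_of_real (1 / measure lborel (ball c r))"]
    show "(1 / measure lborel (ball c r)) *\<^sub>R (LINT x:ball c r|lborel. v x) \<in> range_span Dh"
      by (simp add: set_lebesgue_integral_def vec_eq_iff scaleR_conv_of_real vector_scalar_mult_def scaleR_vec_def)
  qed
  have S: "vec.subspace (V_space Dh p)" unfolding V by (rule vec.subspace_span)
  show "range_span Dh \<subseteq> V_space Dh p"
  proof
    fix v assume "v \<in> range_span Dh"
    then show "v \<in> V_space Dh p"
    proof (rule range_span_induct[OF _ S])
      fix j e
      obtain E where E: "\<And>x. E *v x \<in> V_space Dh p" "\<And>x. x \<in> V_space Dh p \<Longrightarrow> E *v x = x"
        by (rule projection_exists[OF S]) (rule that)
      define P where "P = mat 1 - E"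
      have P: "P *v x = x - E *v x" for x by (simp add: P_def matrix_vector_mult_diff_rdistrib)
      note mem = D_gauss_closed_range[OF p, of Dh e 0, simplified]
      then have gL: "D_gauss Dh e \<in> Lp p" by (simp add: closed_range_def Lp_closure_def)
      have "D_gauss Dh e x \<in> V_space Dh p" for x
      proof (rule average_in_subspace[OF S])
        show "continuous_on UNIV (\<lambda>x. D_gauss Dh e x $ k)" for k using D_gauss_continuous[of Dh e 0 k] by simp
        show "integrable lborel (\<lambda>x. indicator (ball c r) x *\<^sub>R D_gauss Dh e x)" for c r
          by (rule ball_integrable[OF gL p1])
        show "(1 / measure lborel (ball c r)) *\<^sub>R (LINT x:ball c r|lborel. D_gauss Dh e x) \<in> V_space Dh p" if "r > 0" for c r
          unfolding V by (rule vec.span_base) (use mem that in blast)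
      qed
      then have "P *v D_gauss Dh e x = 0" for x using E(2) by (simp add: P)
      then have "(\<Sum>l\<in>UNIV. P $ k $ l * D_gauss Dh e x $ l) = 0" for k x
        by (simp add: vec_eq_iff matrix_vector_mult_def)
      from D_gauss_separates[OF this] have "P *v (Dh j *v e) = 0"
        by (simp add: vec_eq_iff matrix_vector_mult_def[of P])
      then have "Dh j *v e = E *v (Dh j *v e)" by (simp add: P)
      then show "Dh j *v e \<in> V_space Dh p" using E(1) by metis
    qed
  qed
qed

lemma cinner_average:
  assumes w: "w \<in> Lp p" and p: "p \<ge> 1"
  shows "cinner v (LINT x:ball c r|lborel. w x) = (LINT x:ball c r|lborel. cinner v (w x))"
  unfolding set_lebesgue_integral_def
  by (subst integral_bounded_linear[OF bounded_linear_cinner ball_integrable[OF w p], symmetric])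
     (simp add: linear_scale[OF bounded_linear.linear[OF bounded_linear_cinner]])

section \<open>Characterization by the range of the symbol\<close>

text \<open>Every ball average of \<open>?w\<close> lies in W, so the continuous scalar function
  \<open>cinner v (?w x)\<close> has vanishing ball integrals.\<close>

lemma perp_imp_constant_range:
  fixes Dh :: "'n::finite \<Rightarrow> complex^'N::finite^'N"
  assumes \<kappa>: "\<kappa> > 0"
    and bound: "\<And>\<xi> e. e \<in> range (\<lambda>x. symbol Dh \<xi> *v x) \<Longrightarrow> \<kappa> * norm \<xi> * norm e \<le> norm (symbol Dh \<xi> *v e)"
    and p: "p > 1" and perp: "perp (range_span Dh) (W_space Dh p)"
  shows "constant_range Dh"
proof (rule constant_range_if_perp[OF \<kappa> bound])
  fix h v x assume h: "\<And>l. schwartz (h l)" "\<And>\<xi> m. (\<Sum>l\<in>UNIV. h l \<xi> * symbol Dh \<xi> $ l $ m) = 0" and v: "v \<in> range_span Dh"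
  let ?w = "\<lambda>x. \<chi> l. cnj (ift (h l) x)"
  have w: "?w \<in> null_adjoint Dh p" by (rule null_adjoint_ift[OF p h])
  have wL: "?w \<in> Lp (conj_exp p)" using w by (simp add: null_adjoint_def adjoint_graph_def)
  have p': "conj_exp p \<ge> 1" using conj_exp_gt_1[OF p] by simp
  show "cinner v (?w x) = 0"
  proof (rule continuous_zero_if_ball_integrals_zero[where h = "\<lambda>x. cinner v (?w x)"])
    show "continuous_on UNIV (\<lambda>x. cinner v (?w x))"
      unfolding cinner_def by (simp, intro continuous_intros ift_continuous h)
    fix c :: "real^'n" and r :: real assume r: "r > 0"
    have "(1 / measure lborel (ball c r)) *\<^sub>R (LINT x:ball c r|lborel. ?w x) \<in> W_space Dh p"
      unfolding W_space_def average_span_def by (rule vec.span_base) (use w r in blast)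
    then have "cinner v ((1 / measure lborel (ball c r)) *\<^sub>R (LINT x:ball c r|lborel. ?w x)) = 0"
      using perp v unfolding perp_def by blast
    then have "(1 / measure lborel (ball c r)) *\<^sub>R cinner v (LINT x:ball c r|lborel. ?w x) = 0"
      by (simp only: linear_scale[OF bounded_linear.linear[OF bounded_linear_cinner]])
    moreover have "measure lborel (ball c r) \<noteq> 0" using content_ball_pos[OF r, of c] by simp
    ultimately show "(LINT x:ball c r|lborel. cinner v (?w x)) = 0"
      unfolding cinner_average[OF wL p', symmetric] by simp
  qed
qed

text \<open>Stability localizes the annihilation: if \<phi> f is in the closed range for every test
  function \<phi>, the integral of \<phi> times the pointwise product of f and w vanishes, hence so
  does that product at every point.\<close>

lemma cutoff_stable_imp_constant_range:
  fixes Dh :: "'n::finite \<Rightarrow> complex^'N::finite^'N"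
  assumes \<kappa>: "\<kappa> > 0"
    and bound: "\<And>\<xi> e. e \<in> range (\<lambda>x. symbol Dh \<xi> *v x) \<Longrightarrow> \<kappa> * norm \<xi> * norm e \<le> norm (symbol Dh \<xi> *v e)"
    and p: "p > 1" and stable: "cutoff_stable (closed_range Dh p)"
  shows "constant_range Dh"
proof (rule constant_range_if_perp[OF \<kappa> bound])
  fix h v x assume h: "\<And>l. schwartz (h l)" "\<And>\<xi> m. (\<Sum>l\<in>UNIV. h l \<xi> * symbol Dh \<xi> $ l $ m) = 0" and v: "v \<in> range_span Dh"
  let ?w = "\<lambda>x. \<chi> l. cnj (ift (h l) x)"
  have w: "?w \<in> null_adjoint Dh p" by (rule null_adjoint_ift[OF p h])
  have wL: "?w \<in> Lp (conj_exp p)" using w by (simp add: null_adjoint_def adjoint_graph_def)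
  have base: "cinner (Dh j *v e) (?w x) = 0" for j e
  proof -
    have "cinner (D_gauss Dh e z) (?w x) = 0" for z
    proof -
      \<comment> \<open>At \<open>x' = x\<close> this has the value of \<open>D_gauss\<close> at
        \<open>z\<close>: the translation frees the argument of \<open>D_gauss\<close> while
        \<open>w\<close> stays at \<open>x\<close>.\<close>
      let ?f = "\<lambda>x'. D_gauss Dh e (x' - (x - z))"
      let ?F = "\<lambda>x'. cinner (?f x') (?w x')"
      have f: "?f \<in> closed_range Dh p" by (rule D_gauss_closed_range[OF p])
      then have fL: "?f \<in> Lp p" by (simp add: closed_range_def Lp_closure_def)
      have Fc: "continuous_on UNIV ?F"
        unfolding cinner_def by (simp, intro continuous_intros ift_continuous h D_gauss_continuous)
      have ae: "AE x in lborel. ?F x = 0"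
      proof (rule fundamental_lemma)
        show "?F \<in> borel_measurable borel" by (rule borel_measurable_continuous_onI[OF Fc])
        show "integrable lborel (\<lambda>x. indicator (box a b) x *\<^sub>R ?F x)" for a b
          using integrable_mult_indicator[OF _ cinner_Lp_integrable(2)[OF fL wL p], of "box a b"] by simp
        fix \<phi> :: "real^'n \<Rightarrow> complex" assume \<phi>: "test_function \<phi>"
        have "(\<lambda>x. \<phi> x *s ?f x) \<in> closed_range Dh p"
          by (rule stable[unfolded cutoff_stable_def, rule_format, OF f \<phi>])
        from null_adjoint_pairing[OF w this p]
        show "(LINT x|lborel. \<phi> x * ?F x) = 0" by (simp add: cinner_def sum_distrib_left mult.assoc)
      qed
      have "?F x = 0"
      proof (rule continuous_zero_if_ball_integrals_zero[OF Fc])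
        fix c :: "real^'n" and r :: real
        show "(LINT x:ball c r|lborel. ?F x) = 0"
          unfolding set_lebesgue_integral_def
          by (rule integral_eq_zero_AE) (use ae in eventually_elim, simp)
      qed
      then show ?thesis by simp
    qed
    then have "(\<Sum>l\<in>UNIV. ift (h l) x * D_gauss Dh e z $ l) = 0" for z
      by (simp add: cinner_def mult.commute)
    from D_gauss_separates[OF this, of j] show ?thesis by (simp add: cinner_def mult.commute)
  qed
  have "v \<in> {v. cinner v (?w x) = 0}"
  proof (rule range_span_induct[OF v])
    show "vec.subspace {v. cinner v (?w x) = 0}"
      by (rule vec.subspaceI) (auto simp: cinner_def distrib_right sum.distrib mult.assoc sum_distrib_left[symmetric])
  qed (use base in simp)
  then show "cinner v (?w x) = 0" by simp
qed

lemma closed_range_subset_Lp: "closed_range Dh p \<subseteq> Lp p"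
  by (auto simp: closed_range_def Lp_closure_def)

lemma test_function_Lp:
  assumes "test_function \<zeta>" "u \<in> Lp p" "p > 0"
  shows "(\<lambda>x. \<zeta> x *s u x) \<in> Lp p"
proof -
  obtain B where "\<And>x. norm (\<zeta> x) \<le> B" by (rule test_function_bounded[OF assms(1)]) (rule that)
  then show ?thesis
    by (rule Lp_cutoff[OF assms(2,3) borel_measurable_continuous_onI[OF test_functionD(3)[OF assms(1)]]])
qed

lemma cutoff_stable_iff:
  fixes Dh :: "'n::finite \<Rightarrow> complex^'N::finite^'N"
  assumes \<kappa>: "\<kappa> > 0"
    and bound: "\<And>\<xi> e. e \<in> range (\<lambda>x. symbol Dh \<xi> *v x) \<Longrightarrow> \<kappa> * norm \<xi> * norm e \<le> norm (symbol Dh \<xi> *v e)"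
    and p: "p > 1"
  shows "cutoff_stable (closed_range Dh p) \<longleftrightarrow> constant_range Dh"
proof
  assume K: "constant_range Dh"
  show "cutoff_stable (closed_range Dh p)"
    unfolding cutoff_stable_def
  proof (intro ballI allI impI)
    fix u and \<zeta> :: "real^'n \<Rightarrow> complex" assume u: "u \<in> closed_range Dh p" and \<zeta>: "test_function \<zeta>"
    show "(\<lambda>x. \<zeta> x *s u x) \<in> closed_range Dh p"
    proof (rule closed_range_if_in_range_span[OF K \<kappa> bound p])
      show "(\<lambda>x. \<zeta> x *s u x) \<in> Lp p"
        using test_function_Lp[OF \<zeta>] u closed_range_subset_Lp p by fastforce
      show "AE x in lborel. \<zeta> x *s u x \<in> range_span Dh"
        using closed_range_AE_range_span[OF u p] by eventually_elim (rule vec.subspace_scale[OF subspace_range_span])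
    qed
  qed
qed (rule cutoff_stable_imp_constant_range[OF \<kappa> bound p])

text \<open>The exponents \<open>q\<close> and \<open>r\<close> need no relation, since V does not
  depend on \<open>q\<close>. For the direction from constant range, a vector of V times the
  indicator of a ball lies in the closed range, and its pairing with w is the product of the vector
  with the ball integral of w.\<close>

lemma perp_iff:
  fixes Dh :: "'n::finite \<Rightarrow> complex^'N::finite^'N"
  assumes \<kappa>: "\<kappa> > 0"
    and bound: "\<And>\<xi> e. e \<in> range (\<lambda>x. symbol Dh \<xi> *v x) \<Longrightarrow> \<kappa> * norm \<xi> * norm e \<le> norm (symbol Dh \<xi> *v e)"
    and q: "q > 1" and r: "r > 1"
  shows "perp (V_space Dh q) (W_space Dh r) \<longleftrightarrow> constant_range Dh"
  unfolding V_space_eq[OF q]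
proof
  assume K: "constant_range Dh"
  have r': "conj_exp r \<ge> 1" using conj_exp_gt_1[OF r] by simp
  show "perp (range_span Dh) (W_space Dh r)"
    unfolding perp_def
  proof (intro ballI)
    fix v w assume v: "v \<in> range_span Dh" and w: "w \<in> W_space Dh r"
    have "W_space Dh r \<subseteq> {w. cinner v w = 0}"
      unfolding W_space_def average_span_def
    proof (rule vec.span_minimal, clarify)
      fix c :: "real^'n" and s :: real and w assume w: "w \<in> null_adjoint Dh r"
      then have wL: "w \<in> Lp (conj_exp r)" by (simp add: null_adjoint_def adjoint_graph_def)
      have "(\<lambda>x. indicator (ball c s) x *s v) \<in> closed_range Dh r"
        by (rule closed_range_if_in_range_span[OF K \<kappa> bound r])
           (use r v in \<open>auto intro!: Lp_ball vec.subspace_scale[OF subspace_range_span]\<close>)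
      from null_adjoint_pairing[OF w this r]
      have "(LINT x|lborel. cinner (indicator (ball c s) x *s v) (w x)) = 0" .
      moreover have "cinner (indicator (ball c s) x *s v) (w x) = indicator (ball c s) x *\<^sub>R cinner v (w x)" for x
        by (cases "x \<in> ball c s") (simp_all add: cinner_def)
      ultimately have "(LINT x:ball c s|lborel. cinner v (w x)) = 0"
        by (simp only: set_lebesgue_integral_def)
      then have "cinner v (LINT x:ball c s|lborel. w x) = 0" unfolding cinner_average[OF wL r'] .
      then show "cinner v ((1 / measure lborel (ball c s)) *\<^sub>R (LINT x:ball c s|lborel. w x)) = 0"
        by (simp add: linear_scale[OF bounded_linear.linear[OF bounded_linear_cinner]])
    next
      show "vec.subspace {w. cinner v w = 0}"
        by (rule vec.subspaceI)
           (auto simp: cinner_def distrib_left sum.distrib mult.left_commute sum_distrib_left[symmetric])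
    qed
    then show "cinner v w = 0" using w by blast
  qed
qed (rule perp_imp_constant_range[OF \<kappa> bound r])

text \<open>The whole space L^p is trivially stable under cut-offs, which gives the constant range.
  A vector outside V times the indicator of a ball would violate the almost everywhere description
  of the closed range.\<close>

lemma closed_range_full_iff:
  fixes Dh :: "'n::finite \<Rightarrow> complex^'N::finite^'N"
  assumes \<kappa>: "\<kappa> > 0"
    and bound: "\<And>\<xi> e. e \<in> range (\<lambda>x. symbol Dh \<xi> *v x) \<Longrightarrow> \<kappa> * norm \<xi> * norm e \<le> norm (symbol Dh \<xi> *v e)"
    and p: "p > 1"
  shows "closed_range Dh p = Lp p \<longleftrightarrow> constant_range Dh \<and> range_span Dh = UNIV"
proof
  assume full: "closed_range Dh p = Lp p"
  have "cutoff_stable (closed_range Dh p)"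
    unfolding full cutoff_stable_def using test_function_Lp p by fastforce
  moreover have "e \<in> range_span Dh" for e
  proof (rule ccontr)
    assume e: "e \<notin> range_span Dh"
    have "(\<lambda>x. indicator (ball 0 1) x *s e) \<in> closed_range Dh p"
      unfolding full using p by (intro Lp_ball) simp
    from closed_range_AE_range_span[OF this p]
    have "AE x in lborel. x \<notin> ball (0 :: real^'n) 1"
      by eventually_elim (use e in \<open>auto simp: indicator_def split: if_splits\<close>)
    then have "emeasure lborel (ball (0 :: real^'n) 1) = 0"
      by (subst (asm) AE_iff_measurable[of "ball 0 1"]) auto
    then have "measure lborel (ball (0 :: real^'n) 1) = 0" by (simp add: measure_def)
    then show False using content_ball_pos[of 1 "0 :: real^'n"] by simp
  qed
  ultimately show "constant_range Dh \<and> range_span Dh = UNIV"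
    using cutoff_stable_iff[OF \<kappa> bound p] by auto
next
  assume "constant_range Dh \<and> range_span Dh = UNIV"
  then show "closed_range Dh p = Lp p"
    using closed_range_if_in_range_span[OF _ \<kappa> bound p] closed_range_subset_Lp[of Dh p] by auto
qed

theorem proposition3p19:
  fixes Dh :: "'n::finite \<Rightarrow> complex^'N::finite^'N"
    and \<kappa> \<omega> p q r :: real
  assumes "\<kappa> > 0"
    and "\<And>\<xi> e. e \<in> range (\<lambda>x. symbol Dh \<xi> *v x) \<Longrightarrow> \<kappa> * norm \<xi> * norm e \<le> norm (symbol Dh \<xi> *v e)"
    and "0 \<le> \<omega>" and "\<omega> < pi / 2"
    and "\<And>\<xi>. mat_spectrum (symbol Dh \<xi>) \<subseteq> closed_bisector \<omega>"
    and "1 < p" and "1 < q" and "1 < r"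
  shows "(closed_range Dh p = Lp p \<longrightarrow> cutoff_stable (closed_range Dh p))
    \<and> (closed_range Dh p \<noteq> Lp p \<longrightarrow>
        (cutoff_stable (closed_range Dh p) \<longleftrightarrow> perp (V_space Dh q) (W_space Dh r)))
    \<and> ((\<exists>s>1. closed_range Dh s = Lp s) \<longrightarrow> (\<forall>s>1. closed_range Dh s = Lp s))
    \<and> ((\<exists>s>1. closed_range Dh s \<noteq> Lp s \<and> cutoff_stable (closed_range Dh s)) \<longrightarrow>
        (\<forall>s>1. closed_range Dh s \<noteq> Lp s \<and> cutoff_stable (closed_range Dh s)))"
proof -
  note stable = cutoff_stable_iff[OF assms(1,2)]
  note full = closed_range_full_iff[OF assms(1,2)]
  \<comment> \<open>Stability, orthogonality and fullness are now all stated in terms of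
    \<open>constant_range Dh\<close> and \<open>range_span Dh\<close>, in which no exponent occurs;
    what remains is propositional.\<close>
  show ?thesis
    using stable full perp_iff[OF assms(1,2,7,8)] assms(6) by meson
qed

end
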